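(* Let $\mathbb{Z}[1/2]\subset\mathbb{Q}$ be the subring generated by $1/2$. The cohomology of the discrete group $SL_2(\mathbb{Z}[1/2])$ with trivial integer coefficients satisfies $$H^i(SL_2(\mathbb{Z}[1/2]), \mathbb{Z}) \cong \begin{cases} 0 & \text{if } i \text{ is odd}; \\ \mathbb{Z} \oplus \mathbb{Z}/3 & \text{if } i = 2; \\ \mathbb{Z}/24 \oplus \mathbb{Z}/3 & \text{if } i = 2j \text{ with } j > 1 \text{ an integer}. \end{cases}$$
   Context: $H^*(G,\mathbb{Z})$ denotes group cohomology of the discrete group $G$ with coefficients in the trivial $G$-module $\mathbb{Z}$. All isomorphisms are isomorphisms of abelian groups. *)

theory Defs
  imports
    "HOL-Analysis.Analysis"
    "HOL-Algebra.Algebra"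
    "HOL-Algebra.Algebraic_Closure_Type"
    "HOL-Algebra.Elementary_Groups"
begin

section \<open>Cohomology of a discrete group\<close>

text \<open>
  Cohomology is defined by the inhomogeneous (bar) cochain complex. An \<open>n\<close>-tuple of group elements
  is a list of length \<open>n\<close>, and an \<open>n\<close>-cochain is a function on such lists, extended by \<open>0\<close> to all
  other lists so that equality of cochains is equality of functions. The coefficient module is the
  additive group of the type \<open>'a\<close>, on which \<open>G\<close> acts by \<open>act\<close>.
\<close>

definition tuples :: "('g, 'm) monoid_scheme \<Rightarrow> nat \<Rightarrow> 'g list set"
  where "tuples G n = {gs. length gs = n \<and> set gs \<subseteq> carrier G}"

definition cochains :: "('g, 'm) monoid_scheme \<Rightarrow> nat \<Rightarrow> ('g list \<Rightarrow> 'a::ab_group_add) set"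
  where "cochains G n = {f. \<forall>gs. gs \<notin> tuples G n \<longrightarrow> f gs = 0}"

definition signed :: "nat \<Rightarrow> 'a::ab_group_add \<Rightarrow> 'a"
  where "signed k x = (if even k then x else - x)"

text \<open>
  With indices starting at \<open>0\<close>, the value of the coboundary of \<open>f\<close> at \<open>(g\<^sub>0, \<dots>, g\<^sub>n)\<close> is
  \<open>g\<^sub>0 \<cdot> f (g\<^sub>1, \<dots>, g\<^sub>n) + (\<Sum>i<n. (-1)^(i+1) f (g\<^sub>0, \<dots>, g\<^sub>i g\<^sub>i\<^sub>+\<^sub>1, \<dots>, g\<^sub>n)) + (-1)^(n+1) f (g\<^sub>0, \<dots>, g\<^sub>n\<^sub>-\<^sub>1)\<close>.
\<close>

definition coboundary ::
    "('g, 'm) monoid_scheme \<Rightarrow> ('g \<Rightarrow> 'a \<Rightarrow> 'a) \<Rightarrow> nat \<Rightarrow> ('g list \<Rightarrow> 'a) \<Rightarrow> 'g list \<Rightarrow> 'a::ab_group_add"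
  where "coboundary G act n f gs =
    (if gs \<in> tuples G (Suc n) then
       act (hd gs) (f (tl gs))
       + (\<Sum>i<n. signed (Suc i)
            (f (take i gs @ [gs ! i \<otimes>\<^bsub>G\<^esub> gs ! Suc i] @ drop (i + 2) gs)))
       + signed (Suc n) (f (butlast gs))
     else 0)"

definition cocycle_group ::
    "('g, 'm) monoid_scheme \<Rightarrow> ('g \<Rightarrow> 'a \<Rightarrow> 'a) \<Rightarrow> nat \<Rightarrow> ('g list \<Rightarrow> 'a::ab_group_add) monoid"
  where "cocycle_group G act n =
    \<lparr>carrier = {f \<in> cochains G n. coboundary G act n f = (\<lambda>_. 0)},
     monoid.mult = (\<lambda>f f' gs. f gs + f' gs),
     one = (\<lambda>_. 0)\<rparr>"

fun coboundaries ::
    "('g, 'm) monoid_scheme \<Rightarrow> ('g \<Rightarrow> 'a \<Rightarrow> 'a) \<Rightarrow> nat \<Rightarrow> ('g list \<Rightarrow> 'a::ab_group_add) set"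
  where
    "coboundaries G act 0 = {\<lambda>_. 0}"
  | "coboundaries G act (Suc n) = coboundary G act n ` cochains G n"

definition group_cohomology ::
    "('g, 'm) monoid_scheme \<Rightarrow> ('g \<Rightarrow> 'a \<Rightarrow> 'a) \<Rightarrow> nat \<Rightarrow> ('g list \<Rightarrow> 'a::ab_group_add) set monoid"
  where "group_cohomology G act n = cocycle_group G act n Mod coboundaries G act n"

definition trivial_action :: "'g \<Rightarrow> 'a \<Rightarrow> 'a"
  where "trivial_action g a = a"

definition integral_cohomology ::
    "('g, 'm) monoid_scheme \<Rightarrow> nat \<Rightarrow> ('g list \<Rightarrow> int) set monoid"
  where "integral_cohomology G n = group_cohomology G trivial_action n"


section \<open>The group \<open>SL\<^sub>2(\<int>[1/2])\<close>\<close>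

definition SL :: "'a::comm_ring_1 set \<Rightarrow> ('a ^ 'n ^ 'n) monoid"
  where "SL R =
    \<lparr>carrier = {A. (\<forall>i j. A $ i $ j \<in> R) \<and> det A = 1},
     monoid.mult = (**),
     one = mat 1\<rparr>"

definition Z_half :: "rat set"
  where "Z_half = generate_ring ring_of_type_algebra {1/2}"

definition SL2_Z_half :: "(rat ^ 2 ^ 2) monoid"
  where "SL2_Z_half = SL Z_half"

end

theory Submission
  imports Defs "HOL-Library.Function_Algebras"
begin

text \<open>
  \<open>G = SL\<^sub>2(\<int>[1/2])\<close> is generated by elements \<open>a, b, c\<close> of orders 4, 6, 6 with \<open>a\<^sup>2 = b\<^sup>3 = c\<^sup>3 = -1\<close> and
  \<open>babcac = a\<close>. Here \<open>\<langle>a, b\<rangle> = SL\<^sub>2(\<int>)\<close>, while \<open>\<langle>a, c\<rangle>\<close> is its conjugate by \<open>\<eta> = 1 + a\<close>; \<open>G\<close> is the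
  amalgam of the two along \<open>\<langle>a, bab\<rangle>\<close>, the stabiliser of an edge of the tree of \<open>SL\<^sub>2(\<rat>\<^sub>2)\<close>.
  These data define a complex of modules of functions on \<open>G\<close>, periodic of period two from degree two
  on. In degrees at least three its exactness only involves the finite cyclic groups generated by
  \<open>a\<close>, \<open>b\<close>, \<open>c\<close> and \<open>-1\<close>; in degrees zero to two it follows from the trees of \<open>SL\<^sub>2(\<int>)\<close> and
  \<open>SL\<^sub>2(\<rat>\<^sub>2)\<close>. The modules are coinduced, hence acyclic, so dimension shifting identifies the
  cohomology of \<open>G\<close> with that of the complex of constant functions, a complex of free abelian groups
  of rank at most four: the differentials out of even degrees vanish, and those out of odd degrees
  are injective with cokernel \<open>\<int> \<oplus> \<int>/3\<close> at first and \<open>\<int>/24 \<oplus> \<int>/3\<close> later.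
\<close>

text \<open>The theories of formal power series leave the notation of \<open>vec_nth\<close> ambiguous.\<close>

no_notation fps_nth (infixl "$" 75)

section \<open>Quotients of additive groups\<close>

text \<open>Working with one complex for the whole group avoids the connecting maps and extension
  problems of Mayer-Vietoris sequences. The complex is dual to one read off from the presentation:
  generators, then relations, then the identities expressing that -1 is central. It closes up with
  period two because -1 lies in each of the finite cyclic groups, whose own resolutions alternate
  \<open>x - 1\<close> with the norm. The obstacle is the start: degree zero has one component and
  degree one has three, and the absent ones are those that the cyclic arguments would use. The last
  sequence is deduced from the tree of \<open>SL\<^sub>2(\<int>)\<close>. Trees enter only through
  height functions on cosets for which every vertex other than the root has a unique descending
  edge.\<close>

definition additive_subgroup_set :: "'a::ab_group_add set \<Rightarrow> bool"
  where "additive_subgroup_set Z \<longleftrightarrow> 0 \<in> Z \<and> (\<forall>x\<in>Z. \<forall>y\<in>Z. x - y \<in> Z)"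

definition add_group_of :: "'a::ab_group_add set \<Rightarrow> 'a monoid"
  where "add_group_of Z = \<lparr>carrier = Z, monoid.mult = (+), one = 0\<rparr>"

definition quot_group :: "'a::ab_group_add set \<Rightarrow> 'a set \<Rightarrow> 'a set monoid"
  where "quot_group Z B = add_group_of Z Mod B"

lemma additive_subgroup_setD:
  assumes "additive_subgroup_set Z"
  shows "0 \<in> Z" "x \<in> Z \<Longrightarrow> y \<in> Z \<Longrightarrow> x - y \<in> Z" "x \<in> Z \<Longrightarrow> - x \<in> Z"
    "x \<in> Z \<Longrightarrow> y \<in> Z \<Longrightarrow> x + y \<in> Z"
proof -
  show 0: "0 \<in> Z" and d: "\<And>x y. x \<in> Z \<Longrightarrow> y \<in> Z \<Longrightarrow> x - y \<in> Z"
    using assms by (auto simp: additive_subgroup_set_def)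
  show m: "- x \<in> Z" if "x \<in> Z" for x
    using d[OF 0 that] by simp
  show "x + y \<in> Z" if "x \<in> Z" "y \<in> Z"
    using d[OF that(1) m[OF that(2)]] by simp
qed

lemma comm_group_add_group_of:
  assumes "additive_subgroup_set Z"
  shows "comm_group (add_group_of Z)"
proof (rule comm_groupI)
  fix x assume "x \<in> carrier (add_group_of Z)"
  then show "\<exists>y\<in>carrier (add_group_of Z). y \<otimes>\<^bsub>add_group_of Z\<^esub> x = \<one>\<^bsub>add_group_of Z\<^esub>"
    using additive_subgroup_setD[OF assms] by (intro bexI[of _ "- x"]) (auto simp: add_group_of_def)
qed (use additive_subgroup_setD[OF assms] in \<open>auto simp: add_group_of_def algebra_simps\<close>)

lemma quot_group_iso_hom:
  assumes Z: "additive_subgroup_set Z" and H: "group H"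
    and mem: "\<And>x. x \<in> Z \<Longrightarrow> \<theta> x \<in> carrier H"
    and add: "\<And>x y. x \<in> Z \<Longrightarrow> y \<in> Z \<Longrightarrow> \<theta> (x + y) = \<theta> x \<otimes>\<^bsub>H\<^esub> \<theta> y"
    and surj: "\<And>h. h \<in> carrier H \<Longrightarrow> \<exists>x\<in>Z. \<theta> x = h"
    and B: "B \<subseteq> Z"
    and ker: "\<And>x. x \<in> Z \<Longrightarrow> \<theta> x = \<one>\<^bsub>H\<^esub> \<longleftrightarrow> x \<in> B"
  shows "quot_group Z B \<cong> H"
proof -
  interpret comm_group "add_group_of Z" by (rule comm_group_add_group_of[OF Z])
  interpret group_hom "add_group_of Z" H \<theta>
    by (intro group_hom.intro group_hom_axioms.intro is_group H homI)
      (use mem add in \<open>auto simp: add_group_of_def\<close>)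
  have k: "kernel (add_group_of Z) H \<theta> = B"
    using B ker by (auto simp: kernel_def add_group_of_def)
  have s: "\<theta> ` carrier (add_group_of Z) = carrier H"
    using mem surj by (fastforce simp: add_group_of_def)
  show ?thesis
    using FactGroup_iso[OF s] by (simp add: k quot_group_def)
qed

lemma group_quot_group:
  assumes Z: "additive_subgroup_set Z" and B: "additive_subgroup_set B" and "B \<subseteq> Z"
  shows "group (quot_group Z B)"
proof -
  interpret comm_group "add_group_of Z" by (rule comm_group_add_group_of[OF Z])
  have "subgroup B (add_group_of Z)"
  proof (rule subgroupI)
    show "B \<subseteq> carrier (add_group_of Z)" using assms(3) by (simp add: add_group_of_def)
    show "B \<noteq> {}" using additive_subgroup_setD[OF B] by auto
    fix x assume x: "x \<in> B"
    then have "inv\<^bsub>add_group_of Z\<^esub> x = - x"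
      using assms(3) additive_subgroup_setD[OF Z]
      by (intro inv_equality) (auto simp: add_group_of_def)
    then show "inv\<^bsub>add_group_of Z\<^esub> x \<in> B" using x additive_subgroup_setD[OF B] by auto
  next
    fix x y assume "x \<in> B" "y \<in> B"
    then show "x \<otimes>\<^bsub>add_group_of Z\<^esub> y \<in> B"
      using additive_subgroup_setD[OF B] by (simp add: add_group_of_def)
  qed
  then have "B \<lhd> add_group_of Z" by (rule normal_iff_subgroup[THEN iffD2])
  then show ?thesis unfolding quot_group_def by (rule normal.factorgroup_is_group)
qed

text \<open>The composite of \<open>pr\<close> with the projection to cosets of \<open>B\<close> is
  onto with kernel \<open>N\<close>. Both projections of an additive relation have this
  shape.\<close>

lemma quot_group_iso_surj:
  fixes pr :: "'a::ab_group_add \<Rightarrow> 'x::ab_group_add"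
  assumes W: "additive_subgroup_set W"
    and ZB: "additive_subgroup_set Z" "additive_subgroup_set B" "B \<subseteq> Z"
    and add: "\<And>p q. pr (p + q) = pr p + pr q"
    and img: "pr ` W = Z" and N: "N = {p \<in> W. pr p \<in> B}"
  shows "quot_group W N \<cong> quot_group Z B"
proof -
  have coset: "{} \<noteq> B #>\<^bsub>add_group_of Z\<^esub> x \<and> (B #>\<^bsub>add_group_of Z\<^esub> x = B \<longleftrightarrow> x \<in> B)" for x :: 'x
  proof -
    have e: "B #>\<^bsub>add_group_of Z\<^esub> x = (\<lambda>b. b + x) ` B" by (auto simp: r_coset_def add_group_of_def)
    note D = additive_subgroup_setD[OF ZB(2)]
    have "(\<lambda>b. b + x) ` B = B \<longleftrightarrow> x \<in> B"
    proof
      assume "(\<lambda>b. b + x) ` B = B"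
      then show "x \<in> B" using D(1) by (metis add_0 imageI)
    next
      assume x: "x \<in> B"
      show "(\<lambda>b. b + x) ` B = B"
      proof (intro equalityI subsetI)
        fix y assume "y \<in> B"
        then have "y - x \<in> B" using x D by blast
        then show "y \<in> (\<lambda>b. b + x) ` B" by (intro image_eqI[of _ _ "y - x"]) auto
      qed (use x D in auto)
    qed
    then show ?thesis using e D(1) by auto
  qed
  have mult: "(B #>\<^bsub>add_group_of Z\<^esub> (x + y)) = (B #>\<^bsub>add_group_of Z\<^esub> x) <#>\<^bsub>add_group_of Z\<^esub> (B #>\<^bsub>add_group_of Z\<^esub> y)" for x y :: 'x
  proof -
    note D = additive_subgroup_setD[OF ZB(2)]
    show ?thesis
    proof (intro equalityI subsetI)
      fix w assume "w \<in> B #>\<^bsub>add_group_of Z\<^esub> (x + y)"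
      then obtain b where "b \<in> B" "w = b + (x + y)" by (auto simp: r_coset_def add_group_of_def)
      then have "w = (b + x) + (0 + y)" by (simp add: algebra_simps)
      moreover have "b + x \<in> B #>\<^bsub>add_group_of Z\<^esub> x" "0 + y \<in> B #>\<^bsub>add_group_of Z\<^esub> y"
        using \<open>b \<in> B\<close> D(1) by (force simp: r_coset_def add_group_of_def)+
      ultimately show "w \<in> (B #>\<^bsub>add_group_of Z\<^esub> x) <#>\<^bsub>add_group_of Z\<^esub> (B #>\<^bsub>add_group_of Z\<^esub> y)"
        by (auto simp: set_mult_def add_group_of_def)
    next
      fix w assume "w \<in> (B #>\<^bsub>add_group_of Z\<^esub> x) <#>\<^bsub>add_group_of Z\<^esub> (B #>\<^bsub>add_group_of Z\<^esub> y)"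
      then obtain b b' where b: "b \<in> B" "b' \<in> B" "w = (b + x) + (b' + y)"
        by (auto simp: set_mult_def r_coset_def add_group_of_def)
      then have "w = (b + b') + (x + y)" by (simp add: algebra_simps)
      then show "w \<in> B #>\<^bsub>add_group_of Z\<^esub> (x + y)"
        using b D(4) by (auto simp: r_coset_def add_group_of_def)
    qed
  qed
  show ?thesis
  proof (rule quot_group_iso_hom[OF W group_quot_group[OF ZB],
        where \<theta> = "\<lambda>p. B #>\<^bsub>add_group_of Z\<^esub> pr p"])
    fix p assume "p \<in> W"
    then show "B #>\<^bsub>add_group_of Z\<^esub> pr p \<in> carrier (quot_group Z B)"
      using img by (auto simp: quot_group_def FactGroup_def RCOSETS_def add_group_of_def)
    show "B #>\<^bsub>add_group_of Z\<^esub> pr p = \<one>\<^bsub>quot_group Z B\<^esub> \<longleftrightarrow> p \<in> N"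
      using coset[of "pr p"] \<open>p \<in> W\<close> by (simp add: quot_group_def FactGroup_def N)
  next
    fix p q assume "p \<in> W" "q \<in> W"
    show "B #>\<^bsub>add_group_of Z\<^esub> pr (p + q) =
      (B #>\<^bsub>add_group_of Z\<^esub> pr p) \<otimes>\<^bsub>quot_group Z B\<^esub> (B #>\<^bsub>add_group_of Z\<^esub> pr q)"
      by (simp add: add mult quot_group_def FactGroup_def)
  next
    fix h assume "h \<in> carrier (quot_group Z B)"
    then obtain z where "z \<in> Z" "h = B #>\<^bsub>add_group_of Z\<^esub> z"
      by (auto simp: quot_group_def FactGroup_def RCOSETS_def add_group_of_def)
    then show "\<exists>p\<in>W. B #>\<^bsub>add_group_of Z\<^esub> pr p = h" using img by (metis imageE)
  qed (auto simp: N)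
qed

text \<open>Additive relations: the connecting homomorphisms of homological algebra are of this kind.\<close>

lemma quot_group_iso_rel:
  assumes Z1: "additive_subgroup_set Z1" and B1: "additive_subgroup_set B1" "B1 \<subseteq> Z1"
    and Z2: "additive_subgroup_set Z2" and B2: "additive_subgroup_set B2" "B2 \<subseteq> Z2"
    and R: "\<And>x y. R x y \<Longrightarrow> x \<in> Z1 \<and> y \<in> Z2"
    and zero: "R 0 0"
    and diff: "\<And>x y x' y'. R x y \<Longrightarrow> R x' y' \<Longrightarrow> R (x - x') (y - y')"
    and tot: "\<And>x. x \<in> Z1 \<Longrightarrow> \<exists>y. R x y" and surj: "\<And>y. y \<in> Z2 \<Longrightarrow> \<exists>x. R x y"
    and ker: "\<And>x y. R x y \<Longrightarrow> x \<in> B1 \<longleftrightarrow> y \<in> B2"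
  shows "quot_group Z1 B1 \<cong> quot_group Z2 B2"
proof -
  \<comment> \<open>The relation is a subgroup of the product. Both projections are onto, and
    \<open>ker\<close> says that \<open>B1\<close> and \<open>B2\<close> have the same preimage
    \<open>N\<close> in it.\<close>
  define W where "W = {p. R (fst p) (snd p)}"
  define N where "N = {p \<in> W. fst p \<in> B1}"
  have W: "additive_subgroup_set W"
    using zero diff by (auto simp: additive_subgroup_set_def W_def)
  have img: "fst ` W = Z1" "snd ` W = Z2"
    using R tot surj by (auto simp: W_def image_iff)
  have N: "N = {p \<in> W. snd p \<in> B2}"
    using ker by (auto simp: N_def W_def)
  have "quot_group W N \<cong> quot_group Z1 B1"
    by (rule quot_group_iso_surj[OF W Z1 B1 _ img(1) N_def]) simp
  moreover have "quot_group W N \<cong> quot_group Z2 B2"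
    by (rule quot_group_iso_surj[OF W Z2 B2 _ img(2) N]) simp
  moreover have "group (quot_group W N)"
  proof (rule group_quot_group[OF W])
    show "additive_subgroup_set N"
      using zero diff additive_subgroup_setD[OF B1(1)]
      by (auto simp: additive_subgroup_set_def W_def N_def)
  qed (auto simp: N_def)
  ultimately show ?thesis
    using group.iso_sym iso_trans by blast
qed

section \<open>Inhomogeneous cochains\<close>

text \<open>With the group as a type there are no carrier conditions, so words in the generators can
  be normalised by plain rewriting.\<close>

class group_mult = monoid_mult + inverse +
  assumes left_inverse_mult: "inverse x * x = 1"
begin

lemma inverse_mult_cancel [simp]: "inverse x * (x * y) = y"
  by (metis left_inverse_mult mult_1_left mult.assoc)

lemma right_inverse_mult: "x * inverse x = 1"
  by (metis inverse_mult_cancel left_inverse_mult mult_1_right)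

lemma mult_inverse_cancel [simp]: "x * (inverse x * y) = y"
  by (metis right_inverse_mult mult_1_left mult.assoc)

lemma mult_left_cancel_group: "x * y = x * z \<longleftrightarrow> y = z"
  by (metis inverse_mult_cancel)

lemma inverse_unique_group: "x * y = 1 \<Longrightarrow> inverse x = y"
  by (metis inverse_mult_cancel mult_1_right)

lemma inverse_mult_distrib_group: "inverse (x * y) = inverse y * inverse x"
  by (rule inverse_unique_group) (metis mult.assoc mult_inverse_cancel right_inverse_mult)

lemma inverse_inverse_group [simp]: "inverse (inverse x) = x"
  by (rule inverse_unique_group) (rule left_inverse_mult)

end

text \<open>The part \<open>f (g\<^sub>0 g\<^sub>1, g\<^sub>2, \<dots>) - f (g\<^sub>0, g\<^sub>1 g\<^sub>2, \<dots>) + \<dots>\<close> of the coboundary that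
  does not involve the action.\<close>

fun merge :: "('g::times list \<Rightarrow> 'a::ab_group_add) \<Rightarrow> 'g list \<Rightarrow> 'a" where
  "merge f [] = 0"
| "merge f [g] = f []"
| "merge f (g # h # r) = f ((g * h) # r) - merge (\<lambda>l. f (g # l)) (h # r)"

lemma merge_cong:
  "(\<And>l. Suc (length l) = length gs \<Longrightarrow> f l = f' l) \<Longrightarrow> merge f gs = merge f' gs"
  by (induction f gs arbitrary: f' rule: merge.induct) auto

lemma merge_additive:
  assumes "Modules.additive \<phi>"
  shows "merge (\<lambda>l. \<phi> (f l)) gs = \<phi> (merge f gs)"
  by (induction f gs rule: merge.induct) (auto simp: additive.zero[OF assms] additive.diff[OF assms])

lemma merge_diff: "merge (\<lambda>l. f l - f' l) gs = merge f gs - merge f' gs"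
  by (induction f gs arbitrary: f' rule: merge.induct) auto

lemma merge_zero: "merge (\<lambda>_. 0) gs = 0"
  using merge_diff[of "\<lambda>_. 0" "\<lambda>_. 0" gs] by simp

text \<open>Unfolding the multiplication at the front produces the same expression twice with
  opposite signs, equal by associativity, and a double \<open>merge\<close> over the shorter list,
  which vanishes by induction.\<close>

lemma merge_merge: "merge (merge f) gs = 0" for gs :: "'g::semigroup_mult list"
proof (induction f gs rule: merge.induct)
  case (3 f g h r)
  show ?case
  proof (cases r)
    case Nil
    then show ?thesis by simp
  next
    case (Cons h' r')
    have "merge (\<lambda>l. merge f (g # l)) (h # r)
      = merge (\<lambda>l. f (g * hd l # tl l) - merge (\<lambda>l'. f (g # l')) l) (h # r)"
    proof (rule merge_cong)
      fix l :: "'g list"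
      assume "Suc (length l) = length (h # r)"
      then obtain x l' where "l = x # l'" using Cons by (cases l) auto
      then show "merge f (g # l) = f (g * hd l # tl l) - merge (\<lambda>l'. f (g # l')) l" by simp
    qed
    then show ?thesis
      using 3 Cons by (simp add: merge_diff mult.assoc)
  qed
qed auto

text \<open>The degree is read off from the length of the list, so one operator serves all degrees;
  no coboundary has degree zero, whence the value \<open>0\<close> at the empty list.\<close>

fun cob :: "('g::times \<Rightarrow> 'm \<Rightarrow> 'm) \<Rightarrow> ('g list \<Rightarrow> 'm::ab_group_add) \<Rightarrow> 'g list \<Rightarrow> 'm" where
  "cob act f [] = 0"
| "cob act f (g # r) = act g (f r) - merge f (g # r)"

definition cochain :: "'m::zero set \<Rightarrow> nat \<Rightarrow> ('g list \<Rightarrow> 'm) set"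
  where "cochain N n = {f. (\<forall>l. length l = n \<longrightarrow> f l \<in> N) \<and> (\<forall>l. length l \<noteq> n \<longrightarrow> f l = 0)}"

lemma cob_cob:
  fixes f :: "'g::group_mult list \<Rightarrow> 'm::ab_group_add"
  assumes add: "\<And>g. Modules.additive (act g)" and act: "\<And>g h m. act g (act h m) = act (g * h) m"
  shows "cob act (cob act f) = 0"
proof
  fix gs :: "'g list"
  show "cob act (cob act f) gs = 0 gs"
  proof (cases "\<exists>g h r. gs = g # h # r")
    case True
    then obtain g h r where gs: "gs = g # h # r" by blast
    have "merge (cob act f) gs = merge (\<lambda>l. act (hd l) (f (tl l)) - merge f l) gs"
    proof (rule merge_cong)
      fix l :: "'g list"
      assume "Suc (length l) = length gs"
      then obtain x l' where "l = x # l'" using gs by (cases l) auto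
      then show "cob act f l = act (hd l) (f (tl l)) - merge f l" by simp
    qed
    also have "\<dots> = act (g * h) (f r) - merge (\<lambda>l. act g (f l)) (h # r)"
      unfolding merge_diff merge_merge by (simp only: gs merge.simps list.sel diff_zero)
    also have "\<dots> = act g (cob act f (h # r))"
      by (simp only: merge_additive[OF add] cob.simps additive.diff[OF add] act)
    finally show ?thesis by (simp add: gs)
  next
    case False
    then show ?thesis by (cases gs; cases "tl gs") (auto simp: additive.zero[OF add])
  qed
qed

lemma cob_supp:
  assumes "\<And>l. length l \<noteq> n \<Longrightarrow> f l = 0"
    and "\<And>g. act g 0 = 0" and "length gs \<noteq> Suc n"
  shows "cob act f gs = 0"
proof (cases gs)
  case (Cons g r)
  have "merge f gs = merge (\<lambda>_. 0) gs"
    by (rule merge_cong) (use assms in auto)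
  also have "\<dots> = 0" by (rule merge_zero)
  finally show ?thesis using assms Cons by simp
qed simp

section \<open>Dimension shifting along an acyclic resolution\<close>

text \<open>All modules are subsets of a single type, because a type cannot depend on the degree
  \<open>q\<close>; \<open>eps\<close> embeds the trivial module of integers as the kernel of
  \<open>d 0\<close>.\<close>

locale acyclic_resolution =
  fixes act :: "'g::group_mult \<Rightarrow> 'm::ab_group_add \<Rightarrow> 'm"
    and M :: "nat \<Rightarrow> 'm set" and d :: "nat \<Rightarrow> 'm \<Rightarrow> 'm" and eps :: "int \<Rightarrow> 'm"
  assumes act_additive: "Modules.additive (act g)"
    and act_act: "act g (act h m) = act (g * h) m"
    and act_M: "m \<in> M q \<Longrightarrow> act g m \<in> M q"
    and M_subgroup: "additive_subgroup_set (M q)"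
    and d_additive: "Modules.additive (d q)"
    and d_M: "m \<in> M q \<Longrightarrow> d q m \<in> M (Suc q)"
    and d_act: "d q (act g m) = act g (d q m)"
    and d_d: "m \<in> M q \<Longrightarrow> d (Suc q) (d q m) = 0"
    and exact: "m \<in> M (Suc q) \<Longrightarrow> d (Suc q) m = 0 \<Longrightarrow> \<exists>n\<in>M q. d q n = m"
    and eps_additive: "Modules.additive eps"
    and eps_eq_0: "eps k = 0 \<Longrightarrow> k = 0"
    and eps_M: "eps k \<in> M 0"
    and d_eps: "d 0 (eps k) = 0"
    and act_eps: "act g (eps k) = eps k"
    and exact_eps: "m \<in> M 0 \<Longrightarrow> d 0 m = 0 \<Longrightarrow> \<exists>k. eps k = m"
    and acyclic: "F \<in> cochain (M q) (Suc p) \<Longrightarrow> cob act F = 0 \<Longrightarrow> \<exists>E\<in>cochain (M q) p. cob act E = F"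
begin

section \<open>Cocycles with values in the kernels, and the connecting isomorphism\<close>

definition Ker :: "nat \<Rightarrow> 'm set"
  where "Ker q = {m \<in> M q. d q m = 0}"

definition Zc :: "nat \<Rightarrow> nat \<Rightarrow> ('g list \<Rightarrow> 'm) set"
  where "Zc p q = {F \<in> cochain (Ker q) p. cob act F = 0}"

definition Bc :: "nat \<Rightarrow> nat \<Rightarrow> ('g list \<Rightarrow> 'm) set"
  where "Bc p q = cob act ` cochain (Ker q) p"

text \<open>The image of the cocycles of \<open>M q\<close> in those of \<open>Ker (Suc q)\<close>.
  In positive degrees these are the usual coboundaries (\<open>Bd_Suc\<close>); in degree zero they
  are what dimension shifting has to divide by.\<close>

definition Bd :: "nat \<Rightarrow> nat \<Rightarrow> ('g list \<Rightarrow> 'm) set"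
  where "Bd p q = (\<lambda>E l. d q (E l)) ` {E \<in> cochain (M q) p. cob act E = 0}"

lemmas act_0 [simp] = additive.zero[OF act_additive]
lemmas d_0 [simp] = additive.zero[OF d_additive]
lemmas eps_0 [simp] = additive.zero[OF eps_additive]

lemma cob_diff: "cob act (E - E') = cob act E - cob act E'"
proof
  fix l show "cob act (E - E') l = (cob act E - cob act E') l"
    using merge_diff[of E E'] by (cases l) (auto simp: additive.diff[OF act_additive] fun_diff_def)
qed

lemma cob_0 [simp]: "cob act 0 = 0"
  using cob_diff[of 0 0] by simp

lemma cob_d: "cob act (\<lambda>l. d q (E l)) = (\<lambda>l. d q (cob act E l))"
proof
  fix l show "cob act (\<lambda>l. d q (E l)) l = d q (cob act E l)"
    by (cases l) (auto simp: additive.diff[OF d_additive] merge_additive[OF d_additive] d_act)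
qed

lemma cob_cob_act: "cob act (cob act F) = 0"
  by (rule cob_cob[OF act_additive act_act])

lemma merge_mem:
  assumes "additive_subgroup_set N" and "\<And>l. Suc (length l) = length gs \<Longrightarrow> f l \<in> N"
  shows "merge f gs \<in> N"
  using assms(2)
proof (induction f gs rule: merge.induct)
  case (3 f g h r)
  then show ?case using additive_subgroup_setD(2)[OF assms(1)] by simp
qed (auto simp: additive_subgroup_setD[OF assms(1)])

lemma Ker_subgroup: "additive_subgroup_set (Ker q)"
  using additive_subgroup_setD[OF M_subgroup] by (auto simp: Ker_def additive_subgroup_set_def additive.diff[OF d_additive])

lemma act_Ker: "m \<in> Ker q \<Longrightarrow> act g m \<in> Ker q"
  by (simp add: Ker_def act_M d_act)

lemma cob_cochain:
  assumes N: "additive_subgroup_set N" "\<And>g m. m \<in> N \<Longrightarrow> act g m \<in> N" and F: "F \<in> cochain N n"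
  shows "cob act F \<in> cochain N (Suc n)"
proof -
  have "cob act F l \<in> N" if "length l = Suc n" for l
  proof (cases l)
    case (Cons g r)
    then have "merge F l \<in> N" "act g (F r) \<in> N"
      using F that by (auto intro!: merge_mem[OF N(1)] N(2) simp: cochain_def)
    then show ?thesis using Cons additive_subgroup_setD(2)[OF N(1)] by simp
  qed (use that in simp)
  moreover have "cob act F l = 0" if "length l \<noteq> Suc n" for l
    using F that by (intro cob_supp[of n]) (auto simp: cochain_def)
  ultimately show ?thesis by (simp add: cochain_def)
qed

lemma cochain_subgroup: "additive_subgroup_set N \<Longrightarrow> additive_subgroup_set (cochain N n)"
  unfolding additive_subgroup_set_def by (auto simp: cochain_def)

lemma d_cochain: "E \<in> cochain (M q) p \<Longrightarrow> (\<lambda>l. d q (E l)) \<in> cochain (Ker (Suc q)) p"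
  by (auto simp: cochain_def Ker_def d_M d_d)

lemma cochain_Ker_D:
  assumes "E \<in> cochain (Ker q) p"
  shows "E \<in> cochain (M q) p" "d q (E l) = 0"
  using assms by (auto simp: cochain_def Ker_def)

lemma lift_cochain:
  assumes "Y \<in> cochain (Ker (Suc q)) p"
  obtains E where "E \<in> cochain (M q) p" "(\<lambda>l. d q (E l)) = Y"
proof -
  have "\<exists>m\<in>M q. d q m = Y l" if "length l = p" for l
    using assms that exact by (auto simp: cochain_def Ker_def)
  then obtain e where e: "\<And>l. length l = p \<Longrightarrow> e l \<in> M q \<and> d q (e l) = Y l" by metis
  show ?thesis
    by (rule that[of "\<lambda>l. if length l = p then e l else 0"])
      (use e assms in \<open>auto simp: cochain_def fun_eq_iff\<close>)
qed

lemma Zc_subgroup: "additive_subgroup_set (Zc p q)"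
  using additive_subgroup_setD[OF cochain_subgroup[OF Ker_subgroup]]
  by (auto simp: Zc_def additive_subgroup_set_def cob_diff)

lemma Bc_subgroup: "additive_subgroup_set (Bc p q)"
  unfolding additive_subgroup_set_def
proof (intro conjI ballI)
  note S = additive_subgroup_setD[OF cochain_subgroup[OF Ker_subgroup, of q p]]
  show "0 \<in> Bc p q" using S(1) by (auto simp: Bc_def image_iff intro!: bexI[of _ 0])
  fix x y assume "x \<in> Bc p q" "y \<in> Bc p q"
  then obtain E E' where "E \<in> cochain (Ker q) p" "x = cob act E" "E' \<in> cochain (Ker q) p" "y = cob act E'"
    by (auto simp: Bc_def)
  then show "x - y \<in> Bc p q" using S(2) by (auto simp: Bc_def cob_diff[symmetric] intro!: imageI)
qed

lemma Bd_subgroup: "additive_subgroup_set (Bd p q)"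
  unfolding additive_subgroup_set_def
proof (intro conjI ballI)
  note S = additive_subgroup_setD[OF cochain_subgroup[OF M_subgroup, of q p]]
  show "0 \<in> Bd p q" using S(1) by (auto simp: Bd_def image_iff fun_eq_iff intro!: exI[of _ 0])
  fix x y assume "x \<in> Bd p q" "y \<in> Bd p q"
  then obtain E E' where E: "E \<in> cochain (M q) p" "cob act E = 0" "x = (\<lambda>l. d q (E l))"
      "E' \<in> cochain (M q) p" "cob act E' = 0" "y = (\<lambda>l. d q (E' l))"
    by (auto simp: Bd_def)
  then have "E - E' \<in> {E \<in> cochain (M q) p. cob act E = 0}" "x - y = (\<lambda>l. d q ((E - E') l))"
    using S(2) by (auto simp: cob_diff additive.diff[OF d_additive])
  then show "x - y \<in> Bd p q" unfolding Bd_def by blast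
qed

lemma Bc_subset: "Bc p q \<subseteq> Zc (Suc p) q"
  using cob_cochain[OF Ker_subgroup act_Ker] by (auto simp: Bc_def Zc_def cob_cob_act)

lemma Bd_subset: "Bd p q \<subseteq> Zc p (Suc q)"
  using d_cochain by (auto simp: Bd_def Zc_def cob_d fun_eq_iff)

text \<open>The connecting map of \<open>0 \<rightarrow> Ker q \<rightarrow> M q \<rightarrow> Ker
  (Suc q) \<rightarrow> 0\<close>, read as the relation between \<open>cob act E\<close> and
  \<open>d q\<close> applied to \<open>E\<close>. Every \<open>f\<close> occurs because
  \<open>M q\<close> is acyclic, every \<open>g\<close> because the resolution is exact.\<close>

lemma connecting_iso: "quot_group (Zc (Suc p) q) (Bc p q) \<cong> quot_group (Zc p (Suc q)) (Bd p q)"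
proof (rule quot_group_iso_rel[OF Zc_subgroup Bc_subgroup Bc_subset Zc_subgroup Bd_subgroup Bd_subset,
      where R = "\<lambda>f g. f \<in> Zc (Suc p) q \<and> g \<in> Zc p (Suc q) \<and>
        (\<exists>E\<in>cochain (M q) p. cob act E = f \<and> (\<lambda>l. d q (E l)) = g)"])
  note S = additive_subgroup_setD[OF cochain_subgroup[OF M_subgroup, of q p]]
  note Z = additive_subgroup_setD[OF Zc_subgroup]
  show "0 \<in> Zc (Suc p) q \<and> 0 \<in> Zc p (Suc q) \<and>
      (\<exists>E\<in>cochain (M q) p. cob act E = 0 \<and> (\<lambda>l. d q (E l)) = 0)"
    using Z(1) S(1) by (auto simp: fun_eq_iff intro!: bexI[of _ 0])
next
  note S = additive_subgroup_setD[OF cochain_subgroup[OF M_subgroup, of q p]]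
  note Z = additive_subgroup_setD[OF Zc_subgroup]
  fix x y x' y'
  assume 1: "x \<in> Zc (Suc p) q \<and> y \<in> Zc p (Suc q) \<and>
      (\<exists>E\<in>cochain (M q) p. cob act E = x \<and> (\<lambda>l. d q (E l)) = y)"
    and 2: "x' \<in> Zc (Suc p) q \<and> y' \<in> Zc p (Suc q) \<and>
      (\<exists>E\<in>cochain (M q) p. cob act E = x' \<and> (\<lambda>l. d q (E l)) = y')"
  then obtain E E' where E: "E \<in> cochain (M q) p" "cob act E = x" "(\<lambda>l. d q (E l)) = y"
    "E' \<in> cochain (M q) p" "cob act E' = x'" "(\<lambda>l. d q (E' l)) = y'" by blast
  then have "E - E' \<in> cochain (M q) p" "cob act (E - E') = x - x'"
    "(\<lambda>l. d q ((E - E') l)) = y - y'"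
    using S(2) by (auto simp: cob_diff additive.diff[OF d_additive])
  then show "x - x' \<in> Zc (Suc p) q \<and> y - y' \<in> Zc p (Suc q) \<and>
      (\<exists>E\<in>cochain (M q) p. cob act E = x - x' \<and> (\<lambda>l. d q (E l)) = y - y')"
    using Z(2) 1 2 by blast
next
  fix f assume f: "f \<in> Zc (Suc p) q"
  then have "f \<in> cochain (M q) (Suc p)" "cob act f = 0" and df: "\<And>l. d q (f l) = 0"
    by (auto simp: Zc_def cochain_Ker_D)
  then obtain E where E: "E \<in> cochain (M q) p" "cob act E = f" using acyclic by blast
  then have "(\<lambda>l. d q (E l)) \<in> Zc p (Suc q)"
    using d_cochain df by (auto simp: Zc_def cob_d fun_eq_iff)
  then show "\<exists>g. f \<in> Zc (Suc p) q \<and> g \<in> Zc p (Suc q) \<and>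
      (\<exists>E\<in>cochain (M q) p. cob act E = f \<and> (\<lambda>l. d q (E l)) = g)"
    using f E by blast
next
  fix g assume g: "g \<in> Zc p (Suc q)"
  then obtain E where E: "E \<in> cochain (M q) p" "(\<lambda>l. d q (E l)) = g"
    using lift_cochain[of g q p] by (auto simp: Zc_def)
  have "(\<lambda>l. d q (cob act E l)) = 0" using g E cob_d[of q E] by (simp add: Zc_def)
  then have "cob act E \<in> Zc (Suc p) q"
    using cob_cochain[OF M_subgroup act_M E(1)]
    by (auto simp: Zc_def cob_cob_act cochain_def Ker_def fun_eq_iff)
  then show "\<exists>f. f \<in> Zc (Suc p) q \<and> g \<in> Zc p (Suc q) \<and>
      (\<exists>E\<in>cochain (M q) p. cob act E = f \<and> (\<lambda>l. d q (E l)) = g)"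
    using g E by blast
next
  note S = additive_subgroup_setD[OF cochain_subgroup[OF M_subgroup, of q p]]
  fix f g
  assume "f \<in> Zc (Suc p) q \<and> g \<in> Zc p (Suc q) \<and>
      (\<exists>E\<in>cochain (M q) p. cob act E = f \<and> (\<lambda>l. d q (E l)) = g)"
  then obtain E where E: "E \<in> cochain (M q) p" "cob act E = f" "(\<lambda>l. d q (E l)) = g" by blast
  show "f \<in> Bc p q \<longleftrightarrow> g \<in> Bd p q"
  proof
    assume "f \<in> Bc p q"
    then obtain E' where E': "E' \<in> cochain (Ker q) p" "cob act E' = f" by (auto simp: Bc_def)
    then have "E' \<in> cochain (M q) p" "\<And>l. d q (E' l) = 0" 
      by (auto simp: cochain_Ker_D)
    then have "E - E' \<in> cochain (M q) p" "cob act (E - E') = 0" "(\<lambda>l. d q ((E - E') l)) = g"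
      using S(2) E E' by (auto simp: cob_diff additive.diff[OF d_additive])
    then show "g \<in> Bd p q" unfolding Bd_def by blast
  next
    assume "g \<in> Bd p q"
    then obtain E' where E': "E' \<in> cochain (M q) p" "cob act E' = 0" "(\<lambda>l. d q (E' l)) = g"
      by (auto simp: Bd_def)
    then have "E - E' \<in> cochain (M q) p" "cob act (E - E') = f" "\<And>l. d q ((E - E') l) = 0"
      using S(2) E by (auto simp: cob_diff additive.diff[OF d_additive] fun_eq_iff)
    then show "f \<in> Bc p q" unfolding Bc_def by (force simp: cochain_def Ker_def)
  qed
qed blast

text \<open>A cocycle with values in the acyclic \<open>M q\<close> is a coboundary, and
  \<open>d\<close> commutes with \<open>cob\<close>; conversely, cochains lift through
  \<open>d\<close>.\<close>

lemma Bd_Suc: "Bd (Suc p) q = Bc p (Suc q)"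
proof (intro equalityI subsetI)
  fix x assume "x \<in> Bd (Suc p) q"
  then obtain E where E: "E \<in> cochain (M q) (Suc p)" "cob act E = 0" "x = (\<lambda>l. d q (E l))"
    by (auto simp: Bd_def)
  then obtain E1 where E1: "E1 \<in> cochain (M q) p" "cob act E1 = E" using acyclic by blast
  then show "x \<in> Bc p (Suc q)"
    using E cob_d[of q E1] d_cochain by (auto simp: Bc_def image_iff intro!: bexI[of _ "\<lambda>l. d q (E1 l)"])
next
  fix x assume "x \<in> Bc p (Suc q)"
  then obtain Y where Y: "Y \<in> cochain (Ker (Suc q)) p" "x = cob act Y" by (auto simp: Bc_def)
  obtain E where E: "E \<in> cochain (M q) p" "(\<lambda>l. d q (E l)) = Y" using lift_cochain[OF Y(1)] .
  have "x = (\<lambda>l. d q (cob act E l))" using Y E cob_d[of q E] by simp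
  then show "x \<in> Bd (Suc p) q"
    using cob_cochain[OF M_subgroup act_M E(1)] by (auto simp: Bd_def cob_cob_act)
qed

lemma dimension_shift:
  "quot_group (Zc (Suc n) q) (Bc n q) \<cong> quot_group (Zc 0 (Suc (n + q))) (Bd 0 (n + q))"
proof (induction n arbitrary: q)
  case 0
  show ?case using connecting_iso[of 0 q] by simp
next
  case (Suc n)
  show ?case
    using iso_trans[OF connecting_iso[of "Suc n" q, unfolded Bd_Suc] Suc.IH[of "Suc q"]] by simp
qed

section \<open>From cocycles of degree zero to invariants\<close>

definition Inv :: "nat \<Rightarrow> 'm set"
  where "Inv q = {m \<in> M q. \<forall>g. act g m = m}"

lemma Inv_subgroup: "additive_subgroup_set (Inv q)"
  using additive_subgroup_setD[OF M_subgroup]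
  by (auto simp: Inv_def additive_subgroup_set_def additive.diff[OF act_additive])

lemma cochain_0_cob:
  assumes "E \<in> cochain N 0"
  shows "cob act E = 0 \<longleftrightarrow> (\<forall>g. act g (E []) = E [])"
proof
  assume "cob act E = 0"
  then have "cob act E [g] = 0" for g by simp
  then show "\<forall>g. act g (E []) = E []" by simp
next
  assume *: "\<forall>g. act g (E []) = E []"
  show "cob act E = 0"
  proof
    fix l :: "'g list"
    consider "length l \<noteq> Suc 0" | g where "l = [g]" by (cases l; cases "tl l") auto
    then show "cob act E l = 0 l"
    proof cases
      case 1
      then show ?thesis using assms by (auto simp: cochain_def intro!: cob_supp[of 0 E])
    qed (simp add: *)
  qed
qed

lemma quot_group_invariants:
  "quot_group (Zc 0 (Suc n)) (Bd 0 n) \<cong> quot_group {m \<in> Inv (Suc n). d (Suc n) m = 0} (d n ` Inv n)"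
proof (rule quot_group_iso_rel[OF Zc_subgroup Bd_subgroup Bd_subset,
      where R = "\<lambda>F m. F \<in> Zc 0 (Suc n) \<and> m = F []"])
  show "additive_subgroup_set {m \<in> Inv (Suc n). d (Suc n) m = 0}"
    using additive_subgroup_setD[OF Inv_subgroup]
    by (auto simp: additive_subgroup_set_def additive.diff[OF d_additive])
  show "additive_subgroup_set (d n ` Inv n)"
    using additive_subgroup_setD[OF Inv_subgroup]
    unfolding additive_subgroup_set_def
  proof (intro conjI ballI)
    note S = additive_subgroup_setD[OF Inv_subgroup[of n]]
    show "0 \<in> d n ` Inv n" using S(1) by (auto simp: image_iff intro!: bexI[of _ 0])
    fix x y assume "x \<in> d n ` Inv n" "y \<in> d n ` Inv n"
    then show "x - y \<in> d n ` Inv n"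
      using S(2) by (auto simp: additive.diff[OF d_additive, symmetric])
  qed
  show "d n ` Inv n \<subseteq> {m \<in> Inv (Suc n). d (Suc n) m = 0}"
    by (auto simp: Inv_def d_M d_d d_act[symmetric])
  show "F \<in> Zc 0 (Suc n) \<and> m \<in> {m \<in> Inv (Suc n). d (Suc n) m = 0}"
    if "F \<in> Zc 0 (Suc n) \<and> m = F []" for F m
    using that cochain_0_cob[of F] by (auto simp: Zc_def Inv_def cochain_def Ker_def)
  show "0 \<in> Zc 0 (Suc n) \<and> 0 = (0::'g list \<Rightarrow> 'm) []"
    using additive_subgroup_setD[OF Zc_subgroup] by auto
  show "x - x' \<in> Zc 0 (Suc n) \<and> y - y' = (x - x') []"
    if "x \<in> Zc 0 (Suc n) \<and> y = x []" "x' \<in> Zc 0 (Suc n) \<and> y' = x' []" for x y x' y'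
    using that additive_subgroup_setD[OF Zc_subgroup] by auto
  show "\<exists>F. F \<in> Zc 0 (Suc n) \<and> m = F []" if "m \<in> {m \<in> Inv (Suc n). d (Suc n) m = 0}" for m
  proof (intro exI conjI)
    let ?F = "\<lambda>l. if l = [] then m else 0"
    have "?F \<in> cochain (Ker (Suc n)) 0" using that by (auto simp: cochain_def Ker_def Inv_def)
    then show "?F \<in> Zc 0 (Suc n)" using that cochain_0_cob[of ?F] by (auto simp: Zc_def Inv_def)
  qed simp
  show "F \<in> Bd 0 n \<longleftrightarrow> m \<in> d n ` Inv n" if "F \<in> Zc 0 (Suc n) \<and> m = F []" for F m
  proof
    assume "F \<in> Bd 0 n"
    then obtain E where "E \<in> cochain (M n) 0" "cob act E = 0" "F = (\<lambda>l. d n (E l))"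
      by (auto simp: Bd_def)
    then show "m \<in> d n ` Inv n"
      using that cochain_0_cob[of E] by (auto simp: Inv_def cochain_def)
  next
    assume "m \<in> d n ` Inv n"
    then obtain e where e: "e \<in> Inv n" "m = d n e" by auto
    let ?E = "\<lambda>l. if l = [] then e else 0"
    have "?E \<in> cochain (M n) 0" using e by (auto simp: cochain_def Inv_def)
    moreover from this have "cob act ?E = 0" using e cochain_0_cob[of ?E] by (auto simp: Inv_def)
    moreover have "F = (\<lambda>l. d n (?E l))"
      using that e by (auto simp: Zc_def cochain_def fun_eq_iff)
    ultimately show "F \<in> Bd 0 n" unfolding Bd_def by (intro image_eqI[of _ _ ?E]) auto
  qed
qed blast

section \<open>Comparison with the bar complex of the definition\<close>

lemma signed_Suc: "signed (Suc k) x = - signed k x"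
  by (simp add: signed_def)

text \<open>Splitting off the summand \<open>i = 0\<close> leaves the sum for the tail of the list
  with all signs reversed, for \<open>f\<close> with its first argument fixed; this is the recursion
  of \<open>merge\<close>.\<close>

lemma coboundary_sum_merge:
  fixes G :: "('h, 'k) monoid_scheme" and f :: "'h list \<Rightarrow> int"
  assumes rep: "\<And>x y. rep (x * y) = rep x \<otimes>\<^bsub>G\<^esub> rep (y::'g)" and "length xs = Suc n"
  shows "(\<Sum>i<n. signed (Suc i) (f (take i (map rep xs) @ [map rep xs ! i \<otimes>\<^bsub>G\<^esub> map rep xs ! Suc i]
      @ drop (i + 2) (map rep xs)))) + signed (Suc n) (f (butlast (map rep xs)))
    = - merge (\<lambda>l. f (map rep l)) xs"
  using assms(2)
proof (induction n arbitrary: f xs)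
  case 0
  then obtain g where "xs = [g]" by (cases xs) auto
  then show ?case by (simp add: signed_def)
next
  case (Suc n)
  then obtain g h r where xs: "xs = g # h # r" and "length (h # r) = Suc n"
    by (cases xs; cases "tl xs") auto
  have IH: "(\<Sum>i<n. signed (Suc i) (f (rep g # take i (map rep (h # r)) @
        [map rep (h # r) ! i \<otimes>\<^bsub>G\<^esub> map rep (h # r) ! Suc i] @ drop (i + 2) (map rep (h # r)))))
      + signed (Suc n) (f (rep g # butlast (map rep (h # r)))) = - merge (\<lambda>l. f (map rep (g # l))) (h # r)"
    using Suc.IH[OF \<open>length (h # r) = Suc n\<close>, of "\<lambda>l. f (rep g # l)"] by simp
  let ?s = "\<lambda>i. signed (Suc i) (f (take i (map rep xs) @ [map rep xs ! i \<otimes>\<^bsub>G\<^esub> map rep xs ! Suc i]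
      @ drop (i + 2) (map rep xs)))"
  have "?s (Suc i) = - signed (Suc i) (f (rep g # take i (map rep (h # r)) @
        [map rep (h # r) ! i \<otimes>\<^bsub>G\<^esub> map rep (h # r) ! Suc i] @ drop (i + 2) (map rep (h # r))))" for i
    by (simp add: xs signed_Suc[of "Suc i"])
  moreover have "?s 0 = - f (map rep ((g * h) # r))" by (simp add: xs signed_def rep)
  moreover have "signed (Suc (Suc n)) (f (butlast (map rep xs))) = - signed (Suc n) (f (rep g # butlast (map rep (h # r))))"
    by (simp add: xs signed_Suc[of "Suc n"])
  ultimately show ?case
    using IH unfolding sum.lessThan_Suc_shift
    by (simp only: xs merge.simps sum_negf)
qed

text \<open>Composition with \<open>rep\<close> on lists and with \<open>eps\<close> on values (the
  map \<open>T\<close>) is a bijection of cochains commuting with the coboundaries, so cocycles and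
  coboundaries correspond.\<close>

lemma integral_cohomology_iso:
  fixes G :: "('h, 'k) monoid_scheme"
  assumes bij: "bij_betw rep UNIV (carrier G)"
    and rep: "\<And>x y. rep (x * y) = rep x \<otimes>\<^bsub>G\<^esub> rep (y::'g)"
  shows "integral_cohomology G (Suc n) \<cong> quot_group (Zc (Suc n) 0) (Bc n 0)"
    and group_integral_cohomology: "group (integral_cohomology G (Suc n))"
proof -
  define T where "T f = (\<lambda>l. eps (f (map rep l)))" for f :: "'h list \<Rightarrow> int"
  let ?C = "\<lambda>n. cochains G n :: ('h list \<Rightarrow> int) set"
  let ?\<delta> = "\<lambda>n. coboundary G trivial_action n :: ('h list \<Rightarrow> int) \<Rightarrow> _"
  have tup: "map rep l \<in> tuples G n \<longleftrightarrow> length l = n" for l n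
    using bij by (auto simp: tuples_def bij_betw_def)
  have tup_ex: "\<exists>l. gs = map rep l \<and> length l = n" if "gs \<in> tuples G n" for gs n
  proof -
    have "set gs \<subseteq> range rep" using that bij by (auto simp: tuples_def bij_betw_def)
    then obtain l where "gs = map rep l" by (metis ex_map_conv subsetD rangeE)
    then show ?thesis using that by (auto simp: tuples_def)
  qed
  have ex_eps: "\<exists>k. eps k = m" if "m \<in> Ker 0" for m
    using that exact_eps by (auto simp: Ker_def)
  have eps_Ker: "eps k \<in> Ker 0" for k by (simp add: Ker_def eps_M d_eps)
  have eps_inj: "eps k = eps k' \<longleftrightarrow> k = k'" for k k'
    using eps_eq_0[of "k - k'"] by (auto simp: additive.diff[OF eps_additive])
  have T_mem: "T f \<in> cochain (Ker 0) n" if "f \<in> ?C n" for f n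
    using that by (auto simp: cochain_def cochains_def T_def tup eps_Ker)
  have T_inj: "f = f'" if "f \<in> ?C n" "f' \<in> ?C n" "T f = T f'" for f f' n
  proof
    fix gs show "f gs = f' gs"
    proof (cases "gs \<in> tuples G n")
      case True
      then obtain l where "gs = map rep l" using tup_ex by blast
      then show ?thesis using that(3) by (metis T_def eps_inj)
    qed (use that in \<open>auto simp: cochains_def\<close>)
  qed
  have T_surj: "\<exists>f\<in>?C n. T f = F" if F: "F \<in> cochain (Ker 0) n" for F n
  proof -
    have "\<exists>k. eps k = F l" for l
      using F ex_eps[of "F l"] by (cases "length l = n") (auto simp: cochain_def intro!: exI[of _ 0])
    then obtain e where e: "\<And>l. eps (e l) = F l" by metis
    define f where "f gs = (if gs \<in> tuples G n then e (map (inv_into UNIV rep) gs) else 0)" for gs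
    have inv: "map (inv_into UNIV rep) (map rep l) = l" for l
      using bij by (simp add: bij_betw_def map_idI o_def)
    have "T f = F"
      using F by (auto simp: T_def f_def tup inv e cochain_def fun_eq_iff simp del: map_map)
    moreover have "f \<in> ?C n" by (simp add: f_def cochains_def)
    ultimately show ?thesis by blast
  qed
  have T_diff: "T (f - f') = T f - T f'" for f f'
    by (auto simp: T_def additive.diff[OF eps_additive])
  have C_sub: "additive_subgroup_set (?C n)" for n
    by (auto simp: additive_subgroup_set_def cochains_def)
  have \<delta>_mem: "?\<delta> n f \<in> ?C (Suc n)" for n f
    by (simp add: cochains_def coboundary_def)
  have T_\<delta>: "T (?\<delta> n f) = cob act (T f)" if f: "f \<in> ?C n" for n f
  proof
    fix l :: "'g list"
    show "T (?\<delta> n f) l = cob act (T f) l"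
    proof (cases "length l = Suc n")
      case True
      then obtain g r where l: "l = g # r" by (cases l) auto
      have "?\<delta> n f (map rep l) = f (map rep r) - merge (\<lambda>l. f (map rep l)) l"
        using coboundary_sum_merge[of rep G l n f, OF rep True] True
        by (simp add: coboundary_def tup trivial_action_def add.assoc) (simp add: l)
      then show ?thesis
        by (simp add: T_def l additive.diff[OF eps_additive] merge_additive[OF eps_additive] act_eps
            del: merge.simps)
    next
      case False
      then show ?thesis
        using T_mem[OF f] T_mem[OF \<delta>_mem[of n f]] by (auto simp: cob_supp[of n] cochain_def)
    qed
  qed
  define Z where "Z = {f \<in> ?C (Suc n). ?\<delta> (Suc n) f = (\<lambda>_. 0)}"
  define B where "B = ?\<delta> n ` ?C n"
  have Z_iff: "f \<in> Z \<longleftrightarrow> T f \<in> Zc (Suc n) 0" if f: "f \<in> ?C (Suc n)" for f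
  proof -
    have "?\<delta> (Suc n) f = 0 \<longleftrightarrow> T (?\<delta> (Suc n) f) = T 0"
      using T_inj[OF \<delta>_mem additive_subgroup_setD(1)[OF C_sub], of "Suc n" f] by metis
    moreover have "T 0 = 0" by (auto simp: T_def)
    ultimately show ?thesis
      using f by (simp add: Z_def Zc_def T_mem T_\<delta>) (simp add: zero_fun_def)
  qed
  have B_iff: "f \<in> B \<longleftrightarrow> T f \<in> Bc n 0" if f: "f \<in> ?C (Suc n)" for f
  proof
    assume "f \<in> B"
    then show "T f \<in> Bc n 0" by (auto simp: B_def Bc_def T_mem T_\<delta>)
  next
    assume "T f \<in> Bc n 0"
    then obtain e where "e \<in> ?C n" "T f = cob act (T e)" using T_surj by (auto simp: Bc_def)
    then have "T f = T (?\<delta> n e)" by (simp add: T_\<delta>)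
    then have "f = ?\<delta> n e" using T_inj[OF f \<delta>_mem] by blast
    then show "f \<in> B" using \<open>e \<in> ?C n\<close> by (simp add: B_def)
  qed
  have BC: "B \<subseteq> ?C (Suc n)" by (auto simp: B_def \<delta>_mem)
  have ZC: "Z \<subseteq> ?C (Suc n)" by (auto simp: Z_def)
  have sub: "additive_subgroup_set A"
    if "A \<subseteq> ?C (Suc n)" "\<And>f. f \<in> ?C (Suc n) \<Longrightarrow> f \<in> A \<longleftrightarrow> T f \<in> Y" "additive_subgroup_set Y" for A Y
  proof -
    note S = additive_subgroup_setD[OF that(3)] and C = additive_subgroup_setD[OF C_sub[of "Suc n"]]
    have T0: "T 0 = 0" by (auto simp: T_def)
    show ?thesis
      unfolding additive_subgroup_set_def
    proof (intro conjI ballI)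
      show "0 \<in> A" using that(2)[OF C(1)] T0 S(1) by simp
      fix x y assume "x \<in> A" "y \<in> A"
      then have "x \<in> ?C (Suc n)" "y \<in> ?C (Suc n)" "T x \<in> Y" "T y \<in> Y" using that(1,2) by auto
      then show "x - y \<in> A" using that(2)[OF C(2)] T_diff[of x y] S(2) by simp
    qed
  qed
  have "(\<lambda>f f' gs. f gs + f' gs) = ((+) :: ('h list \<Rightarrow> int) \<Rightarrow> _)"
    by (simp add: plus_fun_def fun_eq_iff)
  then have "integral_cohomology G (Suc n) = quot_group Z B"
    by (simp add: integral_cohomology_def group_cohomology_def cocycle_group_def quot_group_def
        add_group_of_def Z_def B_def zero_fun_def)
  moreover have BZ: "B \<subseteq> Z"
  proof
    fix x assume x: "x \<in> B"
    then have "x \<in> ?C (Suc n)" using BC by auto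
    then show "x \<in> Z" using x B_iff Z_iff subsetD[OF Bc_subset] by auto
  qed
  moreover have "quot_group Z B \<cong> quot_group (Zc (Suc n) 0) (Bc n 0)"
  proof (rule quot_group_iso_rel[OF sub[OF ZC Z_iff Zc_subgroup] sub[OF BC B_iff Bc_subgroup] _
        Zc_subgroup Bc_subgroup Bc_subset, where R = "\<lambda>f F. f \<in> Z \<and> F = T f"])
    show "B \<subseteq> Z" by (rule BZ)
    show "0 \<in> Z \<and> 0 = T 0"
      using additive_subgroup_setD(1)[OF sub[OF ZC Z_iff Zc_subgroup]] by (auto simp: T_def)
    show "x \<in> Z \<and> y \<in> Zc (Suc n) 0" if "x \<in> Z \<and> y = T x" for x y
      using that Z_iff ZC by blast
    show "x - x' \<in> Z \<and> y - y' = T (x - x')" if "x \<in> Z \<and> y = T x" "x' \<in> Z \<and> y' = T x'" for x y x' y'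
      using that T_diff additive_subgroup_setD(2)[OF sub[OF ZC Z_iff Zc_subgroup]] by auto
    show "\<exists>y. x \<in> Z \<and> y = T x" if "x \<in> Z" for x using that by blast
    show "\<exists>x. x \<in> Z \<and> y = T x" if "y \<in> Zc (Suc n) 0" for y
      using that T_surj[of y "Suc n"] Z_iff by (auto simp: Zc_def)
    show "x \<in> B \<longleftrightarrow> y \<in> Bc n 0" if "x \<in> Z \<and> y = T x" for x y
      using that B_iff ZC by blast
  qed
  ultimately show "integral_cohomology G (Suc n) \<cong> quot_group (Zc (Suc n) 0) (Bc n 0)"
    "group (integral_cohomology G (Suc n))"
    using group_quot_group[OF sub[OF ZC Z_iff Zc_subgroup] sub[OF BC B_iff Bc_subgroup] BZ] by simp_all
qed

theorem integral_cohomology_iso_invariants: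
  assumes "bij_betw rep UNIV (carrier G)"
    and "\<And>x y. rep (x * y) = rep x \<otimes>\<^bsub>G\<^esub> rep (y::'g)"
  shows "integral_cohomology G (Suc n)
    \<cong> quot_group {m \<in> Inv (Suc n). d (Suc n) m = 0} (d n ` Inv n)"
  using iso_trans[OF integral_cohomology_iso(1)[OF assms, of n]
      iso_trans[OF dimension_shift[of n 0] quot_group_invariants[of "n + 0"]]] by simp

end

section \<open>Coinduced modules\<close>

text \<open>The group acts by left translation, while the differentials are built from right
  translations; this is why they are equivariant.\<close>

definition lshift :: "'g::group_mult \<Rightarrow> ('g \<Rightarrow> 'a) \<Rightarrow> 'g \<Rightarrow> 'a"
  where "lshift g m = (\<lambda>x. m (inverse g * x))"

lemma lshift_lshift: "lshift g (lshift h m) = lshift (g * h) m"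
  by (simp add: lshift_def inverse_mult_distrib_group mult.assoc)

lemma additive_lshift: "Modules.additive (lshift g :: _ \<Rightarrow> _ \<Rightarrow> 'a::ab_group_add)"
  by (simp add: Modules.additive_def lshift_def fun_eq_iff)

lemma lshift_0 [simp]: "lshift g (0 :: _ \<Rightarrow> 'a::ab_group_add) = 0"
  by (rule additive.zero[OF additive_lshift])

lemma merge_apply: "merge f gs x = merge (\<lambda>l. f l x) gs"
  using merge_additive[of "\<lambda>m. m x" f gs] by (simp add: Modules.additive_def)

text \<open>The standard contraction: prepend \<open>inverse x\<close> to the list and evaluate at
  \<open>1\<close>. The clause on \<open>F = 0\<close> keeps components zero that are absent from a
  module of the complex.\<close>

lemma coinduced_acyclic:
  fixes F :: "'g::group_mult list \<Rightarrow> 'g \<Rightarrow> 'a::ab_group_add"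
  assumes F: "F \<in> cochain UNIV (Suc p)" and c: "cob lshift F = 0"
  shows "\<exists>E\<in>cochain UNIV p. cob lshift E = F \<and> (F = 0 \<longrightarrow> E = 0)"
proof (intro bexI conjI impI)
  define E where "E gs = (\<lambda>x. F (inverse x # gs) 1)" for gs
  show "E = 0" if "F = 0" using that by (auto simp: E_def fun_eq_iff)
  show E: "E \<in> cochain UNIV p"
    using F by (auto simp: cochain_def E_def)
  show "cob lshift E = F"
  proof
    fix gs :: "'g list"
    show "cob lshift E gs = F gs"
    proof (cases gs)
      case Nil
      then show ?thesis using F by (simp add: cochain_def)
    next
      case (Cons g r)
      have "cob lshift E (g # r) x = F (g # r) x" for x
      proof -
        \<comment> \<open>The cocycle identity at this one list, evaluated at \<open>1\<close>, is
          the required equation at \<open>x\<close>.\<close>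
        have "cob lshift F (inverse x # g # r) 1 = 0" using c by simp
        then show ?thesis
          by (simp add: lshift_def merge_apply E_def inverse_mult_distrib_group algebra_simps)
      qed
      then show ?thesis using Cons by auto
    qed
  qed
qed

lemma lshift_invariant_iff: "(\<forall>g. lshift g m = m) \<longleftrightarrow> (\<exists>k. m = (\<lambda>_. k))"
proof
  assume *: "\<forall>g. lshift g m = m"
  have "m x = m 1" for x
    using *[rule_format, THEN fun_cong, of x x] by (simp add: lshift_def left_inverse_mult)
  then show "\<exists>k. m = (\<lambda>_. k)" by blast
qed (auto simp: lshift_def)

section \<open>Cyclic subgroups\<close>

definition exact_order :: "'g::monoid_mult \<Rightarrow> nat \<Rightarrow> bool"
  where "exact_order x N \<longleftrightarrow> N > 0 \<and> x ^ N = 1 \<and> (\<forall>i. 0 < i \<and> i < N \<longrightarrow> x ^ i \<noteq> 1)"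

text \<open>\<open>\<rho>\<close> chooses an origin on each coset
  \<open>g \<langle>x\<rangle>\<close> and \<open>j\<close> measures the position from it, modulo
  the order of \<open>x\<close>.\<close>

lemma orbit_transversal:
  fixes x :: "'g::group_mult"
  assumes "exact_order x N"
  obtains \<rho> :: "'g \<Rightarrow> 'g" and j :: "'g \<Rightarrow> nat"
  where "\<And>g. \<rho> (g * x) = \<rho> g" "\<And>g. j g < N" "\<And>g. g = \<rho> g * x ^ j g" "\<And>g. j (g * x) = Suc (j g) mod N"
proof -
  have N: "N > 0" "x ^ N = 1" and ord: "\<And>i. 0 < i \<Longrightarrow> i < N \<Longrightarrow> x ^ i \<noteq> 1"
    using assms by (auto simp: exact_order_def)
  have mod: "x ^ (n mod N) = x ^ n" for n
    by (metis N(2) div_mult_mod_eq mult.commute mult_1 power_add power_mult power_one)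
  have inj: "i = i'" if "x ^ i = x ^ i'" "i < N" "i' < N" for i i'
  proof -
    have "i = i'" if "x ^ i = x ^ i'" "i \<le> i'" "i' < N" for i i'
    proof -
      have "x ^ i * x ^ (i' - i) = x ^ i * 1"
        using that by (metis le_add_diff_inverse mult_1_right power_add)
      then have "x ^ (i' - i) = 1" using mult_left_cancel_group by blast
      then show ?thesis using ord[of "i' - i"] that by force
    qed
    from this[of i i'] this[of i' i] that show ?thesis by force
  qed
  define orb where "orb g = {h. \<exists>i. h = g * x ^ i}" for g
  define \<rho> where "\<rho> g = (SOME h. h \<in> orb g)" for g
  have orb: "orb (g * x) = orb g" for g
  proof
    have "g * x * x ^ i = g * x ^ Suc i" for i by (simp add: mult.assoc)
    then show "orb (g * x) \<subseteq> orb g" unfolding orb_def by blast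
    have "g * x ^ i = g * x * x ^ (i + (N - 1))" for i
    proof -
      have "i + N = Suc (i + (N - 1))" using N(1) by simp
      then have "x * x ^ (i + (N - 1)) = x ^ (i + N)" by (simp only: power_Suc)
      then show ?thesis by (simp add: mult.assoc power_add N)
    qed
    then show "orb g \<subseteq> orb (g * x)" unfolding orb_def by blast
  qed
  have "\<rho> g \<in> orb g" for g
    unfolding \<rho>_def by (rule someI[of _ g]) (auto simp: orb_def intro: exI[of _ 0])
  have "\<exists>j<N. g = \<rho> g * x ^ j" for g
  proof -
    obtain i where "\<rho> g = g * x ^ i" using \<open>\<rho> g \<in> orb g\<close> by (auto simp: orb_def)
    moreover have "x ^ (i mod N) * x ^ (N - i mod N) = 1"
      using N by (metis le_add_diff_inverse less_or_eq_imp_le mod_less_divisor power_add)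
    ultimately have "g = \<rho> g * x ^ (N - i mod N)" by (simp add: mult.assoc mod)
    then have "g = \<rho> g * x ^ ((N - i mod N) mod N)" by (simp add: mod)
    then show ?thesis using N(1) mod_less_divisor by blast
  qed
  then obtain j where j: "\<And>g. j g < N" "\<And>g. g = \<rho> g * x ^ j g" by metis
  have \<rho>x: "\<rho> (g * x) = \<rho> g" for g by (simp add: \<rho>_def orb)
  have "j (g * x) = Suc (j g) mod N" for g
  proof (rule inj)
    have "\<rho> g * x ^ j (g * x) = g * x" using j(2)[of "g * x"] \<rho>x by simp
    also have "\<dots> = \<rho> g * x ^ j g * x" using j(2)[of g] by simp
    also have "\<dots> = \<rho> g * x ^ (Suc (j g) mod N)" by (simp add: mod mult.assoc power_commutes)
    finally show "x ^ j (g * x) = x ^ (Suc (j g) mod N)" using mult_left_cancel_group by blast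
  qed (use j N in auto)
  with \<rho>x j show ?thesis using that by blast
qed

text \<open>Summing \<open>f\<close> along each orbit from its origin gives \<open>u\<close>; the
  vanishing norm makes it consistent when the orbit closes.\<close>

lemma cyclic_norm_exact:
  fixes x :: "'g::group_mult" and f :: "'g \<Rightarrow> int"
  assumes x: "exact_order x N" and f: "\<And>g. (\<Sum>i<N. f (g * x ^ i)) = 0"
  obtains u where "\<And>g. f g = u (g * x) - u g"
proof -
  obtain \<rho> j where r: "\<And>g. \<rho> (g * x) = \<rho> g" "\<And>g. j g < N" "\<And>g. g = \<rho> g * x ^ j g"
    "\<And>g. j (g * x) = Suc (j g) mod N"
    using orbit_transversal[OF x] by metis
  define u where "u g = (\<Sum>i<j g. f (\<rho> g * x ^ i))" for g
  have "f g = u (g * x) - u g" for g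
  proof (cases "Suc (j g) = N")
    case True
    then have "u (g * x) = 0" by (simp add: u_def r)
    moreover have "u g + f g = (\<Sum>i<N. f (\<rho> g * x ^ i))"
      using True[symmetric] r(3)[of g] by (simp add: u_def)
    ultimately show ?thesis using f by simp
  next
    case False
    then have "j (g * x) = Suc (j g)" using r(2)[of g] r(4)[of g] by simp
    then show ?thesis using r(3)[of g] by (simp add: u_def r(1))
  qed
  then show ?thesis using that by blast
qed

text \<open>Concentrating \<open>f\<close> at the origin of each orbit gives \<open>u\<close>:
  exactly one term of the norm is then nonzero.\<close>

lemma cyclic_invariant_exact:
  fixes x :: "'g::group_mult" and f :: "'g \<Rightarrow> int"
  assumes x: "exact_order x N" and f: "\<And>g. f (g * x) = f g"
  obtains u where "\<And>g. f g = (\<Sum>i<N. u (g * x ^ i))"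
proof -
  obtain \<rho> j where r: "\<And>g. \<rho> (g * x) = \<rho> g" "\<And>g. j g < N" "\<And>g. g = \<rho> g * x ^ j g"
    "\<And>g. j (g * x) = Suc (j g) mod N"
    using orbit_transversal[OF x] by metis
  have N: "N > 0" using x by (simp add: exact_order_def)
  define u where "u g = (if j g = 0 then f g else 0)" for g
  have jp: "j (g * x ^ i) = (j g + i) mod N" for g i
  proof (induction i)
    case (Suc i)
    have "j (g * x ^ Suc i) = Suc (j (g * x ^ i)) mod N"
      using r(4)[of "g * x ^ i"] by (simp add: mult.assoc power_Suc2 del: power_Suc)
    then show ?case using Suc by (simp add: mod_Suc_eq)
  qed (use r(2) in simp)
  have fp: "f (g * x ^ i) = f g" for g i
    by (induction i) (use f in \<open>simp_all add: power_Suc2 mult.assoc[symmetric] del: power_Suc\<close>)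
  have "f g = (\<Sum>i<N. u (g * x ^ i))" for g
  proof -
    have "(\<Sum>i<N. u (g * x ^ i)) = (\<Sum>i<N. if i = (N - j g) mod N then f g else 0)"
    proof (rule sum.cong)
      fix i assume "i \<in> {..<N}"
      then have "i < N" by simp
      have "(j g + i) mod N = 0 \<longleftrightarrow> i = (N - j g) mod N"
      proof (cases "j g = 0")
        case False
        then show ?thesis using \<open>i < N\<close> r(2)[of g]
          by (cases "j g + i < N") (auto simp: mod_if)
      qed (use \<open>i < N\<close> in simp)
      then show "u (g * x ^ i) = (if i = (N - j g) mod N then f g else 0)"
        by (simp add: u_def jp fp)
    qed simp
    also have "\<dots> = f g" using N by simp
    finally show ?thesis by simp
  qed
  then show ?thesis using that by blast
qed

section \<open>Groups acting on trees\<close>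

text \<open>The vertices are the cosets \<open>gA\<close> and \<open>gB\<close>, the edges the cosets of \<open>A \<inter> B\<close>. The
  functions \<open>dA\<close> and \<open>dB\<close> grow away from the root \<open>A\<close>; every other vertex has a unique edge
  along which they decrease.\<close>

locale rooted_tree =
  fixes S A B :: "'g::group_mult set" and dA dB :: "'g \<Rightarrow> nat"
  assumes S_A: "g \<in> S \<Longrightarrow> k \<in> A \<Longrightarrow> g * k \<in> S" and S_B: "g \<in> S \<Longrightarrow> k \<in> B \<Longrightarrow> g * k \<in> S"
    and A_mult: "k \<in> A \<Longrightarrow> l \<in> A \<Longrightarrow> k * l \<in> A" and A_inv: "k \<in> A \<Longrightarrow> inverse k \<in> A"
    and B_mult: "k \<in> B \<Longrightarrow> l \<in> B \<Longrightarrow> k * l \<in> B" and B_inv: "k \<in> B \<Longrightarrow> inverse k \<in> B"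
    and A_1: "1 \<in> A" and B_1: "1 \<in> B"
    and dA: "g \<in> S \<Longrightarrow> k \<in> A \<Longrightarrow> dA (g * k) = dA g" and dB: "g \<in> S \<Longrightarrow> k \<in> B \<Longrightarrow> dB (g * k) = dB g"
    and neq: "g \<in> S \<Longrightarrow> dA g \<noteq> dB g"
    and uniqA: "g \<in> S \<Longrightarrow> k \<in> A \<Longrightarrow> dB g < dA g \<Longrightarrow> dB (g * k) < dA (g * k) \<Longrightarrow> k \<in> B"
    and uniqB: "g \<in> S \<Longrightarrow> k \<in> B \<Longrightarrow> dA g < dB g \<Longrightarrow> dA (g * k) < dB (g * k) \<Longrightarrow> k \<in> A"
    and exA: "g \<in> S \<Longrightarrow> g \<notin> A \<Longrightarrow> \<exists>k\<in>A. dB (g * k) < dA g"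
    and exB: "g \<in> S \<Longrightarrow> \<exists>k\<in>B. dA (g * k) < dB g"
begin

lemma invariant_const:
  assumes inv: "\<And>g k. g \<in> S \<Longrightarrow> k \<in> A \<union> B \<Longrightarrow> x (g * k) = x g" and g: "g \<in> S"
  shows "x g = x 1"
  using g
proof (induction "dA g" arbitrary: g rule: less_induct)
  case less
  show ?case
  proof (cases "g \<in> A")
    case True
    then have "x (g * inverse g) = x g" using less(2) A_inv inv by blast
    then show ?thesis by (simp add: right_inverse_mult)
  next
    case False
    then obtain k where k: "k \<in> A" "dB (g * k) < dA g" using exA less(2) by blast
    then have gk: "g * k \<in> S" using S_A less(2) by blast
    obtain l where l: "l \<in> B" "dA (g * k * l) < dB (g * k)" using exB[OF gk] by blast
    have "x (g * k * l) = x 1" using less(1)[of "g * k * l"] k l S_B[OF gk] by simp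
    then show ?thesis using inv k l gk less(2) by auto
  qed
qed

text \<open>The signed sum of \<open>w\<close> over the edges of the path from a vertex to the root,
  \<open>True\<close> standing for a vertex of type \<open>A\<close>. Where no descent exists the
  path is empty, hence \<open>0\<close>.\<close>

function walk :: "('g \<Rightarrow> int) \<Rightarrow> bool \<Rightarrow> 'g \<Rightarrow> int" where
  "walk w True g = (if \<exists>k\<in>A. dB (g * k) < dA g
    then (let k = SOME k. k \<in> A \<and> dB (g * k) < dA g in walk w False (g * k) + w (g * k)) else 0)"
| "walk w False g = (if \<exists>k\<in>B. dA (g * k) < dB g
    then (let k = SOME k. k \<in> B \<and> dA (g * k) < dB g in walk w True (g * k) - w (g * k)) else 0)"
  by pat_completeness auto
termination
proof (relation "Wellfounded.measure (\<lambda>(w, t, g). if t then dA g else dB g)")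
  show "((w, False, g * k), w, True, g) \<in> Wellfounded.measure (\<lambda>(w, t, g). if t then dA g else dB g)"
    if "\<exists>k\<in>A. dB (g * k) < dA g" "k = (SOME k. k \<in> A \<and> dB (g * k) < dA g)" for w g k
    using someI_ex[of "\<lambda>k. k \<in> A \<and> dB (g * k) < dA g"] that by auto
  show "((w, True, g * k), w, False, g) \<in> Wellfounded.measure (\<lambda>(w, t, g). if t then dA g else dB g)"
    if "\<exists>k\<in>B. dA (g * k) < dB g" "k = (SOME k. k \<in> B \<and> dA (g * k) < dB g)" for w g k
    using someI_ex[of "\<lambda>k. k \<in> B \<and> dA (g * k) < dB g"] that by auto
qed simp

declare walk.simps [simp del]

lemma walk_True:
  assumes "k \<in> A" "dB (g * k) < dA g"
  obtains k where "k \<in> A" "dB (g * k) < dA g" "walk w True g = walk w False (g * k) + w (g * k)"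
proof (rule that)
  let ?k = "SOME k. k \<in> A \<and> dB (g * k) < dA g"
  show "?k \<in> A" "dB (g * ?k) < dA g"
    using someI_ex[of "\<lambda>k. k \<in> A \<and> dB (g * k) < dA g"] assms by auto
  show "walk w True g = walk w False (g * ?k) + w (g * ?k)"
    by (subst walk.simps) (use assms in \<open>auto simp: Let_def\<close>)
qed

lemma walk_False:
  assumes "k \<in> B" "dA (g * k) < dB g"
  obtains k where "k \<in> B" "dA (g * k) < dB g" "walk w False g = walk w True (g * k) - w (g * k)"
proof (rule that)
  let ?k = "SOME k. k \<in> B \<and> dA (g * k) < dB g"
  show "?k \<in> B" "dA (g * ?k) < dB g"
    using someI_ex[of "\<lambda>k. k \<in> B \<and> dA (g * k) < dB g"] assms by auto
  show "walk w False g = walk w True (g * ?k) - w (g * ?k)"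
    by (subst walk.simps) (use assms in \<open>auto simp: Let_def\<close>)
qed

text \<open>The arbitrary choices made by \<open>walk\<close> do not matter: two descending edges at
  one vertex differ by an element \<open>c\<close>, which \<open>uniqA\<close> or
  \<open>uniqB\<close> places in both groups, and \<open>w\<close> is invariant under it.\<close>

lemma walk_invariant:
  assumes w: "\<And>g k. g \<in> S \<Longrightarrow> k \<in> A \<Longrightarrow> k \<in> B \<Longrightarrow> w (g * k) = w g"
  shows "g \<in> S \<Longrightarrow> k \<in> A \<Longrightarrow> dA g = n \<Longrightarrow> walk w True (g * k) = walk w True g"
    and "g \<in> S \<Longrightarrow> k \<in> B \<Longrightarrow> dB g = n \<Longrightarrow> walk w False (g * k) = walk w False g"
proof (induction n arbitrary: g k rule: less_induct)
  case (less n)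
  {
    case 1
    show ?case
    proof (cases "\<exists>l\<in>A. dB (g * l) < dA g")
      case True
      then obtain l where l: "l \<in> A" "dB (g * l) < dA g" "walk w True g = walk w False (g * l) + w (g * l)"
        using walk_True by metis
      have "g * k * (inverse k * l) = g * l" by (simp add: mult.assoc)
      then have "\<exists>l\<in>A. dB (g * k * l) < dA (g * k)"
        using l 1 A_mult A_inv dA by metis
      then obtain l' where l': "l' \<in> A" "dB (g * k * l') < dA (g * k)"
          "walk w True (g * k) = walk w False (g * k * l') + w (g * k * l')"
        using walk_True by metis
      define c where "c = inverse l * (k * l')"
      have gl: "g * l \<in> S" using S_A 1 l by blast
      have c: "g * k * l' = g * l * c" by (simp add: c_def mult.assoc)
      have "c \<in> A" using l l' 1 A_mult A_inv by (simp add: c_def)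
      moreover have "c \<in> B"
      proof (rule uniqA[OF gl \<open>c \<in> A\<close>])
        show "dB (g * l) < dA (g * l)" using l 1 dA by simp
        show "dB (g * l * c) < dA (g * l * c)"
          using l' dA[OF gl \<open>c \<in> A\<close>] dA[of g l] dA[of g k] l 1 by (simp add: c)
      qed
      ultimately have "walk w False (g * l * c) = walk w False (g * l)" "w (g * l * c) = w (g * l)"
        using less.IH(2)[of "dB (g * l)" "g * l" c] w gl l(2) 1 by auto
      then show ?thesis using l(3) l'(3) c by simp
    next
      case False
      then have "\<not> (\<exists>l\<in>A. dB (g * k * l) < dA (g * k))"
        using 1 A_mult dA by (metis mult.assoc)
      then show ?thesis using False by (simp add: walk.simps)
    qed
  next
    case 2
    have ex: "\<exists>l\<in>B. dA (g * l) < dB g" if "g \<in> S" for g using exB that by blast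
    obtain l where l: "l \<in> B" "dA (g * l) < dB g" "walk w False g = walk w True (g * l) - w (g * l)"
      using walk_False ex[OF 2(1)] by metis
    have gk: "g * k \<in> S" using S_B 2 by blast
    obtain l' where l': "l' \<in> B" "dA (g * k * l') < dB (g * k)"
        "walk w False (g * k) = walk w True (g * k * l') - w (g * k * l')"
      using walk_False ex[OF gk] by metis
    define c where "c = inverse l * (k * l')"
    have gl: "g * l \<in> S" using S_B 2 l by blast
    have c: "g * k * l' = g * l * c" by (simp add: c_def mult.assoc)
    have "c \<in> B" using l l' 2 B_mult B_inv by (simp add: c_def)
    moreover have "c \<in> A"
    proof (rule uniqB[OF gl \<open>c \<in> B\<close>])
      show "dA (g * l) < dB (g * l)" using l 2 dB by simp
      show "dA (g * l * c) < dB (g * l * c)"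
        using l' dB[OF gl \<open>c \<in> B\<close>] dB[of g l] dB[of g k] l 2 by (simp add: c)
    qed
    ultimately have "walk w True (g * l * c) = walk w True (g * l)" "w (g * l * c) = w (g * l)"
      using less.IH(1)[of "dA (g * l)" "g * l" c] w gl l(2) 2 by auto
    then show ?case using l(3) l'(3) c by simp
  }
qed

text \<open>The first cohomology of a tree vanishes: integrate \<open>w\<close> from the root. By
  \<open>neq\<close> each edge descends in one of its two directions, and it is the last edge in the
  path of its upper end to be added.\<close>

lemma split:
  assumes w: "\<And>g k. g \<in> S \<Longrightarrow> k \<in> A \<Longrightarrow> k \<in> B \<Longrightarrow> w (g * k) = (w g :: int)"
  obtains p q where "\<And>g k. g \<in> S \<Longrightarrow> k \<in> A \<Longrightarrow> p (g * k) = p g"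
    "\<And>g k. g \<in> S \<Longrightarrow> k \<in> B \<Longrightarrow> q (g * k) = q g" "\<And>g. g \<in> S \<Longrightarrow> w g = p g - (q g :: int)"
proof
  note inv = walk_invariant[OF w, OF _ _ _ _ _ refl]
  show "walk w True (g * k) = walk w True g" if "g \<in> S" "k \<in> A" for g k using inv(1) that by blast
  show "walk w False (g * k) = walk w False g" if "g \<in> S" "k \<in> B" for g k using inv(2) that by blast
  show "w g = walk w True g - walk w False g" if g: "g \<in> S" for g
  proof (cases "dB g < dA g")
    case True
    then obtain k where k: "k \<in> A" "dB (g * k) < dA g" "walk w True g = walk w False (g * k) + w (g * k)"
      using walk_True[of 1 g w] A_1 by auto
    then have "k \<in> B" using uniqA[OF g k(1) True] dA g by simp
    then show ?thesis using k inv(2)[of g k] w g by simp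
  next
    case False
    then have lt: "dA g < dB g" using neq[OF g] by simp
    then obtain k where k: "k \<in> B" "dA (g * k) < dB g" "walk w False g = walk w True (g * k) - w (g * k)"
      using walk_False[of 1 g w] B_1 by auto
    then have "k \<in> A" using uniqB[OF g k(1) lt] dB g by simp
    then show ?thesis using k inv(1)[of g k] w g by simp
  qed
qed

end

section \<open>The group as a type\<close>

lemma Z_half_closed:
  shows Z_half_1: "1 \<in> Z_half" and Z_half_half: "1/2 \<in> Z_half"
    and Z_half_add: "x \<in> Z_half \<Longrightarrow> y \<in> Z_half \<Longrightarrow> x + y \<in> Z_half"
    and Z_half_mult: "x \<in> Z_half \<Longrightarrow> y \<in> Z_half \<Longrightarrow> x * y \<in> Z_half"
    and Z_half_uminus: "x \<in> Z_half \<Longrightarrow> - x \<in> Z_half"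
proof -
  let ?R = "ring_of_type_algebra :: rat ring"
  interpret cring ?R by (rule cring_from_type_algebra)
  have minus: "\<ominus>\<^bsub>?R\<^esub> x = - x" for x
    by (rule minus_equality) (auto simp: ring_of_type_algebra_def)
  show "1 \<in> Z_half" "1/2 \<in> Z_half"
    using generate_ring.one[of ?R] generate_ring.incl[of "1/2" "{1/2}" ?R]
    by (auto simp: Z_half_def ring_of_type_algebra_def)
  show "x + y \<in> Z_half" "x * y \<in> Z_half" if "x \<in> Z_half" "y \<in> Z_half"
    using that generate_ring.eng_add[of x ?R "{1/2}" y] generate_ring.eng_mult[of x ?R "{1/2}" y]
    by (auto simp: Z_half_def ring_of_type_algebra_def)
  show "- x \<in> Z_half" if "x \<in> Z_half"
    using that generate_ring.a_inv[of x ?R "{1/2}"] minus by (auto simp: Z_half_def)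
qed

lemma Z_half_0: "0 \<in> Z_half"
  using Z_half_add[OF Z_half_1 Z_half_uminus[OF Z_half_1]] by simp

lemma Z_half_diff: "x \<in> Z_half \<Longrightarrow> y \<in> Z_half \<Longrightarrow> x - y \<in> Z_half"
  using Z_half_add[OF _ Z_half_uminus, of x y] by simp

lemma Z_half_div_2: "x \<in> Z_half \<Longrightarrow> x / 2 \<in> Z_half"
  using Z_half_mult[OF _ Z_half_half, of x] by simp

lemma Z_half_denom:
  assumes "x \<in> Z_half"
  shows "\<exists>n::nat. 2 ^ n * x \<in> \<int>"
proof -
  let ?R = "ring_of_type_algebra :: rat ring"
  interpret cring ?R by (rule cring_from_type_algebra)
  have minus: "\<ominus>\<^bsub>?R\<^esub> x = - x" for x
    by (rule minus_equality) (auto simp: ring_of_type_algebra_def)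
  show ?thesis
    using assms unfolding Z_half_def
  proof (induction rule: generate_ring.induct)
    case one
    show ?case by (rule exI[of _ 0]) (simp add: ring_of_type_algebra_def)
  next
    case (incl h)
    then have "2 ^ 1 * h = 1" by simp
    then show ?case by (metis Ints_1)
  next
    case (a_inv h)
    then show ?case by (auto simp: minus)
  next
    case (eng_add x y)
    then obtain n m :: nat where nm: "2 ^ n * x \<in> \<int>" "2 ^ m * y \<in> \<int>" by blast
    have "2 ^ (n + m) * (x + y) = 2 ^ m * (2 ^ n * x) + 2 ^ n * (2 ^ m * y)"
      by (simp add: algebra_simps power_add)
    also have "\<dots> \<in> \<int>" using nm by simp
    finally have "2 ^ (n + m) * (x + y) \<in> \<int>" .
    then show ?case by (auto simp: ring_of_type_algebra_def)
  next
    case (eng_mult x y)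
    then obtain n m :: nat where nm: "2 ^ n * x \<in> \<int>" "2 ^ m * y \<in> \<int>" by blast
    have "2 ^ (n + m) * (x * y) = (2 ^ n * x) * (2 ^ m * y)"
      by (simp add: algebra_simps power_add)
    also have "\<dots> \<in> \<int>" using nm by simp
    finally have "2 ^ (n + m) * (x * y) \<in> \<int>" .
    then show ?case by (auto simp: ring_of_type_algebra_def)
  qed
qed

lemma Z_half_of_int: "of_int k \<in> Z_half"
proof (induction k rule: int_induct[of _ 0])
  case (step1 i) then show ?case using Z_half_add[OF _ Z_half_1] by simp
next
  case (step2 i) then show ?case using Z_half_diff[OF _ Z_half_1] by simp
qed (use Z_half_0 in simp)

lemma carrier_SL2_Z_half:
  "A \<in> carrier SL2_Z_half \<longleftrightarrow> A $ 1 $ 1 \<in> Z_half \<and> A $ 1 $ 2 \<in> Z_half \<and> A $ 2 $ 1 \<in> Z_half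
    \<and> A $ 2 $ 2 \<in> Z_half \<and> A $ 1 $ 1 * A $ 2 $ 2 - A $ 1 $ 2 * A $ 2 $ 1 = 1"
  by (simp only: SL2_Z_half_def SL_def partial_object.select_convs mem_Collect_eq det_2 forall_2 conj_assoc)

definition mat2 :: "'a \<Rightarrow> 'a \<Rightarrow> 'a \<Rightarrow> 'a \<Rightarrow> 'a::zero ^ 2 ^ 2"
  where "mat2 p q r s = (\<chi> i j. if i = 1 then if j = 1 then p else q else if j = 1 then r else s)"

lemma mat2_simps [simp]:
  "mat2 p q r s $ 1 $ 1 = p" "mat2 p q r s $ 1 $ 2 = q" "mat2 p q r s $ 2 $ 1 = r" "mat2 p q r s $ 2 $ 2 = s"
  by (simp_all add: mat2_def)

typedef slh = "carrier SL2_Z_half"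
  by (rule exI[of _ "mat2 1 0 0 1"]) (simp add: carrier_SL2_Z_half Z_half_0 Z_half_1)

setup_lifting type_definition_slh

lift_definition m11 :: "slh \<Rightarrow> rat" is "\<lambda>A. A $ 1 $ 1" .
lift_definition m12 :: "slh \<Rightarrow> rat" is "\<lambda>A. A $ 1 $ 2" .
lift_definition m21 :: "slh \<Rightarrow> rat" is "\<lambda>A. A $ 2 $ 1" .
lift_definition m22 :: "slh \<Rightarrow> rat" is "\<lambda>A. A $ 2 $ 2" .

lemma slh_eq_iff: "g = h \<longleftrightarrow> m11 g = m11 h \<and> m12 g = m12 h \<and> m21 g = m21 h \<and> m22 g = m22 h"
  by transfer (auto simp: vec_eq_iff forall_2)

lemma slh_entries [simp]: "m11 g \<in> Z_half" "m12 g \<in> Z_half" "m21 g \<in> Z_half" "m22 g \<in> Z_half"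
  by (transfer; simp add: carrier_SL2_Z_half)+

lemma slh_det: "m11 g * m22 g - m12 g * m21 g = 1"
  by transfer (simp add: carrier_SL2_Z_half)

instantiation slh :: group_mult
begin

lift_definition one_slh :: slh is "mat 1"
  by (simp add: carrier_SL2_Z_half Z_half_0 Z_half_1 mat_def)

lift_definition times_slh :: "slh \<Rightarrow> slh \<Rightarrow> slh" is "(**)"
proof -
  fix A B :: "rat ^ 2 ^ 2"
  assume "A \<in> carrier SL2_Z_half" "B \<in> carrier SL2_Z_half"
  then have "det (A ** B) = 1" and "\<And>i j. (A ** B) $ i $ j \<in> Z_half"
    by (auto simp: SL2_Z_half_def SL_def det_mul) (auto simp: matrix_matrix_mult_def sum_2 intro!: Z_half_add Z_half_mult)
  then show "A ** B \<in> carrier SL2_Z_half"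
    by (simp add: SL2_Z_half_def SL_def)
qed

lift_definition inverse_slh :: "slh \<Rightarrow> slh" is "\<lambda>A. mat2 (A $ 2 $ 2) (- A $ 1 $ 2) (- A $ 2 $ 1) (A $ 1 $ 1)"
  by (auto simp: carrier_SL2_Z_half Z_half_uminus algebra_simps)

definition divide_slh :: "slh \<Rightarrow> slh \<Rightarrow> slh" where "divide_slh g h = g * inverse h"

instance
proof
  fix g h k :: slh
  show "g * h * k = g * (h * k)" by transfer (rule matrix_mul_assoc[symmetric])
  show "1 * g = g" "g * 1 = g" by (transfer; simp)+
  show "inverse g * g = 1"
    by transfer (auto simp: carrier_SL2_Z_half vec_eq_iff forall_2 matrix_matrix_mult_def sum_2 mat_def algebra_simps)
qed

end

lemma slh_mult [simp]:
  "m11 (g * h) = m11 g * m11 h + m12 g * m21 h" "m12 (g * h) = m11 g * m12 h + m12 g * m22 h"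
  "m21 (g * h) = m21 g * m11 h + m22 g * m21 h" "m22 (g * h) = m21 g * m12 h + m22 g * m22 h"
  by (transfer; simp add: matrix_matrix_mult_def sum_2)+

lemma slh_one [simp]: "m11 1 = 1" "m12 1 = 0" "m21 1 = 0" "m22 1 = 1"
  by (transfer; simp add: mat_def)+

lemma slh_inverse [simp]:
  "m11 (inverse g) = m22 g" "m12 (inverse g) = - m12 g" "m21 (inverse g) = - m21 g" "m22 (inverse g) = m11 g"
  by (transfer; simp)+

lemma bij_betw_Rep_slh: "bij_betw Rep_slh UNIV (carrier SL2_Z_half)"
  using type_definition.Rep_range[OF type_definition_slh]
  by (auto simp: bij_betw_def inj_def Rep_slh_inject)

lemma Rep_slh_mult: "Rep_slh (g * h) = Rep_slh g \<otimes>\<^bsub>SL2_Z_half\<^esub> Rep_slh h"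
  by (simp add: times_slh.rep_eq SL2_Z_half_def SL_def)

section \<open>Generators, their relations, and the conjugation between the two vertex
  groups\<close>

definition mk :: "rat \<Rightarrow> rat \<Rightarrow> rat \<Rightarrow> rat \<Rightarrow> slh"
  where "mk p q r s = Abs_slh (mat2 p q r s)"

lemma mk_entries:
  assumes "p \<in> Z_half" "q \<in> Z_half" "r \<in> Z_half" "s \<in> Z_half" "p * s - q * r = 1"
  shows "m11 (mk p q r s) = p" "m12 (mk p q r s) = q" "m21 (mk p q r s) = r" "m22 (mk p q r s) = s"
  using assms by (simp_all add: mk_def m11.rep_eq m12.rep_eq m21.rep_eq m22.rep_eq Abs_slh_inverse carrier_SL2_Z_half)

definition ga :: slh where "ga = mk 0 (-1) 1 0"
definition gb :: slh where "gb = mk 0 (-1) 1 1"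
definition gc :: slh where "gc = mk (1/2) (-3/2) (1/2) (1/2)"
definition gz :: slh where "gz = mk (-1) 0 0 (-1)"

lemma three_halves: "- (3/2) \<in> Z_half"
  using Z_half_uminus[OF Z_half_div_2[OF Z_half_of_int[of 3]]] by simp

lemma ga_entries [simp]: "m11 ga = 0" "m12 ga = -1" "m21 ga = 1" "m22 ga = 0"
  unfolding ga_def by (subst mk_entries; simp add: Z_half_0 Z_half_1 Z_half_uminus)+

lemma gb_entries [simp]: "m11 gb = 0" "m12 gb = -1" "m21 gb = 1" "m22 gb = 1"
  unfolding gb_def by (subst mk_entries; simp add: Z_half_0 Z_half_1 Z_half_uminus)+

lemma gc_entries [simp]: "m11 gc = 1/2" "m12 gc = -3/2" "m21 gc = 1/2" "m22 gc = 1/2"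
  unfolding gc_def by (subst mk_entries; simp add: Z_half_half three_halves)+

lemma gz_entries [simp]: "m11 gz = -1" "m12 gz = 0" "m21 gz = 0" "m22 gz = -1"
  unfolding gz_def by (subst mk_entries; simp add: Z_half_0 Z_half_1 Z_half_uminus)+

lemma generator_relations:
  "ga * ga = gz" "gb * (gb * gb) = gz" "gc * (gc * gc) = gz" "gz * gz = 1"
  "gb * (ga * (gb * (gc * (ga * gc)))) = ga"
  by (simp_all add: slh_eq_iff)

lemma exact_order_gens:
  "exact_order ga 4" "exact_order gb 6" "exact_order gc 6" "exact_order gz 2"
  by (auto simp: exact_order_def slh_eq_iff eval_nat_numeral less_Suc_eq)

text \<open>Conjugation by \<open>\<eta> = ((1, -1), (1, 1))\<close>, which commutes with \<open>ga\<close>, has determinant \<open>2\<close> and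
  exchanges the two conjugacy classes of copies of \<open>SL\<^sub>2(\<int>)\<close>.\<close>

definition \<tau> :: "slh \<Rightarrow> slh"
  where "\<tau> g = mk ((m11 g - m12 g - m21 g + m22 g) / 2) ((m11 g + m12 g - m21 g - m22 g) / 2)
    ((m11 g - m12 g + m21 g - m22 g) / 2) ((m11 g + m12 g + m21 g + m22 g) / 2)"

lemma \<tau>_entries [simp]:
  "m11 (\<tau> g) = (m11 g - m12 g - m21 g + m22 g) / 2" "m12 (\<tau> g) = (m11 g + m12 g - m21 g - m22 g) / 2"
  "m21 (\<tau> g) = (m11 g - m12 g + m21 g - m22 g) / 2" "m22 (\<tau> g) = (m11 g + m12 g + m21 g + m22 g) / 2"
proof -
  have "(m11 g - m12 g - m21 g + m22 g) / 2 * ((m11 g + m12 g + m21 g + m22 g) / 2)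
    - (m11 g + m12 g - m21 g - m22 g) / 2 * ((m11 g - m12 g + m21 g - m22 g) / 2) = 1"
    using slh_det[of g] by (simp add: field_simps)
  from mk_entries[OF _ _ _ _ this]
  show "m11 (\<tau> g) = (m11 g - m12 g - m21 g + m22 g) / 2" "m12 (\<tau> g) = (m11 g + m12 g - m21 g - m22 g) / 2"
    "m21 (\<tau> g) = (m11 g - m12 g + m21 g - m22 g) / 2" "m22 (\<tau> g) = (m11 g + m12 g + m21 g + m22 g) / 2"
    unfolding \<tau>_def by (simp_all add: Z_half_div_2 Z_half_add Z_half_diff)
qed

lemma \<tau>_mult: "\<tau> (g * h) = \<tau> g * \<tau> h"
  by (simp add: slh_eq_iff field_simps)

lemma \<tau>_gens [simp]: "\<tau> ga = ga" "\<tau> gb = gc" "\<tau> 1 = 1"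
  by (simp_all add: slh_eq_iff)

lemma \<tau>_\<tau>: "\<tau> (\<tau> g) = ga * g * inverse ga"
  by (simp add: slh_eq_iff field_simps)

lemma \<tau>_inverse: "\<tau> (inverse g) = inverse (\<tau> g)"
  by (simp add: slh_eq_iff field_simps)

section \<open>The tree of \<open>SL\<^sub>2(\<int>)\<close>\<close>

definition SLZ :: "slh set"
  where "SLZ = {g. m11 g \<in> \<int> \<and> m12 g \<in> \<int> \<and> m21 g \<in> \<int> \<and> m22 g \<in> \<int>}"

lemma SLZ_mult: "g \<in> SLZ \<Longrightarrow> h \<in> SLZ \<Longrightarrow> g * h \<in> SLZ"
  and SLZ_inverse: "g \<in> SLZ \<Longrightarrow> inverse g \<in> SLZ"
  and SLZ_gens [simp]: "1 \<in> SLZ" "ga \<in> SLZ" "gb \<in> SLZ" "gz \<in> SLZ"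
  by (auto simp: SLZ_def)

lemma SLZ_cases:
  assumes "g \<in> SLZ"
  obtains p q r s :: int where "m11 g = of_int p" "m12 g = of_int q" "m21 g = of_int r" "m22 g = of_int s"
    "p * s - q * r = 1"
proof -
  obtain p q r s :: int where e: "m11 g = of_int p" "m12 g = of_int q" "m21 g = of_int r" "m22 g = of_int s"
    using assms by (auto simp: SLZ_def elim!: Ints_cases)
  then have "rat_of_int (p * s - q * r) = 1" using slh_det[of g] by simp
  then have "p * s - q * r = 1" by (simp only: of_int_eq_1_iff)
  with e that show ?thesis by blast
qed

definition cycA :: "slh set" where "cycA = {1, ga, gz, gz * ga}"
definition cycB :: "slh set" where "cycB = {1, gb, gb * gb, gz, gz * gb, gz * (gb * gb)}"

text \<open>The columns of \<open>g\<close> are the ends of an edge of the Farey tessellation, which depends on the coset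
  \<open>g \<langle>ga\<rangle>\<close>; the coset \<open>g \<langle>gb\<rangle>\<close> is a triangle containing it, whose third vertex is the difference of
  the columns. The largest of the \<open>l\<^sup>1\<close> norms of the three vertices is the sum of the other two.\<close>

definition dA1 :: "slh \<Rightarrow> nat"
  where "dA1 g = nat (2 * (\<bar>\<lfloor>m11 g\<rfloor>\<bar> + \<bar>\<lfloor>m12 g\<rfloor>\<bar> + \<bar>\<lfloor>m21 g\<rfloor>\<bar> + \<bar>\<lfloor>m22 g\<rfloor>\<bar>))"

definition dB1 :: "slh \<Rightarrow> nat"
  where "dB1 g = nat (\<bar>\<lfloor>m11 g\<rfloor>\<bar> + \<bar>\<lfloor>m12 g\<rfloor>\<bar> + \<bar>\<lfloor>m11 g - m12 g\<rfloor>\<bar>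
    + \<bar>\<lfloor>m21 g\<rfloor>\<bar> + \<bar>\<lfloor>m22 g\<rfloor>\<bar> + \<bar>\<lfloor>m21 g - m22 g\<rfloor>\<bar> + 1)"

lemma dA1_of_int:
  assumes "m11 g = of_int p" "m12 g = of_int q" "m21 g = of_int r" "m22 g = of_int s"
  shows "dA1 g = nat (2 * (\<bar>p\<bar> + \<bar>q\<bar> + \<bar>r\<bar> + \<bar>s\<bar>))"
  unfolding dA1_def assms by simp

lemma dB1_of_int:
  assumes "m11 g = of_int p" "m12 g = of_int q" "m21 g = of_int r" "m22 g = of_int s"
  shows "dB1 g = nat (\<bar>p\<bar> + \<bar>q\<bar> + \<bar>p - q\<bar> + \<bar>r\<bar> + \<bar>s\<bar> + \<bar>r - s\<bar> + 1)"
  unfolding dB1_def assms by (simp flip: of_int_diff)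

text \<open>The product of the two row products is \<open>n * (n + 1)\<close>, never negative for an
  integer. Hence the norms of the columns add up in their sum, or in their difference, in both rows
  at once.\<close>

lemma det_1_signs:
  fixes p q r s :: int
  assumes "p * s - q * r = 1"
  shows "p * q \<ge> 0 \<and> r * s \<ge> 0 \<or> p * q \<le> 0 \<and> r * s \<le> 0"
proof -
  define n where "n = q * r"
  have "p * q * (r * s) = (q * r) * (p * s)" by (simp add: algebra_simps)
  also have "p * s = q * r + 1" using assms by simp
  finally have "p * q * (r * s) = n * (n + 1)" by (simp add: n_def)
  moreover have "n * (n + 1) \<ge> 0" by (cases "n \<ge> 0") (auto simp: zero_le_mult_iff)
  ultimately show ?thesis using zero_le_mult_iff[of "p * q" "r * s"] by simp
qed

lemma abs_diff_eq: "p * q \<le> 0 \<Longrightarrow> \<bar>p - q\<bar> = \<bar>p\<bar> + \<bar>q\<bar>"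
  and abs_add_eq: "p * q \<ge> 0 \<Longrightarrow> \<bar>p + q\<bar> = \<bar>p\<bar> + \<bar>q\<bar>"
  and abs_diff_less: "p * q > 0 \<Longrightarrow> \<bar>p - q\<bar> + 2 \<le> \<bar>p\<bar> + \<bar>q\<bar>"
  and abs_add_less: "p * q < 0 \<Longrightarrow> \<bar>p + q\<bar> + 2 \<le> \<bar>p\<bar> + \<bar>q\<bar>" for p q :: int
  by (auto simp: mult_le_0_iff zero_le_mult_iff mult_less_0_iff zero_less_mult_iff)

lemma eq_of_signs:
  fixes p q :: int
  assumes "p * q > 0" "q * (q - p) \<ge> 0" "p * (p - q) \<ge> 0"
  shows "p = q"
  using assms by (auto simp: zero_le_mult_iff zero_less_mult_iff)

text \<open>The three alternatives belong to the edges of the triangle, each saying that the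
  opposite vertex has the largest norm. If all failed, \<open>det_1_signs\<close> and
  \<open>eq_of_signs\<close> would make the columns equal.\<close>

lemma triangle_base:
  fixes p q r s :: int
  assumes det: "p * s - q * r = 1"
  shows "p * q \<le> 0 \<and> r * s \<le> 0 \<or> q * (q - p) \<le> 0 \<and> s * (s - r) \<le> 0 \<or> (q - p) * (- p) \<le> 0 \<and> (s - r) * (- r) \<le> 0"
proof (rule ccontr)
  assume neg: "\<not> ?thesis"
  have "q * (s - r) - (q - p) * s = 1" "(q - p) * (- r) - (- p) * (s - r) = 1"
    using det by (simp_all add: algebra_simps)
  note S = det_1_signs[OF det] det_1_signs[OF this(1)] det_1_signs[OF this(2)]
  have n: "p * q \<ge> 0" "r * s \<ge> 0" "q * (q - p) \<ge> 0" "s * (s - r) \<ge> 0" "p * (p - q) \<ge> 0" "r * (r - s) \<ge> 0"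
    and pos: "p * q > 0 \<or> r * s > 0" "q * (q - p) > 0 \<or> s * (s - r) > 0"  "p * (p - q) > 0 \<or> r * (r - s) > 0"
    using S neg by (auto simp: algebra_simps)
  from pos(1) show False
  proof
    assume pq: "p * q > 0"
    then have "p = q" using n eq_of_signs by blast
    then have "r \<noteq> 0" "s \<noteq> 0" using pos(2,3) by auto
    then have "r * s > 0" using n(2) by (simp add: order_less_le)
    then have "r = s" using n eq_of_signs by blast
    then show False using det \<open>p = q\<close> by simp
  next
    assume rs: "r * s > 0"
    then have "r = s" using n eq_of_signs by blast
    then have "p \<noteq> 0" "q \<noteq> 0" using pos(2,3) by auto
    then have "p * q > 0" using n(1) by (simp add: order_less_le)
    then have "p = q" using n eq_of_signs by blast
    then show False using det \<open>r = s\<close> by simp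
  qed
qed

lemma zero_products_SLZ:
  assumes "g \<in> SLZ" "m11 g * m12 g = 0" "m21 g * m22 g = 0"
  shows "g \<in> cycA"
proof -
  obtain p q r s :: int where e: "m11 g = of_int p" "m12 g = of_int q" "m21 g = of_int r" "m22 g = of_int s"
    and d: "p * s - q * r = 1" using SLZ_cases[OF assms(1)] .
  have "p * q = 0" "r * s = 0" using assms(2,3) by (simp_all add: e)
  then have "p = 0 \<and> s = 0 \<and> q * r = -1 \<or> q = 0 \<and> r = 0 \<and> p * s = 1" using d by auto
  then have "p = 0 \<and> s = 0 \<and> (q = 1 \<and> r = -1 \<or> q = -1 \<and> r = 1) \<or> q = 0 \<and> r = 0 \<and> (p = 1 \<and> s = 1 \<or> p = -1 \<and> s = -1)"
    using zmult_eq_1_iff[of p s] zmult_eq_1_iff[of q "- r"] by auto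
  then show ?thesis
    by (auto simp: cycA_def slh_eq_iff e)
qed

interpretation slz: rooted_tree SLZ cycA cycB dA1 dB1
proof
  have cycS: "k \<in> SLZ" if "k \<in> cycA \<union> cycB" for k
    using that by (auto simp: cycA_def cycB_def intro!: SLZ_mult)
  show "g * k \<in> SLZ" if "g \<in> SLZ" "k \<in> cycA" for g k using that SLZ_mult cycS by blast
  show "g * k \<in> SLZ" if "g \<in> SLZ" "k \<in> cycB" for g k using that SLZ_mult cycS by blast
  have "\<forall>k\<in>cycA. \<forall>l\<in>cycA. k * l \<in> cycA" unfolding cycA_def by (simp add: slh_eq_iff)
  then show "k * l \<in> cycA" if "k \<in> cycA" "l \<in> cycA" for k l
    using that by blast
  have "\<forall>k\<in>cycA. inverse k \<in> cycA" unfolding cycA_def by (simp add: slh_eq_iff)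
  then show "inverse k \<in> cycA" if "k \<in> cycA" for k
    using that by blast
  have "\<forall>k\<in>cycB. \<forall>l\<in>cycB. k * l \<in> cycB" unfolding cycB_def by (simp add: slh_eq_iff)
  then show "k * l \<in> cycB" if "k \<in> cycB" "l \<in> cycB" for k l
    using that by blast
  have "\<forall>k\<in>cycB. inverse k \<in> cycB" unfolding cycB_def by (simp add: slh_eq_iff)
  then show "inverse k \<in> cycB" if "k \<in> cycB" for k
    using that by blast
  show "1 \<in> cycA" "1 \<in> cycB" by (auto simp: cycA_def cycB_def)
  fix g assume g: "g \<in> SLZ"
  obtain p q r s :: int where e: "m11 g = of_int p" "m12 g = of_int q" "m21 g = of_int r" "m22 g = of_int s"
    and d: "p * s - q * r = 1" using SLZ_cases[OF g] .
  note A = dA1_of_int[OF e] and B = dB1_of_int[OF e]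
  have Aga: "dA1 (g * ga) = nat (2 * (\<bar>q\<bar> + \<bar>- p\<bar> + \<bar>s\<bar> + \<bar>- r\<bar>))"
    by (rule dA1_of_int) (simp_all add: e)
  have Agz: "dA1 (g * gz) = nat (2 * (\<bar>- p\<bar> + \<bar>- q\<bar> + \<bar>- r\<bar> + \<bar>- s\<bar>))"
    by (rule dA1_of_int) (simp_all add: e)
  have Agza: "dA1 (g * (gz * ga)) = nat (2 * (\<bar>- q\<bar> + \<bar>p\<bar> + \<bar>- s\<bar> + \<bar>r\<bar>))"
    by (rule dA1_of_int) (simp_all add: e)
  have Ab: "dA1 (g * gb) = nat (2 * (\<bar>q\<bar> + \<bar>q - p\<bar> + \<bar>s\<bar> + \<bar>s - r\<bar>))"
    by (rule dA1_of_int) (simp_all add: e)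
  have Azb: "dA1 (g * (gz * gb)) = nat (2 * (\<bar>- q\<bar> + \<bar>p - q\<bar> + \<bar>- s\<bar> + \<bar>r - s\<bar>))"
    by (rule dA1_of_int) (simp_all add: e)
  have Abb: "dA1 (g * (gb * gb)) = nat (2 * (\<bar>q - p\<bar> + \<bar>- p\<bar> + \<bar>s - r\<bar> + \<bar>- r\<bar>))"
    by (rule dA1_of_int) (simp_all add: e)
  have Azbb: "dA1 (g * (gz * (gb * gb))) = nat (2 * (\<bar>p - q\<bar> + \<bar>p\<bar> + \<bar>r - s\<bar> + \<bar>r\<bar>))"
    by (rule dA1_of_int) (simp_all add: e)
  have Bga: "dB1 (g * ga) = nat (\<bar>q\<bar> + \<bar>- p\<bar> + \<bar>q - - p\<bar> + \<bar>s\<bar> + \<bar>- r\<bar> + \<bar>s - - r\<bar> + 1)"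
    by (rule dB1_of_int) (simp_all add: e)
  have Bgza: "dB1 (g * (gz * ga)) = nat (\<bar>- q\<bar> + \<bar>p\<bar> + \<bar>- q - p\<bar> + \<bar>- s\<bar> + \<bar>r\<bar> + \<bar>- s - r\<bar> + 1)"
    by (rule dB1_of_int) (simp_all add: e)
  have Bgz: "dB1 (g * gz) = nat (\<bar>- p\<bar> + \<bar>- q\<bar> + \<bar>- p - - q\<bar> + \<bar>- r\<bar> + \<bar>- s\<bar> + \<bar>- r - - s\<bar> + 1)"
    by (rule dB1_of_int) (simp_all add: e)
  have Bb: "dB1 (g * gb) = nat (\<bar>q\<bar> + \<bar>q - p\<bar> + \<bar>q - (q - p)\<bar> + \<bar>s\<bar> + \<bar>s - r\<bar> + \<bar>s - (s - r)\<bar> + 1)"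
    by (rule dB1_of_int) (simp_all add: e)
  have Bbb: "dB1 (g * (gb * gb)) = nat (\<bar>q - p\<bar> + \<bar>- p\<bar> + \<bar>(q - p) - - p\<bar> + \<bar>s - r\<bar> + \<bar>- r\<bar> + \<bar>(s - r) - - r\<bar> + 1)"
    by (rule dB1_of_int) (simp_all add: e)
  have Bzb: "dB1 (g * (gz * gb)) = nat (\<bar>- q\<bar> + \<bar>p - q\<bar> + \<bar>- q - (p - q)\<bar> + \<bar>- s\<bar> + \<bar>r - s\<bar> + \<bar>- s - (r - s)\<bar> + 1)"
    by (rule dB1_of_int) (simp_all add: e)
  have Bzbb: "dB1 (g * (gz * (gb * gb))) = nat (\<bar>p - q\<bar> + \<bar>p\<bar> + \<bar>(p - q) - p\<bar> + \<bar>r - s\<bar> + \<bar>r\<bar> + \<bar>(r - s) - r\<bar> + 1)"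
    by (rule dB1_of_int) (simp_all add: e)
  have comm: "\<bar>q - p\<bar> = \<bar>p - q\<bar>" "\<bar>s - r\<bar> = \<bar>r - s\<bar>" "\<bar>- q - p\<bar> = \<bar>p + q\<bar>" "\<bar>- s - r\<bar> = \<bar>r + s\<bar>"
    "\<bar>q - - p\<bar> = \<bar>p + q\<bar>" "\<bar>s - - r\<bar> = \<bar>r + s\<bar>"
    "\<bar>- p - - q\<bar> = \<bar>p - q\<bar>" "\<bar>- r - - s\<bar> = \<bar>r - s\<bar>" "\<bar>q - (q - p)\<bar> = \<bar>p\<bar>" "\<bar>s - (s - r)\<bar> = \<bar>r\<bar>"
    "\<bar>q - p - - p\<bar> = \<bar>q\<bar>" "\<bar>s - r - - r\<bar> = \<bar>s\<bar>" "\<bar>- q - (p - q)\<bar> = \<bar>p\<bar>" "\<bar>- s - (r - s)\<bar> = \<bar>r\<bar>"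
    "\<bar>p - q - p\<bar> = \<bar>q\<bar>" "\<bar>r - s - r\<bar> = \<bar>s\<bar>"
    by linarith+
  have "\<forall>k\<in>cycA. dA1 (g * k) = dA1 g"
    unfolding cycA_def ball_simps Aga Agz Agza A by (simp only: abs_minus_cancel add_ac mult_1_right simp_thms A)
  then show Ak: "dA1 (g * k) = dA1 g" if "k \<in> cycA" for k
    using that by blast
  have "\<forall>k\<in>cycB. dB1 (g * k) = dB1 g"
    unfolding cycB_def ball_simps Bgz Bb Bbb Bzb Bzbb comm by (simp only: abs_minus_cancel add_ac mult_1_right simp_thms B)
  then show Bk: "dB1 (g * k) = dB1 g" if "k \<in> cycB" for k
    using that by blast
  text \<open>Opaque names, since linear arithmetic would split every absolute value.\<close>
  define P Q R S D D' E E' where abs: "P = \<bar>p\<bar>" "Q = \<bar>q\<bar>" "R = \<bar>r\<bar>" "S = \<bar>s\<bar>"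
    "D = \<bar>p - q\<bar>" "D' = \<bar>r - s\<bar>" "E = \<bar>p + q\<bar>" "E' = \<bar>r + s\<bar>"
  have nonneg: "P \<ge> 0" "Q \<ge> 0" "R \<ge> 0" "S \<ge> 0" "D \<ge> 0" "D' \<ge> 0" "E \<ge> 0" "E' \<ge> 0"
    by (simp_all add: abs)
  have A: "int (dA1 g) = 2 * (P + Q + R + S)" and B: "int (dB1 g) = P + Q + D + R + S + D' + 1"
    using nonneg unfolding A B abs[symmetric] by simp_all
  have Aa: "dA1 (g * ga) = dA1 g" "dA1 (g * (gz * ga)) = dA1 g" using Ak by (simp_all add: cycA_def)
  have Ba: "int (dB1 (g * ga)) = P + Q + E + R + S + E' + 1"
    and Bza: "int (dB1 (g * (gz * ga))) = P + Q + E + R + S + E' + 1"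
    using nonneg unfolding Bga Bgza comm abs_minus_cancel abs[symmetric] by simp_all
  have Ab: "int (dA1 (g * gb)) = 2 * (Q + D + S + D')" "int (dA1 (g * (gz * gb))) = 2 * (Q + D + S + D')"
    and Abb: "int (dA1 (g * (gb * gb))) = 2 * (P + D + R + D')"
      "int (dA1 (g * (gz * (gb * gb)))) = 2 * (P + D + R + D')"
    using nonneg unfolding Ab Azb Abb Azbb comm abs_minus_cancel abs[symmetric] by simp_all
  \<comment> \<open>The summand 1 in \<open>dB1\<close> separates the heights by parity. Since a
    triangle has height twice its largest norm plus one, the edge opposite its largest vertex lies
    just below it.\<close>
  have "even (P + Q + D + R + S + D')" by (simp add: abs)
  then have "P + Q + D + R + S + D' + 1 \<noteq> 2 * (P + Q + R + S)"
    by (metis dvd_triv_left even_plus_one_iff)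
  then show "dA1 g \<noteq> dB1 g" using A B by linarith
  have sub: "p * q \<le> 0 \<Longrightarrow> D = P + Q" "r * s \<le> 0 \<Longrightarrow> D' = R + S"
    and add: "p * q \<ge> 0 \<Longrightarrow> E = P + Q" "r * s \<ge> 0 \<Longrightarrow> E' = R + S"
    and subl: "p * q > 0 \<Longrightarrow> D + 2 \<le> P + Q" "r * s > 0 \<Longrightarrow> D' + 2 \<le> R + S"
    and addl: "p * q < 0 \<Longrightarrow> E + 2 \<le> P + Q" "r * s < 0 \<Longrightarrow> E' + 2 \<le> R + S"
    unfolding abs by (rule abs_diff_eq abs_add_eq abs_diff_less abs_add_less; assumption)+
  show "k \<in> cycB" if "k \<in> cycA" "dB1 g < dA1 g" "dB1 (g * k) < dA1 (g * k)" for k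
  proof (rule ccontr)
    assume "k \<notin> cycB"
    then have "k = ga \<or> k = gz * ga" using that(1) by (auto simp: cycA_def cycB_def)
    then have "int (dB1 (g * k)) = P + Q + E + R + S + E' + 1" "dA1 (g * k) = dA1 g"
      using Aa Ba Bza by auto
    moreover have "int (dB1 g) < int (dA1 g)" "int (dB1 (g * k)) < int (dA1 (g * k))"
      using that(2,3) by simp_all
    ultimately have "E + E' + 1 < P + Q + R + S \<and> D + D' + 1 < P + Q + R + S"
      using A B by simp
    \<comment> \<open>The two triangles at an edge have the sum and the difference of its ends as
      third vertices; one of these has the full norm, so they cannot both be lower than the
      edge.\<close>
    then show False
      using det_1_signs[OF d] sub add by linarith
  qed
  show "k \<in> cycA" if "k \<in> cycB" "dA1 g < dB1 g" "dA1 (g * k) < dB1 (g * k)" for k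
  proof (rule ccontr)
    assume "k \<notin> cycA"
    then have "k = gb \<or> k = gz * gb \<or> k = gb * gb \<or> k = gz * (gb * gb)"
      using that(1) by (auto simp: cycA_def cycB_def)
    then have "int (dA1 (g * k)) = 2 * (Q + D + S + D') \<or> int (dA1 (g * k)) = 2 * (P + D + R + D')"
      using Ab Abb by auto
    moreover have "int (dA1 g) < int (dB1 g)" "int (dA1 (g * k)) < int (dB1 g)"
      using that(2,3) Bk[OF that(1)] by simp_all
    ultimately have "Q + D + S + D' \<le> P + R \<or> P + D + R + D' \<le> Q + S"
      and "P + Q + R + S \<le> D + D'"
      using A B by auto
    \<comment> \<open>Two lower edges in one triangle would force a zero column, against the
      determinant.\<close>
    then have "Q = 0 \<and> S = 0 \<or> P = 0 \<and> R = 0" using nonneg by linarith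
    then show False using d by (auto simp: abs)
  qed
  show "\<exists>k\<in>cycA. dB1 (g * k) < dA1 g" if "g \<notin> cycA"
  proof -
    have nz: "p * q \<noteq> 0 \<or> r * s \<noteq> 0"
      using zero_products_SLZ[OF g] that by (auto simp: e)
    from det_1_signs[OF d] show ?thesis
    proof
      assume *: "p * q \<ge> 0 \<and> r * s \<ge> 0"
      then have "p * q > 0 \<or> r * s > 0" using nz by linarith
      moreover have "D \<le> P + Q" "D' \<le> R + S" unfolding abs by linarith+
      ultimately have "D + D' + 2 \<le> P + Q + R + S"
        using subl by linarith
      then have "int (dB1 (g * 1)) < int (dA1 g)" using A B by simp
      then have "dB1 (g * 1) < dA1 g" by simp
      then show ?thesis unfolding cycA_def by blast
    next
      assume *: "p * q \<le> 0 \<and> r * s \<le> 0"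
      then have "p * q < 0 \<or> r * s < 0" using nz by linarith
      moreover have "E \<le> P + Q" "E' \<le> R + S" unfolding abs by linarith+
      ultimately have "E + E' + 2 \<le> P + Q + R + S"
        using addl by linarith
      then have "int (dB1 (g * ga)) < int (dA1 g)" using A Ba by simp
      then have "dB1 (g * ga) < dA1 g" by simp
      then show ?thesis unfolding cycA_def by blast
    qed
  qed
  show "\<exists>k\<in>cycB. dA1 (g * k) < dB1 g"
  proof -
    from triangle_base[OF d]
    have "D + D' = P + Q + R + S \<or> P + R = Q + D + S + D' \<or> Q + S = P + D + R + D'"
    proof (elim disjE)
      assume "p * q \<le> 0 \<and> r * s \<le> 0"
      then show ?thesis using sub by simp
    next
      assume "q * (q - p) \<le> 0 \<and> s * (s - r) \<le> 0"
      then show ?thesis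
        using abs_diff_eq[of q "q - p"] abs_diff_eq[of s "s - r"] unfolding comm abs by simp
    next
      assume "(q - p) * - p \<le> 0 \<and> (s - r) * - r \<le> 0"
      then show ?thesis
        using abs_diff_eq[of "q - p" "- p"] abs_diff_eq[of "s - r" "- r"] unfolding comm abs by simp
    qed
    then have "int (dA1 (g * 1)) < int (dB1 g) \<or> int (dA1 (g * gb)) < int (dB1 g) \<or> int (dA1 (g * (gb * gb))) < int (dB1 g)"
      unfolding mult_1_right A B Ab Abb by presburger
    then have "dA1 (g * 1) < dB1 g \<or> dA1 (g * gb) < dB1 g \<or> dA1 (g * (gb * gb)) < dB1 g" by simp
    then show ?thesis unfolding cycB_def by blast
  qed
qed

lemma coset_representatives:
  fixes H :: "'g::group_mult set"
  assumes "1 \<in> H" "\<And>h k. h \<in> H \<Longrightarrow> k \<in> H \<Longrightarrow> h * k \<in> H" "\<And>h. h \<in> H \<Longrightarrow> inverse h \<in> H"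
  obtains \<rho> where "\<And>g h. h \<in> H \<Longrightarrow> \<rho> (g * h) = \<rho> g" "\<And>g. inverse (\<rho> g) * g \<in> H"
proof
  define \<rho> where "\<rho> g = (SOME x. x \<in> {g * h |h. h \<in> H})" for g
  have "{g * k * h |h. h \<in> H} = {g * h |h. h \<in> H}" if "k \<in> H" for g k
  proof (intro equalityI subsetI)
    fix x assume "x \<in> {g * k * h |h. h \<in> H}"
    then show "x \<in> {g * h |h. h \<in> H}" using that assms(2) by (auto simp: mult.assoc)
  next
    fix x assume "x \<in> {g * h |h. h \<in> H}"
    then obtain h where "h \<in> H" "x = g * k * (inverse k * h)" by (auto simp: mult.assoc)
    then show "x \<in> {g * k * h |h. h \<in> H}" using that assms(2,3) by blast
  qed
  then show "\<rho> (g * h) = \<rho> g" if "h \<in> H" for g h using that by (simp add: \<rho>_def)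
  fix g
  have "\<rho> g \<in> {g * h |h. h \<in> H}"
    unfolding \<rho>_def by (rule someI[of _ "g * 1"]) (use assms(1) in blast)
  then obtain h where "h \<in> H" "\<rho> g = g * h" by blast
  then have "inverse (\<rho> g) * g = inverse h" by (simp add: inverse_mult_distrib_group mult.assoc left_inverse_mult)
  then show "inverse (\<rho> g) * g \<in> H" using assms(3) \<open>h \<in> H\<close> by simp
qed

text \<open>The tree of \<open>SLZ\<close> gives the splitting on each coset of \<open>SLZ\<close>
  separately; representatives glue the pieces to functions on the whole group.\<close>

lemma split_ga_gb:
  fixes v :: "slh \<Rightarrow> int"
  assumes v: "\<And>g. v (g * gz) = v g"
  obtains p q where "\<And>g. p (g * ga) = p g" "\<And>g. q (g * gb) = q g" "\<And>g. v g = p g - (q g :: int)"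
proof -
  obtain \<rho> where r: "\<And>g h. h \<in> SLZ \<Longrightarrow> \<rho> (g * h) = \<rho> g" "\<And>g. inverse (\<rho> g) * g \<in> SLZ"
    using coset_representatives[of SLZ] SLZ_gens(1) SLZ_mult SLZ_inverse by metis
  have "\<exists>p q. (\<forall>g\<in>SLZ. p (g * ga) = p g \<and> q (g * gb) = q g \<and> v (h * g) = p g - (q g :: int))" for h
  proof (rule slz.split[of "\<lambda>k. v (h * k)"])
    fix g k assume "k \<in> cycA" "k \<in> cycB"
    then have "k = 1 \<or> k = gz" by (auto simp: cycA_def cycB_def slh_eq_iff)
    then show "v (h * (g * k)) = v (h * g)" using v[of "h * g"] by (auto simp: mult.assoc)
  next
    fix p q
    assume "\<And>g k. g \<in> SLZ \<Longrightarrow> k \<in> cycA \<Longrightarrow> p (g * k) = p g"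
      "\<And>g k. g \<in> SLZ \<Longrightarrow> k \<in> cycB \<Longrightarrow> q (g * k) = q g"
      "\<And>g. g \<in> SLZ \<Longrightarrow> v (h * g) = p g - q g"
    then show "\<exists>p q. (\<forall>g\<in>SLZ. p (g * ga) = p g \<and> q (g * gb) = q g \<and> v (h * g) = p g - (q g :: int))"
      by (intro exI[of _ p] exI[of _ q]) (simp add: cycA_def cycB_def)
  qed
  then obtain p q where pq: "\<And>h g. g \<in> SLZ \<Longrightarrow> p h (g * ga) = p h g"
    "\<And>h g. g \<in> SLZ \<Longrightarrow> q h (g * gb) = q h g" "\<And>h g. g \<in> SLZ \<Longrightarrow> v (h * g) = p h g - (q h g :: int)"
    by metis
  show ?thesis
  proof (rule that[of "\<lambda>g. p (\<rho> g) (inverse (\<rho> g) * g)" "\<lambda>g. q (\<rho> g) (inverse (\<rho> g) * g)"])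
    fix g
    show "p (\<rho> (g * ga)) (inverse (\<rho> (g * ga)) * (g * ga)) = p (\<rho> g) (inverse (\<rho> g) * g)"
      using pq(1)[OF r(2)] r(1) by (simp add: mult.assoc)
    show "q (\<rho> (g * gb)) (inverse (\<rho> (g * gb)) * (g * gb)) = q (\<rho> g) (inverse (\<rho> g) * g)"
      using pq(2)[OF r(2)] r(1) by (simp add: mult.assoc)
    show "v g = p (\<rho> g) (inverse (\<rho> g) * g) - q (\<rho> g) (inverse (\<rho> g) * g)"
      using pq(3)[OF r(2), of "\<rho> g" g] by simp
  qed
qed

text \<open>Descent to the root stands in for the fact that \<open>ga\<close> and \<open>gb\<close>
  generate \<open>SLZ\<close>.\<close>

lemma SLZ_invariant:
  fixes x :: "slh \<Rightarrow> int"
  assumes a: "\<And>g. x (g * ga) = x g" and b: "\<And>g. x (g * gb) = x g" and k: "k \<in> SLZ"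
  shows "x (g * k) = x g"
proof -
  have z: "x (g * gz) = x g" for g
    using a[of "g * ga"] a[of g] by (simp add: mult.assoc generator_relations)
  have "x (g * k) = x (g * 1)"
  proof (rule slz.invariant_const[of "\<lambda>k. x (g * k)", OF _ k])
    fix h k assume "k \<in> cycA \<union> cycB"
    then show "x (g * (h * k)) = x (g * h)"
      using a[of "g * h"] b[of "g * h"] z[of "g * h"] a[of "g * h * gz"] b[of "g * h * gb"]
        b[of "g * h * gz"] b[of "g * h * gz * gb"]
      by (auto simp: cycA_def cycB_def mult.assoc)
  qed
  then show ?thesis by simp
qed

section \<open>The edge group\<close>

definition SLZ' :: "slh set" where "SLZ' = {g. \<tau> g \<in> SLZ}"

definition gt :: slh where "gt = gb * (ga * gb)"

lemma SLZ'_mult: "g \<in> SLZ' \<Longrightarrow> h \<in> SLZ' \<Longrightarrow> g * h \<in> SLZ'"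
  and SLZ'_inverse: "g \<in> SLZ' \<Longrightarrow> inverse g \<in> SLZ'"
  by (simp_all add: SLZ'_def \<tau>_mult \<tau>_inverse SLZ_mult SLZ_inverse)

lemma \<tau>_\<tau>_SLZ: "\<tau> (\<tau> g) \<in> SLZ \<longleftrightarrow> g \<in> SLZ"
proof -
  have "g = inverse ga * (\<tau> (\<tau> g)) * ga" by (simp add: \<tau>_\<tau> mult.assoc left_inverse_mult)
  then show ?thesis by (metis \<tau>_\<tau> SLZ_mult SLZ_inverse SLZ_gens(2))
qed

lemma SLZ'_gens [simp]: "1 \<in> SLZ'" "ga \<in> SLZ'" "gc \<in> SLZ'"
proof -
  have "\<tau> (\<tau> gb) \<in> SLZ" by (simp only: \<tau>_\<tau>_SLZ SLZ_gens)
  then show "gc \<in> SLZ'" unfolding SLZ'_def by (simp del: \<tau>_entries)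
qed (simp_all add: SLZ'_def)

text \<open>Modulo 2 the condition leaves the identity and the swap among the six elements of
  \<open>SL\<^sub>2\<close> over the field of two elements, which is why the edge group has index
  three in \<open>SLZ\<close>.\<close>

lemma even_sum_iff:
  assumes "m11 g = of_int p" "m12 g = of_int q" "m21 g = of_int r" "m22 g = of_int s"
  shows "g \<in> SLZ' \<longleftrightarrow> even (p + q + r + s)"
proof -
  have half: "rat_of_int x / 2 \<in> \<int> \<longleftrightarrow> even x" for x
  proof
    assume "rat_of_int x / 2 \<in> \<int>"
    then obtain y where "rat_of_int x / 2 = of_int y" by (auto elim: Ints_cases)
    then have "rat_of_int x = of_int (2 * y)" by simp
    then have "x = 2 * y" by (simp only: of_int_eq_iff)
    then show "even x" by simp
  qed (auto elim!: evenE)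
  have "g \<in> SLZ' \<longleftrightarrow> rat_of_int (p - q - r + s) / 2 \<in> \<int> \<and> rat_of_int (p + q - r - s) / 2 \<in> \<int>
      \<and> rat_of_int (p - q + r - s) / 2 \<in> \<int> \<and> rat_of_int (p + q + r + s) / 2 \<in> \<int>"
    by (simp add: SLZ'_def SLZ_def assms)
  also have "\<dots> \<longleftrightarrow> even (p + q + r + s)" unfolding half by simp
  finally show ?thesis .
qed

lemma gt_mem: "gt \<in> SLZ" "gt \<in> SLZ'"
  using even_sum_iff[of gt 0 1 "-1" "-2"] by (simp_all add: gt_def SLZ_mult)

text \<open>The column sums \<open>p + r\<close> and \<open>q + s\<close> are not both even, as the
  determinant is odd; so exactly one of the two and their total is even.\<close>

lemma edge_cosets:
  assumes g: "g \<in> SLZ"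
  shows "(g \<in> SLZ' \<and> g * gb \<notin> SLZ' \<and> g * (gb * gb) \<notin> SLZ') \<or> (g \<notin> SLZ' \<and> g * gb \<in> SLZ' \<and> g * (gb * gb) \<notin> SLZ')
    \<or> (g \<notin> SLZ' \<and> g * gb \<notin> SLZ' \<and> g * (gb * gb) \<in> SLZ')"
proof -
  obtain p q r s :: int where e: "m11 g = of_int p" "m12 g = of_int q" "m21 g = of_int r" "m22 g = of_int s"
    and d: "p * s - q * r = 1" using SLZ_cases[OF g] .
  have 0: "g \<in> SLZ' \<longleftrightarrow> even (p + q + r + s)" by (rule even_sum_iff[OF e])
  have "g * gb \<in> SLZ' \<longleftrightarrow> even (q + (q - p) + s + (s - r))"
    by (rule even_sum_iff) (simp_all add: e)
  then have 1: "g * gb \<in> SLZ' \<longleftrightarrow> even (p + r)" by auto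
  have "g * (gb * gb) \<in> SLZ' \<longleftrightarrow> even ((q - p) + (- p) + (s - r) + (- r))"
    by (rule even_sum_iff) (simp_all add: e)
  then have 2: "g * (gb * gb) \<in> SLZ' \<longleftrightarrow> even (q + s)" by auto
  have "odd (p * s - q * r)" by (simp add: d)
  then show ?thesis unfolding 0 1 2 by auto
qed

lemma gb_words:
  "g * gb * (gb * gb) = g * gz" "g * gb * gb = g * (gb * gb)" "g * (gb * gb) * gb = g * gz"
  "g * (gb * gb) * (gb * gb) = g * gz * gb"
  "g * gz * gz = g" "g * ga * gz = g * gz * ga" "g * gb * gz = g * gz * gb" "g * ga * ga = g * gz"
  by (simp_all add: slh_eq_iff)

lemma SLZ'_right: "h \<in> SLZ' \<Longrightarrow> g * h \<in> SLZ' \<longleftrightarrow> g \<in> SLZ'"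
proof
  assume h: "h \<in> SLZ'" and "g * h \<in> SLZ'"
  then have "g * h * inverse h \<in> SLZ'" using SLZ'_mult SLZ'_inverse by blast
  then show "g \<in> SLZ'" by (simp add: mult.assoc right_inverse_mult)
qed (simp add: SLZ'_mult)

lemma gz_SLZ' [simp]: "gz \<in> SLZ'"
  using SLZ'_mult[of ga ga] by (simp add: generator_relations)

text \<open>A function on the edge group extends to \<open>SL\<^sub>2(\<int>)\<close>, which is the disjoint union of three
  cosets of it permuted cyclically by \<open>gb\<close>, the last two being exchanged by \<open>ga\<close>.\<close>

lemma edge_group_invariant:
  fixes w :: "slh \<Rightarrow> int"
  assumes a: "\<And>g. w (g * ga) = w g" and t: "\<And>g. w (g * gt) = w g" and k: "k \<in> SLZ" "k \<in> SLZ'"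
  shows "w (h * k) = w h"
proof -
  have z: "w (g * gz) = w g" for g
    using a[of "g * ga"] a[of g] by (simp add: gb_words)
  \<comment> \<open>Each \<open>k\<close> in \<open>SLZ\<close> is carried into the edge group by
    exactly one of \<open>1\<close>, \<open>gb\<close>, \<open>gb * gb\<close>. The extension is
    invariant under \<open>ga\<close> and \<open>gb\<close>, hence constant on
    \<open>SLZ\<close>.\<close>
  define W where "W k = (if k \<notin> SLZ then 0 else if k \<in> SLZ' then w (h * k)
    else if k * gb \<in> SLZ' then w (h * (k * gb)) else w (h * (k * (gb * gb))))" for k
  have SLZ_iff: "g * x \<in> SLZ \<longleftrightarrow> g \<in> SLZ" if "x \<in> SLZ" for g x
  proof
    assume "g * x \<in> SLZ"
    then have "g * x * inverse x \<in> SLZ" using SLZ_mult SLZ_inverse that by blast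
    then show "g \<in> SLZ" by (simp add: mult.assoc right_inverse_mult)
  qed (use SLZ_mult that in blast)
  have Wb: "W (g * gb) = W g" for g
  proof (cases "g \<in> SLZ")
    case True
    have z': "w (h * (g * gz)) = w (h * g)" using z[of "h * g"] by (simp add: mult.assoc)
    have "g * gb * (gb * gb) \<in> SLZ' \<longleftrightarrow> g \<in> SLZ'"
      unfolding gb_words using SLZ'_right gz_SLZ' by blast
    with edge_cosets[OF True] show ?thesis
      by (auto simp: W_def SLZ_iff gb_words z' True)
  qed (simp add: W_def SLZ_iff)
  have Wa: "W (g * ga) = W g" for g
  proof (cases "g \<in> SLZ")
    case True
    have 1: "g * ga * (gb * gb) * gt = g * gb"
      by (simp add: gt_def slh_eq_iff)
    have 2: "g * (gb * gb) * gz * gt = g * ga * gb"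
      by (simp add: gt_def slh_eq_iff)
    have 3: "g * ga * (gb * gb) \<in> SLZ' \<longleftrightarrow> g * gb \<in> SLZ'"
      using SLZ'_right[OF gt_mem(2), of "g * ga * (gb * gb)"] 1 by simp
    have 4: "g * ga * gb \<in> SLZ' \<longleftrightarrow> g * (gb * gb) \<in> SLZ'"
      using SLZ'_right[OF gt_mem(2), of "g * (gb * gb) * gz"] SLZ'_right[OF gz_SLZ', of "g * (gb * gb)"] 2 by simp
    have 5: "w (h * (g * ga * (gb * gb))) = w (h * (g * gb))"
      using t[of "h * (g * ga * (gb * gb))"] 1 by (simp add: mult.assoc)
    have 6: "w (h * (g * ga * gb)) = w (h * (g * (gb * gb)))"
      using t[of "h * (g * (gb * gb) * gz)"] z[of "h * (g * (gb * gb))"] 2 by (simp add: mult.assoc)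
    have 7: "w (h * (g * ga)) = w (h * g)" using a[of "h * g"] by (simp add: mult.assoc)
    have 8: "g * ga \<in> SLZ' \<longleftrightarrow> g \<in> SLZ'" using SLZ'_right SLZ'_gens(2) by blast
    show ?thesis
      using edge_cosets[OF True] True
      by (auto simp: W_def SLZ_iff 3 4 5 6 7 8 simp del: gb_entries)
  qed (simp add: W_def SLZ_iff)
  have "W (1 * k) = W 1" by (rule SLZ_invariant[OF Wa Wb k(1)])
  then show ?thesis using k by (simp add: W_def)
qed

text \<open>Modulo -1 the edge group is the free product of the group of order two generated by
  \<open>ga\<close> and the infinite cyclic group generated by \<open>gt\<close>. The corresponding
  integration is borrowed from \<open>SLZ\<close>: \<open>p\<close> is found with a prescribed
  increment along \<open>gb\<close>, and an increment along \<open>gt = gb * (ga * gb)\<close>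
  consists of two of these.\<close>

lemma edge_group_surjective:
  fixes f :: "slh \<Rightarrow> int"
  assumes f: "\<And>g. f (g * gz) = f g"
  obtains y where "\<And>g. y (g * ga) = y g" "\<And>g. y (g * gt) - y g = f g"
proof -
  let ?C = "SLZ \<inter> SLZ'"
  obtain \<rho> where r: "\<And>g h. h \<in> ?C \<Longrightarrow> \<rho> (g * h) = \<rho> g" "\<And>g. inverse (\<rho> g) * g \<in> ?C"
    using coset_representatives[of ?C] SLZ_gens(1) SLZ_mult SLZ_inverse SLZ'_gens(1) SLZ'_mult SLZ'_inverse
    by (metis IntD1 IntD2 IntI)
  have "\<exists>p. \<forall>k\<in>?C. p (k * ga) = p k \<and> p (k * gt) - p k = f (h * k)" for h
  proof -
    \<comment> \<open>The increment along \<open>gb\<close> is \<open>f\<close> on the edge group,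
      zero on the coset from which \<open>gb\<close> leads back into it, and minus \<open>f\<close>
      on the remaining one, so that it sums to zero along \<open>gb\<close>.\<close>
    define \<beta> where "\<beta> k = (if k \<notin> SLZ then 0 else if k \<in> SLZ' then f (h * k)
      else if k * (gb * gb) \<in> SLZ' then - f (h * (k * (gb * gb))) else 0)" for k
    have SLZ_iff: "g * x \<in> SLZ \<longleftrightarrow> g \<in> SLZ" if "x \<in> SLZ" for g x
    proof
      assume "g * x \<in> SLZ"
      then have "g * x * inverse x \<in> SLZ" using SLZ_mult SLZ_inverse that by blast
      then show "g \<in> SLZ" by (simp add: mult.assoc right_inverse_mult)
    qed (use SLZ_mult that in blast)
    have z': "f (h * (g * gz)) = f (h * g)" for g using f[of "h * g"] by (simp add: mult.assoc)
    have zS: "g * gz \<in> SLZ' \<longleftrightarrow> g \<in> SLZ'" for g using SLZ'_right gz_SLZ' by blast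
    have zbb: "g * gz * (gb * gb) = g * (gb * gb) * gz" for g by (simp add: slh_eq_iff)
    have \<beta>z: "\<beta> (k * gz) = \<beta> k" for k
      by (simp add: \<beta>_def SLZ_iff z' zS zbb)
    have sum: "\<beta> k + \<beta> (k * gb) + \<beta> (k * (gb * gb)) = 0" for k
    proof (cases "k \<in> SLZ")
      case True
      have zb: "k * gz * gb = k * gb * gz" by (simp add: slh_eq_iff)
      show ?thesis
        using edge_cosets[OF True] True
        by (auto simp: \<beta>_def SLZ_iff SLZ_mult gb_words(1-4) zb zS z')
    qed (simp add: \<beta>_def SLZ_iff SLZ_mult)
    have six: "{..<6::nat} = {0, 1, 2, 3, 4, 5}" by auto
    have "(\<Sum>i<6. \<beta> (g * gb ^ i)) = 0" for g
    proof -
      have "g * gb ^ 3 = g * gz" "g * gb ^ 4 = g * gz * gb" "g * gb ^ 5 = g * gz * (gb * gb)" "gb ^ 2 = gb * gb"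
        by (simp_all add: eval_nat_numeral slh_eq_iff)
      then have "(\<Sum>i<6. \<beta> (g * gb ^ i)) = (\<beta> g + \<beta> (g * gb) + \<beta> (g * (gb * gb)))
          + (\<beta> (g * gz) + \<beta> (g * gz * gb) + \<beta> (g * gz * (gb * gb)))"
        unfolding six by simp
      then show ?thesis unfolding sum by simp
    qed
    then obtain w where w: "\<And>g. \<beta> g = w (g * gb) - w g"
      using cyclic_norm_exact[OF exact_order_gens(2)] by metis
    have "w (g * gz) = w g" for g
      using sum[of g] w[of g] w[of "g * gb"] w[of "g * (gb * gb)"] by (simp add: gb_words mult.assoc)
        (simp add: generator_relations)
    then obtain p q where p: "\<And>g. p (g * ga) = p g" and q: "\<And>g. q (g * gb) = q g" and wpq: "\<And>g. w g = p g - q g"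
      using split_ga_gb by blast
    have pb: "p (g * gb) - p g = \<beta> g" for g using w[of g] wpq[of g] wpq[of "g * gb"] q[of g] by simp
    have "p (k * gt) - p k = f (h * k)" if k: "k \<in> ?C" for k
    proof -
      \<comment> \<open>On the way from \<open>k\<close> to \<open>k * gt\<close> the first
        \<open>gb\<close> contributes \<open>f\<close>, the letter \<open>ga\<close> nothing, and
        the second \<open>gb\<close> starts in the coset where \<open>\<beta>\<close> is
        zero.\<close>
      have kg: "k * gb * ga * gb = k * gt" by (simp add: gt_def mult.assoc)
      have "k * gb * ga * gb \<in> SLZ'" unfolding kg using k gt_mem SLZ'_mult by blast
      then have "\<beta> (k * gb * ga) = 0"
        using edge_cosets[of "k * gb * ga"] k by (auto simp: \<beta>_def SLZ_iff)
      then have "p (k * gt) = p (k * gb)" using pb[of "k * gb * ga"] p[of "k * gb"] kg by simp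
      moreover have "\<beta> k = f (h * k)" using k by (simp add: \<beta>_def)
      ultimately show ?thesis using pb[of k] by simp
    qed
    then show ?thesis using p by blast
  qed
  then obtain p where p: "\<And>h k. k \<in> ?C \<Longrightarrow> p h (k * ga) = p h k" "\<And>h k. k \<in> ?C \<Longrightarrow> p h (k * gt) - p h k = f (h * k)"
    by metis
  have C: "ga \<in> ?C" "gt \<in> ?C" using gt_mem by auto
  show ?thesis
  proof (rule that[of "\<lambda>g. p (\<rho> g) (inverse (\<rho> g) * g)"])
    show "p (\<rho> (g * ga)) (inverse (\<rho> (g * ga)) * (g * ga)) = p (\<rho> g) (inverse (\<rho> g) * g)" for g
      using p(1)[OF r(2)] r(1)[OF C(1)] by (simp add: mult.assoc)
    show "p (\<rho> (g * gt)) (inverse (\<rho> (g * gt)) * (g * gt)) - p (\<rho> g) (inverse (\<rho> g) * g) = f g" for g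
      using p(2)[OF r(2), of "\<rho> g" g] r(1)[OF C(2)] by (simp add: mult.assoc)
  qed
qed

section \<open>The tree of \<open>SL\<^sub>2(\<rat>\<^sub>2)\<close>\<close>

definition J :: "nat \<Rightarrow> slh \<Rightarrow> bool"
  where "J n g \<longleftrightarrow> 2 ^ n * m11 g \<in> \<int> \<and> 2 ^ n * m12 g \<in> \<int> \<and> 2 ^ n * m21 g \<in> \<int> \<and> 2 ^ n * m22 g \<in> \<int>"

text \<open>The same for the matrix \<open>g \<eta>\<close>.\<close>

definition J' :: "nat \<Rightarrow> slh \<Rightarrow> bool"
  where "J' n g \<longleftrightarrow> 2 ^ n * (m11 g + m12 g) \<in> \<int> \<and> 2 ^ n * (m12 g - m11 g) \<in> \<int>
    \<and> 2 ^ n * (m21 g + m22 g) \<in> \<int> \<and> 2 ^ n * (m22 g - m21 g) \<in> \<int>"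

text \<open>By elementary divisors, the lattices spanned over the 2-adic integers by the columns of
  \<open>g\<close> and of \<open>g \<eta>\<close> have distances \<open>2 * NA g\<close> and
  \<open>2 * NB g + 1\<close> from the standard one.\<close>

definition NA :: "slh \<Rightarrow> nat" where "NA g = (LEAST n. J n g)"
definition NB :: "slh \<Rightarrow> nat" where "NB g = (LEAST n. J' n g)"

lemma J_mono: "n \<le> m \<Longrightarrow> J n g \<Longrightarrow> J m g" and J'_mono: "n \<le> m \<Longrightarrow> J' n g \<Longrightarrow> J' m g"
proof -
  assume le: "n \<le> m"
  have "2 ^ m * x \<in> \<int>" if "2 ^ n * x \<in> \<int>" for x :: rat
  proof -
    have "(2::rat) ^ m = 2 ^ (m - n) * 2 ^ n"
      using le by (simp flip: power_add)
    then have eq: "2 ^ m * x = 2 ^ (m - n) * (2 ^ n * x)" by (simp only: mult.assoc)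
    show ?thesis unfolding eq by (intro Ints_mult that) simp
  qed
  then show "J n g \<Longrightarrow> J m g" "J' n g \<Longrightarrow> J' m g" by (simp_all add: J_def J'_def)
qed

lemma J_imp_J': "J n g \<Longrightarrow> J' n g"
  by (simp add: J_def J'_def distrib_left right_diff_distrib)

lemma J_ex: "\<exists>n. J n g"
proof -
  obtain a b c d :: nat where "2 ^ a * m11 g \<in> \<int>" "2 ^ b * m12 g \<in> \<int>" "2 ^ c * m21 g \<in> \<int>" "2 ^ d * m22 g \<in> \<int>"
    using Z_half_denom slh_entries by metis
  then have "2 ^ (b + c + d) * (2 ^ a * m11 g) \<in> \<int>" "2 ^ (a + c + d) * (2 ^ b * m12 g) \<in> \<int>"
    "2 ^ (a + b + d) * (2 ^ c * m21 g) \<in> \<int>" "2 ^ (a + b + c) * (2 ^ d * m22 g) \<in> \<int>"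
    by simp_all
  then have "J (a + b + c + d) g" by (simp add: J_def power_add mult_ac)
  then show ?thesis ..
qed

lemma J_NA: "J (NA g) g" and NA_le: "J n g \<Longrightarrow> NA g \<le> n" and J'_NB: "J' (NB g) g" and NB_le: "J' n g \<Longrightarrow> NB g \<le> n"
proof -
  have "\<exists>n. J' n g" using J_ex[of g] J_imp_J' by blast
  then show "J' (NB g) g" unfolding NB_def by (rule LeastI_ex)
  show "J (NA g) g" using J_ex[of g] unfolding NA_def by (rule LeastI_ex)
qed (auto simp: NA_def NB_def intro: Least_le)

lemma J_0: "J 0 g \<longleftrightarrow> g \<in> SLZ"
  by (simp add: J_def SLZ_def)

lemma J_mult: "J n g \<Longrightarrow> k \<in> SLZ \<Longrightarrow> J n (g * k)"
  by (simp add: J_def SLZ_def distrib_left flip: mult.assoc)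

lemma SLZ'_conj: 
  assumes "k \<in> SLZ'"
  obtains u where "u \<in> SLZ" "k = \<tau> u"
proof
  show "inverse ga * \<tau> k * ga \<in> SLZ" using assms by (simp add: SLZ'_def SLZ_mult SLZ_inverse)
  show "k = \<tau> (inverse ga * \<tau> k * ga)" 
    by (simp add: \<tau>_mult \<tau>_inverse \<tau>_\<tau> mult.assoc left_inverse_mult del: \<tau>_entries)
qed

lemma J'_mult:
  assumes "J' n g" "k \<in> SLZ'"
  shows "J' n (g * k)"
proof -
  obtain u where u: "u \<in> SLZ" "k = \<tau> u" using SLZ'_conj[OF assms(2)] .
  have e: "m11 (g * k) + m12 (g * k) = (m11 g + m12 g) * m11 u + (m12 g - m11 g) * m21 u"
    "m12 (g * k) - m11 (g * k) = (m11 g + m12 g) * m12 u + (m12 g - m11 g) * m22 u"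
    "m21 (g * k) + m22 (g * k) = (m21 g + m22 g) * m11 u + (m22 g - m21 g) * m21 u"
    "m22 (g * k) - m21 (g * k) = (m21 g + m22 g) * m12 u + (m22 g - m21 g) * m22 u"
    unfolding u(2) by (simp_all add: field_simps)
  show ?thesis
    unfolding J'_def e using assms(1) u(1)
    by (simp add: J'_def SLZ_def distrib_left[of "2 ^ n"] flip: mult.assoc)
qed

lemma NA_mult:
  assumes "k \<in> SLZ"
  shows "NA (g * k) = NA g"
proof (rule antisym)
  show "NA (g * k) \<le> NA g" by (rule NA_le[OF J_mult[OF J_NA assms]])
  have "J (NA (g * k)) (g * k * inverse k)" by (rule J_mult[OF J_NA SLZ_inverse[OF assms]])
  then show "NA g \<le> NA (g * k)" by (intro NA_le) (simp add: mult.assoc right_inverse_mult)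
qed

lemma NB_mult:
  assumes "k \<in> SLZ'"
  shows "NB (g * k) = NB g"
proof (rule antisym)
  show "NB (g * k) \<le> NB g" by (rule NB_le[OF J'_mult[OF J'_NB assms]])
  have "J' (NB (g * k)) (g * k * inverse k)" by (rule J'_mult[OF J'_NB SLZ'_inverse[OF assms]])
  then show "NB g \<le> NB (g * k)" by (intro NB_le) (simp add: mult.assoc right_inverse_mult)
qed

lemma half_iff:
  assumes "2 ^ Suc m * t = rat_of_int z"
  shows "2 ^ m * t \<in> \<int> \<longleftrightarrow> even z"
proof
  assume "2 ^ m * t \<in> \<int>"
  then obtain y where "2 ^ m * t = of_int y" by (auto elim: Ints_cases)
  then have "rat_of_int z = of_int (2 * y)" using assms by simp
  then have "z = 2 * y" by (simp only: of_int_eq_iff)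
  then show "even z" by simp
next
  assume "even z"
  then obtain y where "z = 2 * y" by (auto elim: evenE)
  then have "2 ^ m * t = of_int y" using assms by simp
  then show "2 ^ m * t \<in> \<int>" by simp
qed

lemma J'_halfI:
  assumes "2 ^ Suc m * (m11 g + m12 g) = rat_of_int x" "2 ^ Suc m * (m12 g - m11 g) = rat_of_int y"
    "2 ^ Suc m * (m21 g + m22 g) = rat_of_int u" "2 ^ Suc m * (m22 g - m21 g) = rat_of_int v"
    "even x" "even y" "even u" "even v"
  shows "J' m g"
  unfolding J'_def using assms(5-8) half_iff[OF assms(1)] half_iff[OF assms(2)] half_iff[OF assms(3)] half_iff[OF assms(4)]
  by blast

lemma J_halfI:
  assumes "2 ^ Suc m * m11 g = rat_of_int x" "2 ^ Suc m * m12 g = rat_of_int y"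
    "2 ^ Suc m * m21 g = rat_of_int u" "2 ^ Suc m * m22 g = rat_of_int v"
    "even x" "even y" "even u" "even v"
  shows "J m g"
  unfolding J_def using assms(5-8) half_iff[OF assms(1)] half_iff[OF assms(2)] half_iff[OF assms(3)] half_iff[OF assms(4)]
  by blast

lemma J_cases:
  assumes "J n g"
  obtains x y u v :: int where "rat_of_int x = 2 ^ n * m11 g" "rat_of_int y = 2 ^ n * m12 g"
    "rat_of_int u = 2 ^ n * m21 g" "rat_of_int v = 2 ^ n * m22 g" "x * v - y * u = 2 ^ n * 2 ^ n"
proof -
  obtain x y u v :: int where e: "rat_of_int x = 2 ^ n * m11 g" "rat_of_int y = 2 ^ n * m12 g"
    "rat_of_int u = 2 ^ n * m21 g" "rat_of_int v = 2 ^ n * m22 g"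
    using assms unfolding J_def by (metis Ints_cases)
  have "rat_of_int (x * v - y * u) = 2 ^ n * 2 ^ n * (m11 g * m22 g - m12 g * m21 g)"
    by (simp add: e algebra_simps)
  also have "\<dots> = rat_of_int (2 ^ n * 2 ^ n)" by (simp add: slh_det)
  finally have "x * v - y * u = 2 ^ n * 2 ^ n" by (simp only: of_int_eq_iff)
  with e that show ?thesis by blast
qed

lemma J'_cases:
  assumes "J' n g"
  obtains x y u v :: int where "rat_of_int x = 2 ^ n * (m11 g + m12 g)" "rat_of_int y = 2 ^ n * (m12 g - m11 g)"
    "rat_of_int u = 2 ^ n * (m21 g + m22 g)" "rat_of_int v = 2 ^ n * (m22 g - m21 g)"
    "x * v - y * u = 2 * (2 ^ n * 2 ^ n)"
proof -
  obtain x y u v :: int where e: "rat_of_int x = 2 ^ n * (m11 g + m12 g)" "rat_of_int y = 2 ^ n * (m12 g - m11 g)"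
    "rat_of_int u = 2 ^ n * (m21 g + m22 g)" "rat_of_int v = 2 ^ n * (m22 g - m21 g)"
    using assms unfolding J'_def by (metis Ints_cases)
  have "rat_of_int (x * v - y * u) = 2 * (2 ^ n * 2 ^ n) * (m11 g * m22 g - m12 g * m21 g)"
    by (simp add: e algebra_simps)
  also have "\<dots> = rat_of_int (2 * (2 ^ n * 2 ^ n))" by (simp add: slh_det)
  finally have "x * v - y * u = 2 * (2 ^ n * 2 ^ n)" by (simp only: of_int_eq_iff)
  with e that show ?thesis by blast
qed

interpretation serre: rooted_tree UNIV SLZ SLZ' "\<lambda>g. 2 * NA g" "\<lambda>g. 2 * NB g + 1"
proof
  fix g :: slh
  show "2 * NA (g * k) = 2 * NA g" if "k \<in> SLZ" for k using that by (simp add: NA_mult)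
  show "2 * NB (g * k) + 1 = 2 * NB g + 1" if "k \<in> SLZ'" for k using that by (simp add: NB_mult)
  show "2 * NA g \<noteq> 2 * NB g + 1" by presburger
  show "\<exists>k\<in>SLZ. 2 * NB (g * k) + 1 < 2 * NA g" if "g \<notin> SLZ"
  proof -
    have "NA g \<noteq> 0" using J_NA[of g] J_0[of g] that by metis
    then obtain m where m: "NA g = Suc m" using not0_implies_Suc by blast
    obtain x y u v :: int where e: "rat_of_int x = 2 ^ Suc m * m11 g" "rat_of_int y = 2 ^ Suc m * m12 g"
        "rat_of_int u = 2 ^ Suc m * m21 g" "rat_of_int v = 2 ^ Suc m * m22 g"
      and d: "x * v - y * u = 2 ^ Suc m * 2 ^ Suc m"
      using J_cases[OF J_NA[of g, unfolded m]] .
    have "even (x * v - y * u)" unfolding d by simp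
    \<comment> \<open>A matrix singular modulo 2 kills one of the three nonzero vectors
      \<open>(1, 1)\<close>, \<open>(1, 0)\<close>, \<open>(0, 1)\<close>; multiplication by
      \<open>1\<close>, \<open>gb\<close> or \<open>gb * gb\<close> respectively moves it to
      \<open>(1, 1)\<close>, where \<open>\<eta>\<close> absorbs a factor 2.\<close>
    then consider "even (x + y)" "even (u + v)" | "even x" "even u" | "even y" "even v"
      by auto
    then have "\<exists>k\<in>SLZ. J' m (g * k)"
    proof cases
      case 1
      have "J' m (g * 1)"
        by (rule J'_halfI[of _ _ "x + y" "y - x" "u + v" "v - u"]) (use 1 in \<open>simp_all add: e algebra_simps del: power_Suc\<close>)
      then show ?thesis using SLZ_gens by blast
    next
      case 2
      have "J' m (g * gb)"
        by (rule J'_halfI[of _ _ "2 * y - x" "- x" "2 * v - u" "- u"]) (use 2 in \<open>simp_all add: e algebra_simps del: power_Suc\<close>)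
      then show ?thesis using SLZ_gens by blast
    next
      case 3
      have "J' m (g * (gb * gb))"
        by (rule J'_halfI[of _ _ "y - 2 * x" "- y" "v - 2 * u" "- v"]) (use 3 in \<open>simp_all add: e algebra_simps del: power_Suc\<close>)
      then show ?thesis using SLZ_gens SLZ_mult by blast
    qed
    then obtain k where "k \<in> SLZ" "NB (g * k) \<le> m" using NB_le by blast
    then show ?thesis using m by (intro bexI[of _ k]) auto
  qed
  show "\<exists>k\<in>SLZ'. 2 * NA (g * k) < 2 * NB g + 1"
  proof -
    define n where "n = NB g"
    obtain x y u v :: int where e: "rat_of_int x = 2 ^ n * (m11 g + m12 g)" "rat_of_int y = 2 ^ n * (m12 g - m11 g)"
        "rat_of_int u = 2 ^ n * (m21 g + m22 g)" "rat_of_int v = 2 ^ n * (m22 g - m21 g)"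
      and d: "x * v - y * u = 2 * (2 ^ n * 2 ^ n)"
      using J'_cases[OF J'_NB[of g, folded n_def]] .
    have "even (x * v - y * u)" unfolding d by simp
    then consider "even (x + y)" "even (u + v)" | "even x" "even u" | "even y" "even v"
      by auto
    then have "\<exists>k\<in>SLZ'. J n (g * k)"
    proof cases
      case 1
      have "J n (g * 1)"
        by (rule J_halfI[of _ _ "x - y" "x + y" "u - v" "u + v"]) (use 1 in \<open>simp_all add: e field_simps\<close>)
      then show ?thesis using SLZ'_gens by blast
    next
      case 2
      have "J n (g * gc)"
        by (rule J_halfI[of _ _ "x" "2 * y - x" "u" "2 * v - u"]) (use 2 in \<open>simp_all add: e field_simps\<close>)
      then show ?thesis using SLZ'_gens by blast
    next
      case 3
      have "J n (g * (gc * gc))"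
        by (rule J_halfI[of _ _ "y" "y - 2 * x" "v" "v - 2 * u"]) (use 3 in \<open>simp_all add: e field_simps\<close>)
      then show ?thesis using SLZ'_gens SLZ'_mult by blast
    qed
    then obtain k where "k \<in> SLZ'" "NA (g * k) \<le> n" using NA_le by blast
    then show ?thesis by (intro bexI[of _ k]) (auto simp: n_def)
  qed
  show "k \<in> SLZ'" if "k \<in> SLZ" "2 * NB g + 1 < 2 * NA g" "2 * NB (g * k) + 1 < 2 * NA (g * k)" for k
  proof -
    note kS = that(1)
    have nb: "NB g < NA g" "NB (g * k) < NA g" using that(2,3) NA_mult[OF that(1), of g] by auto
    then obtain m where m: "NA g = Suc m" using not0_implies_Suc[of "NA g"] by auto
    obtain x y u v :: int where e: "rat_of_int x = 2 ^ Suc m * m11 g" "rat_of_int y = 2 ^ Suc m * m12 g"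
        "rat_of_int u = 2 ^ Suc m * m21 g" "rat_of_int v = 2 ^ Suc m * m22 g"
      using J_cases[OF J_NA[of g, unfolded m]] by metis
    obtain k1 k2 k3 k4 :: int where k: "m11 k = of_int k1" "m12 k = of_int k2" "m21 k = of_int k3" "m22 k = of_int k4"
      using SLZ_cases[OF kS] by metis
    have "J' m g" "J' m (g * k)" using nb m J'_mono[OF _ J'_NB] by auto
    moreover have "\<not> J m g" using NA_le[of m g] m by auto
    moreover have "2 ^ m * m11 g \<in> \<int> \<longleftrightarrow> even x" "2 ^ m * m12 g \<in> \<int> \<longleftrightarrow> even y"
      "2 ^ m * m21 g \<in> \<int> \<longleftrightarrow> even u" "2 ^ m * m22 g \<in> \<int> \<longleftrightarrow> even v"
      "2 ^ m * (m11 g + m12 g) \<in> \<int> \<longleftrightarrow> even (x + y)" "2 ^ m * (m21 g + m22 g) \<in> \<int> \<longleftrightarrow> even (u + v)"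
      "2 ^ m * (m11 (g * k) + m12 (g * k)) \<in> \<int> \<longleftrightarrow> even (x * (k1 + k2) + y * (k3 + k4))"
      "2 ^ m * (m21 (g * k) + m22 (g * k)) \<in> \<int> \<longleftrightarrow> even (u * (k1 + k2) + v * (k3 + k4))"
      by (rule half_iff; simp add: e k algebra_simps del: power_Suc)+
    \<comment> \<open>By minimality of \<open>NA g\<close> the scaled matrix is nonzero modulo 2, so
      \<open>(1, 1)\<close> is the only nonzero vector it kills; \<open>k\<close> must fix it modulo
      2.\<close>
    ultimately have "even (k1 + k2 + k3 + k4)" unfolding J_def J'_def by auto
    then show ?thesis using even_sum_iff[OF k] by simp
  qed
  show "k \<in> SLZ" if "k \<in> SLZ'" "2 * NA g < 2 * NB g + 1" "2 * NA (g * k) < 2 * NB (g * k) + 1" for k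
  proof -
    note kS = that(1)
    define n where "n = NB g"
    have "NA g \<le> n" "NA (g * k) \<le> n" using that(2,3) NB_mult[OF that(1), of g] by (auto simp: n_def)
    then have J: "J n g" "J n (g * k)" using J_mono[OF _ J_NA] by auto
    obtain x y u v :: int where e: "rat_of_int x = 2 ^ n * m11 g" "rat_of_int y = 2 ^ n * m12 g"
        "rat_of_int u = 2 ^ n * m21 g" "rat_of_int v = 2 ^ n * m22 g" and d: "x * v - y * u = 2 ^ n * 2 ^ n"
      using J_cases[OF J(1)] .
    obtain l where l: "l \<in> SLZ" "k = \<tau> l" using SLZ'_conj[OF kS] .
    obtain k1 k2 k3 k4 :: int where k: "m11 l = of_int k1" "m12 l = of_int k2" "m21 l = of_int k3" "m22 l = of_int k4"
      using SLZ_cases[OF l(1)] by metis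
    \<comment> \<open>Minimality of \<open>NB g\<close> gives this for positive \<open>n\<close>;
      for \<open>n = 0\<close>, where no smaller exponent exists, the odd determinant does.\<close>
    have odd: "odd (x + y) \<or> odd (u + v)"
    proof (cases n)
      case 0
      then have "odd (x * v - y * u)" by (simp add: d)
      then show ?thesis by auto
    next
      case (Suc m)
      have "2 ^ m * (m11 g + m12 g) \<in> \<int> \<longleftrightarrow> even (x + y)" "2 ^ m * (m12 g - m11 g) \<in> \<int> \<longleftrightarrow> even (y - x)"
        "2 ^ m * (m21 g + m22 g) \<in> \<int> \<longleftrightarrow> even (u + v)" "2 ^ m * (m22 g - m21 g) \<in> \<int> \<longleftrightarrow> even (v - u)"
        by (rule half_iff; simp add: e Suc algebra_simps del: power_Suc)+
      moreover have "\<not> J' m g" using NB_le[of m g] Suc n_def by auto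
      ultimately show ?thesis unfolding J'_def by auto
    qed
    have "2 ^ n * m11 (g * k) \<in> \<int> \<longleftrightarrow> even (x * (k1 - k2 - k3 + k4) + y * (k1 - k2 + k3 - k4))"
      "2 ^ n * m21 (g * k) \<in> \<int> \<longleftrightarrow> even (u * (k1 - k2 - k3 + k4) + v * (k1 - k2 + k3 - k4))"
      by (rule half_iff; simp add: e k l(2) field_simps)+
    then have "even (k1 + k2 + k3 + k4)" using J(2) odd unfolding J_def by auto
    then show ?thesis using even_sum_iff[OF k] l by (simp add: SLZ'_def)
  qed
qed (auto intro: SLZ_mult SLZ_inverse SLZ'_mult SLZ'_inverse)

lemma split_SLZ:
  fixes w :: "slh \<Rightarrow> int"
  assumes "\<And>g. w (g * ga) = w g" and "\<And>g. w (g * gt) = w g"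
  obtains p q where "\<And>g. p (g * ga) = p g" "\<And>g. p (g * gb) = p g" "\<And>g. q (g * ga) = q g" "\<And>g. q (g * gc) = q g"
    "\<And>g. w g = p g - (q g :: int)"
proof (rule serre.split[of w])
  show "w (g * k) = w g" if "k \<in> SLZ" "k \<in> SLZ'" for g k
    by (rule edge_group_invariant[OF assms that])
next
  fix p q
  assume "\<And>g k. g \<in> UNIV \<Longrightarrow> k \<in> SLZ \<Longrightarrow> p (g * k) = p g"
    "\<And>g k. g \<in> UNIV \<Longrightarrow> k \<in> SLZ' \<Longrightarrow> q (g * k) = q g" "\<And>g. g \<in> UNIV \<Longrightarrow> w g = p g - q g"
  then show thesis by (intro that[of p q]) simp_all
qed

text \<open>Statements about \<open>ga, gb\<close> pass to \<open>ga, gc\<close> by transport along \<open>\<tau>\<close>.\<close>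

definition \<tau>_inv :: "slh \<Rightarrow> slh" where "\<tau>_inv g = inverse ga * \<tau> g * ga"

lemma \<tau>_inv: "\<tau> (\<tau>_inv g) = g" "\<tau>_inv (\<tau> g) = g" "\<tau>_inv (g * h) = \<tau>_inv g * \<tau>_inv h"
    "\<tau>_inv ga = ga" "\<tau>_inv gc = gb"
  by (simp_all add: \<tau>_inv_def \<tau>_mult \<tau>_inverse \<tau>_\<tau> mult.assoc left_inverse_mult del: \<tau>_entries)
    (simp_all add: slh_eq_iff)

lemma split_ga_gc:
  fixes v :: "slh \<Rightarrow> int"
  assumes v: "\<And>g. v (g * gz) = v g"
  obtains p q where "\<And>g. p (g * ga) = p g" "\<And>g. q (g * gc) = q g" "\<And>g. v g = p g - (q g :: int)"
proof -
  have "v (\<tau> (g * gz)) = v (\<tau> g)" for g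
    using v[of "\<tau> g"] by (simp add: \<tau>_mult generator_relations(1)[symmetric] del: \<tau>_entries)
  then obtain p q where p: "\<And>g. p (g * ga) = p g" "\<And>g. q (g * gb) = q g" "\<And>g. v (\<tau> g) = p g - (q g :: int)"
    using split_ga_gb[of "\<lambda>g. v (\<tau> g)"] by metis
  show ?thesis
  proof (rule that[of "\<lambda>g. p (\<tau>_inv g)" "\<lambda>g. q (\<tau>_inv g)"])
    show "v g = p (\<tau>_inv g) - q (\<tau>_inv g)" for g using p(3)[of "\<tau>_inv g"] by (simp only: \<tau>_inv)
  qed (simp_all only: \<tau>_inv p)
qed

lemma generators_invariant_const:
  fixes x :: "slh \<Rightarrow> int"
  assumes a: "\<And>g. x (g * ga) = x g" and b: "\<And>g. x (g * gb) = x g" and c: "\<And>g. x (g * gc) = x g"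
  shows "x g = x 1"
proof (rule serre.invariant_const)
  fix g k assume k: "k \<in> SLZ \<union> SLZ'"
  have "x (\<tau> (h * l)) = x (\<tau> h)" if "l \<in> SLZ" for h l
    by (rule SLZ_invariant[of "\<lambda>g. x (\<tau> g)", OF _ _ that]) (simp_all only: \<tau>_mult \<tau>_gens a c)
  then have "x (g * \<tau> l) = x g" if "l \<in> SLZ" for l
    using that by (metis \<tau>_inv(1) \<tau>_mult)
  then show "x (g * k) = x g"
    using k SLZ_invariant[OF a b] SLZ'_conj by (metis UnE)
qed simp

section \<open>A free resolution that is periodic of period two\<close>

type_synonym quad = "(slh \<Rightarrow> int) \<times> (slh \<Rightarrow> int) \<times> (slh \<Rightarrow> int) \<times> (slh \<Rightarrow> int)"

text \<open>In odd degrees the components belong to the generators \<open>ga, gb, gc\<close> and to the centrality of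
  the relation \<open>babcac = a\<close>, in even degrees to the relations \<open>a\<^sup>2 = b\<^sup>3\<close>, \<open>a\<^sup>2 = c\<^sup>3\<close>, \<open>babcac = a\<close>
  and \<open>a\<^sup>4 = 1\<close>. The third component of \<open>d_odd\<close> is made of Fox derivatives.\<close>

definition d_odd :: "quad \<Rightarrow> quad" where
  "d_odd = (\<lambda>(\<alpha>, \<beta>, \<gamma>, \<phi>).
    (\<lambda>g. \<alpha> g + \<alpha> (g * ga) - (\<beta> g + \<beta> (g * gb) + \<beta> (g * (gb * gb))),
     \<lambda>g. \<alpha> g + \<alpha> (g * ga) - (\<gamma> g + \<gamma> (g * gc) + \<gamma> (g * (gc * gc))),
     \<lambda>g. \<beta> g + \<alpha> (g * gb) + \<beta> (g * (gb * ga)) + \<gamma> (g * (gb * (ga * gb)))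
       + \<alpha> (g * (gb * (ga * (gb * gc)))) + \<gamma> (g * (gb * (ga * (gb * (gc * ga))))) - \<alpha> g
       + \<phi> g + \<phi> (g * gz),
     \<lambda>g. \<alpha> g + \<alpha> (g * ga) + \<alpha> (g * gz) + \<alpha> (g * (gz * ga))))"

text \<open>From degree two on these are identities among relations. Components two and three say
  that \<open>gb\<close> and \<open>gc\<close> commute with their sixth powers, rewritten through
  the relations. The last moves \<open>gz\<close> across the word \<open>babcac = a\<close>: each
  \<open>b\<close> costs a difference of \<open>r\<close>, each \<open>c\<close> one of
  \<open>s\<close>, and \<open>a\<close> nothing, as \<open>gz\<close> is its square.\<close>

definition d_even :: "quad \<Rightarrow> quad" where
  "d_even = (\<lambda>(r, s, f, u).
    (\<lambda>g. u (g * ga) - u g,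
     \<lambda>g. u (g * gb) - u g - (r (g * gb) - r g + r (g * (gz * gb)) - r (g * gz)),
     \<lambda>g. u (g * gc) - u g - (s (g * gc) - s g + s (g * (gz * gc)) - s (g * gz)),
     \<lambda>g. f (g * gz) - f g + r (g * gb) - r g + r (g * (gb * (ga * gb))) - r (g * (gb * ga))
       + s (g * (gb * (ga * (gb * gc)))) - s (g * (gb * (ga * gb)))
       + s (g * ga) - s (g * (gb * (ga * (gb * (gc * ga)))))))"

text \<open>Rewrite rules moving the central \<open>gz\<close> to the front and eliminating the
  left-hand sides of the relations; they bring the words in composites of differentials to common
  forms.\<close>

lemma words:
  "ga * ga = gz" "ga * (ga * x) = gz * x" "gb * (gb * gb) = gz" "gb * (gb * (gb * x)) = gz * x"
  "gc * (gc * gc) = gz" "gc * (gc * (gc * x)) = gz * x" "gz * gz = 1" "gz * (gz * x) = x"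
  "ga * gz = gz * ga" "gb * gz = gz * gb" "gc * gz = gz * gc"
  "ga * (gz * x) = gz * (ga * x)" "gb * (gz * x) = gz * (gb * x)" "gc * (gz * x) = gz * (gc * x)"
  "gb * (ga * (gb * (gc * (ga * gc)))) = ga" "gb * (ga * (gb * (gc * (ga * (gc * x))))) = ga * x"
  "gb * (ga * (gb * (gc * ga))) = gz * (ga * (gc * gc))"
  by (simp_all add: slh_eq_iff field_simps)

lemma d_even_d_odd: "d_even (d_odd m) = 0"
proof -
  obtain \<alpha> \<beta> \<gamma> \<phi> where m: "m = (\<alpha>, \<beta>, \<gamma>, \<phi>)" by (cases m)
  show ?thesis
    by (simp add: m d_even_def d_odd_def zero_prod_def fun_eq_iff mult.assoc) (simp add: words)
qed

lemma d_odd_d_even: "d_odd (d_even m) = 0"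
proof -
  obtain r s f u where m: "m = (r, s, f, u)" by (cases m)
  show ?thesis
    by (simp add: m d_even_def d_odd_def zero_prod_def fun_eq_iff mult.assoc) (simp add: words)
qed

lemma d_odd_additive: "Modules.additive d_odd"
  by (simp add: Modules.additive_def d_odd_def fun_eq_iff split: prod.splits)

lemma d_even_additive: "Modules.additive d_even"
  by (simp add: Modules.additive_def d_even_def fun_eq_iff split: prod.splits)

section \<open>Exactness of the complex, degree by degree\<close>

lemma sum_4: "(\<Sum>i<4. f i) = f 0 + f 1 + f 2 + (f 3 :: int)" for f :: "nat \<Rightarrow> int"
  by (simp add: eval_nat_numeral)

lemma sum_6: "(\<Sum>i<6. f i) = f 0 + f 1 + f 2 + f 3 + f 4 + (f 5 :: int)" for f :: "nat \<Rightarrow> int"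
  by (simp add: eval_nat_numeral)

lemma powers:
  "ga ^ 2 = gz" "ga ^ 3 = gz * ga" "gb ^ 2 = gb * gb" "gb ^ 3 = gz" "gb ^ 4 = gz * gb" "gb ^ 5 = gz * (gb * gb)"
  "gc ^ 2 = gc * gc" "gc ^ 3 = gz" "gc ^ 4 = gz * gc" "gc ^ 5 = gz * (gc * gc)"
  by (simp_all add: eval_nat_numeral words)

lemma norm_ga:
  fixes f :: "slh \<Rightarrow> int"
  assumes "\<And>g. f g + f (g * ga) + f (g * gz) + f (g * (gz * ga)) = 0"
  obtains u where "\<And>g. f g = u (g * ga) - u g"
  using cyclic_norm_exact[OF exact_order_gens(1), of f] assms by (auto simp: sum_4 powers)

lemma norm_gb:
  fixes f :: "slh \<Rightarrow> int"
  assumes "\<And>g. f g + f (g * gb) + f (g * (gb * gb)) + f (g * gz) + f (g * (gz * gb)) + f (g * (gz * (gb * gb))) = 0"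
  obtains u where "\<And>g. f g = u (g * gb) - u g"
  using cyclic_norm_exact[OF exact_order_gens(2), of f] assms by (auto simp: sum_6 powers)

lemma norm_gc:
  fixes f :: "slh \<Rightarrow> int"
  assumes "\<And>g. f g + f (g * gc) + f (g * (gc * gc)) + f (g * gz) + f (g * (gz * gc)) + f (g * (gz * (gc * gc))) = 0"
  obtains u where "\<And>g. f g = u (g * gc) - u g"
  using cyclic_norm_exact[OF exact_order_gens(3), of f] assms by (auto simp: sum_6 powers)

lemma norm_gz:
  fixes f :: "slh \<Rightarrow> int"
  assumes "\<And>g. f g + f (g * gz) = 0"
  obtains u where "\<And>g. f g = u (g * gz) - u g"
  using cyclic_norm_exact[OF exact_order_gens(4), of f] assms by (auto simp: numeral_2_eq_2)

lemma invariant_ga: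
  fixes f :: "slh \<Rightarrow> int"
  assumes "\<And>g. f (g * ga) = f g"
  obtains u where "\<And>g. f g = u g + u (g * ga) + u (g * gz) + u (g * (gz * ga))"
  using cyclic_invariant_exact[OF exact_order_gens(1), of f] assms by (auto simp: sum_4 powers)

lemma invariant_gb:
  fixes f :: "slh \<Rightarrow> int"
  assumes "\<And>g. f (g * gb) = f g"
  obtains u where "\<And>g. f g = u g + u (g * gb) + u (g * (gb * gb)) + u (g * gz) + u (g * (gz * gb)) + u (g * (gz * (gb * gb)))"
  using cyclic_invariant_exact[OF exact_order_gens(2), of f] assms by (auto simp: sum_6 powers)

lemma invariant_gc:
  fixes f :: "slh \<Rightarrow> int"
  assumes "\<And>g. f (g * gc) = f g"
  obtains u where "\<And>g. f g = u g + u (g * gc) + u (g * (gc * gc)) + u (g * gz) + u (g * (gz * gc)) + u (g * (gz * (gc * gc)))"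
  using cyclic_invariant_exact[OF exact_order_gens(3), of f] assms by (auto simp: sum_6 powers)

lemma invariant_gz:
  fixes f :: "slh \<Rightarrow> int"
  assumes "\<And>g. f (g * gz) = f g"
  obtains u where "\<And>g. f g = u g + u (g * gz)"
  using cyclic_invariant_exact[OF exact_order_gens(4), of f] assms by (auto simp: numeral_2_eq_2)

text \<open>The last equation is the vanishing norm of \<open>\<alpha>\<close>; the first two, taken
  at \<open>g\<close> and \<open>g * gz\<close>, pass it on to \<open>\<beta>\<close> and
  \<open>\<gamma>\<close>. Their half norms telescope to the increments of \<open>x\<close>,
  \<open>y\<close>, \<open>z\<close> along \<open>gz\<close>, which therefore agree.\<close>

lemma d_odd_kernel_cyclic:
  assumes "d_odd (\<alpha>, \<beta>, \<gamma>, \<phi>) = 0"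
  obtains x y z where "\<And>g. \<alpha> g = x (g * ga) - x g" "\<And>g. \<beta> g = y (g * gb) - y g" "\<And>g. \<gamma> g = z (g * gc) - z g"
    "\<And>g. y (g * gz) - x (g * gz) = y g - x g" "\<And>g. z (g * gz) - x (g * gz) = z g - (x g :: int)"
proof -
  have b: "\<beta> g + \<beta> (g * gb) + \<beta> (g * (gb * gb)) = \<alpha> g + \<alpha> (g * ga)"
    and c: "\<gamma> g + \<gamma> (g * gc) + \<gamma> (g * (gc * gc)) = \<alpha> g + \<alpha> (g * ga)"
    and n: "\<alpha> g + \<alpha> (g * ga) + \<alpha> (g * gz) + \<alpha> (g * (gz * ga)) = 0" for g
    using assms by (auto simp: d_odd_def zero_prod_def fun_eq_iff dest: spec[of _ g])
  obtain x where x: "\<And>g. \<alpha> g = x (g * ga) - x g" using norm_ga[of \<alpha>] n by blast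
  have "\<beta> g + \<beta> (g * gb) + \<beta> (g * (gb * gb)) + \<beta> (g * gz) + \<beta> (g * (gz * gb)) + \<beta> (g * (gz * (gb * gb))) = 0"
    "\<gamma> g + \<gamma> (g * gc) + \<gamma> (g * (gc * gc)) + \<gamma> (g * gz) + \<gamma> (g * (gz * gc)) + \<gamma> (g * (gz * (gc * gc))) = 0" for g
    using b[of g] b[of "g * gz"] c[of g] c[of "g * gz"] n[of g] by (simp_all add: mult.assoc)
  then obtain y z where y: "\<And>g. \<beta> g = y (g * gb) - y g" and z: "\<And>g. \<gamma> g = z (g * gc) - z g"
    using norm_gb[of \<beta>] norm_gc[of \<gamma>] by metis
  have "x (g * gz) - x g = \<alpha> g + \<alpha> (g * ga)" for g by (simp add: x mult.assoc words)
  moreover have "y (g * gz) - y g = \<beta> g + \<beta> (g * gb) + \<beta> (g * (gb * gb))" for g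
    by (simp add: y mult.assoc words)
  moreover have "z (g * gz) - z g = \<gamma> g + \<gamma> (g * gc) + \<gamma> (g * (gc * gc))" for g
    by (simp add: z mult.assoc words)
  ultimately show ?thesis
    using b c by (intro that[OF x y z]) (simp_all add: algebra_simps)
qed

text \<open>The differences of the three potentials are invariant under \<open>gz\<close>, hence
  norms of some \<open>r\<close> and \<open>s\<close>; subtracting
  \<open>d_even (r, s, 0, x)\<close> leaves only a fourth component, of norm zero for
  \<open>gz\<close>.\<close>

lemma d_odd_exact:
  assumes m: "d_odd m = 0"
  shows "\<exists>m'. d_even m' = m"
proof -
  obtain \<alpha> \<beta> \<gamma> \<phi> where m': "m = (\<alpha>, \<beta>, \<gamma>, \<phi>)" by (cases m)
  obtain x y z where x: "\<And>g. \<alpha> g = x (g * ga) - x g" and y: "\<And>g. \<beta> g = y (g * gb) - y g"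
    and z: "\<And>g. \<gamma> g = z (g * gc) - z g"
    and inv: "\<And>g. y (g * gz) - x (g * gz) = y g - x g" "\<And>g. z (g * gz) - x (g * gz) = z g - x g"
    using d_odd_kernel_cyclic[OF m[unfolded m']] by blast
  obtain r where r: "\<And>g. x g - y g = r g + r (g * gz)"
    using invariant_gz[of "\<lambda>g. x g - y g"] inv(1) by (auto simp: algebra_simps)
  obtain s where s: "\<And>g. x g - z g = s g + s (g * gz)"
    using invariant_gz[of "\<lambda>g. x g - z g"] inv(2) by (auto simp: algebra_simps)
  define m0 where "m0 = m - d_even (r, s, 0, x)"
  have "y g = x g - (r g + r (g * gz))" "z g = x g - (s g + s (g * gz))" for g using r[of g] s[of g] by simp_all
  then have "fst m0 = 0 \<and> fst (snd m0) = 0 \<and> fst (snd (snd m0)) = 0"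
    by (simp add: m0_def m' d_even_def fun_eq_iff x y z mult.assoc words)
  then obtain \<psi> where \<psi>: "m0 = (0, 0, 0, \<psi>)" by (cases m0) auto
  have "d_odd m0 = 0"
    by (simp add: m0_def additive.diff[OF d_odd_additive] m d_odd_d_even)
  then have "\<psi> g + \<psi> (g * gz) = 0" for g
    by (auto simp: \<psi> d_odd_def zero_prod_def fun_eq_iff)
  then obtain f where "\<And>g. \<psi> g = f (g * gz) - f g" using norm_gz[of \<psi>] by blast
  then have "d_even (0, 0, f, 0) = m0" by (simp add: d_even_def \<psi> fun_eq_iff)
  then have "d_even ((0, 0, f, 0) + (r, s, 0, x)) = m"
    by (simp only: additive.add[OF d_even_additive]) (simp add: m0_def)
  then show ?thesis ..
qed

text \<open>Common to degree two and to the higher even degrees: the cyclic groups dispose of all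
  components except the third, which is left invariant under \<open>gz\<close>.\<close>

lemma d_even_kernel:
  assumes m: "d_even m = 0"
  obtains \<alpha> \<beta> \<gamma> f where "m = d_odd (\<alpha>, \<beta>, \<gamma>, 0) + (0, 0, f, 0)" "\<And>g. f (g * gz) = f g"
proof -
  obtain r s f u where m': "m = (r, s, f, u)" by (cases m)
  have a: "u (g * ga) = u g"
    and b: "u (g * gb) - (r (g * gb) + r (g * (gz * gb))) = u g - (r g + r (g * gz))"
    and c: "u (g * gc) - (s (g * gc) + s (g * (gz * gc))) = u g - (s g + s (g * gz))" for g
    using m by (auto simp: m' d_even_def zero_prod_def fun_eq_iff algebra_simps dest: spec[of _ g])
  obtain \<alpha> where \<alpha>: "\<And>g. u g = \<alpha> g + \<alpha> (g * ga) + \<alpha> (g * gz) + \<alpha> (g * (gz * ga))"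
    using invariant_ga[of u] a by blast
  obtain \<beta>0 where \<beta>0: "\<And>g. u g - (r g + r (g * gz)) = \<beta>0 g + \<beta>0 (g * gb) + \<beta>0 (g * (gb * gb)) + \<beta>0 (g * gz)
      + \<beta>0 (g * (gz * gb)) + \<beta>0 (g * (gz * (gb * gb)))"
    using invariant_gb[of "\<lambda>g. u g - (r g + r (g * gz))"] b by (auto simp: mult.assoc words)
  obtain \<gamma>0 where \<gamma>0: "\<And>g. u g - (s g + s (g * gz)) = \<gamma>0 g + \<gamma>0 (g * gc) + \<gamma>0 (g * (gc * gc)) + \<gamma>0 (g * gz)
      + \<gamma>0 (g * (gz * gc)) + \<gamma>0 (g * (gz * (gc * gc)))"
    using invariant_gc[of "\<lambda>g. u g - (s g + s (g * gz))"] c by (auto simp: mult.assoc words)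
  obtain v where v: "\<And>g. r g - (\<alpha> g + \<alpha> (g * ga)) + (\<beta>0 g + \<beta>0 (g * gb) + \<beta>0 (g * (gb * gb))) = v (g * gz) - v g"
    using norm_gz[of "\<lambda>g. r g - (\<alpha> g + \<alpha> (g * ga)) + (\<beta>0 g + \<beta>0 (g * gb) + \<beta>0 (g * (gb * gb)))"] \<alpha> \<beta>0
    by (auto simp: mult.assoc words algebra_simps)
  obtain w where w: "\<And>g. s g - (\<alpha> g + \<alpha> (g * ga)) + (\<gamma>0 g + \<gamma>0 (g * gc) + \<gamma>0 (g * (gc * gc))) = w (g * gz) - w g"
    using norm_gz[of "\<lambda>g. s g - (\<alpha> g + \<alpha> (g * ga)) + (\<gamma>0 g + \<gamma>0 (g * gc) + \<gamma>0 (g * (gc * gc)))"] \<alpha> \<gamma>0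
    by (auto simp: mult.assoc words algebra_simps)
  \<comment> \<open>An increment along \<open>gb\<close> does not change the full norm, but changes
    the half norm by an increment along \<open>gz\<close>, exactly the defect \<open>v\<close>;
    likewise for \<open>gc\<close>.\<close>
  define \<beta> where "\<beta> g = \<beta>0 g - (v (g * gb) - v g)" for g
  define \<gamma> where "\<gamma> g = \<gamma>0 g - (w (g * gc) - w g)" for g
  define m0 where "m0 = m - d_odd (\<alpha>, \<beta>, \<gamma>, 0)"
  have "r g = v (g * gz) - v g + (\<alpha> g + \<alpha> (g * ga)) - (\<beta>0 g + \<beta>0 (g * gb) + \<beta>0 (g * (gb * gb)))"
    "s g = w (g * gz) - w g + (\<alpha> g + \<alpha> (g * ga)) - (\<gamma>0 g + \<gamma>0 (g * gc) + \<gamma>0 (g * (gc * gc)))" for g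
    using v[of g] w[of g] by simp_all
  then have "fst m0 = 0 \<and> fst (snd m0) = 0 \<and> snd (snd (snd m0)) = 0"
    by (simp add: m0_def m' d_odd_def fun_eq_iff \<alpha> \<beta>_def \<gamma>_def mult.assoc words)
  then obtain f' where f': "m0 = (0, 0, f', 0)" by (cases m0) auto
  have "d_even m0 = 0"
    by (simp add: m0_def additive.diff[OF d_even_additive] m d_even_d_odd)
  then have "f' (g * gz) = f' g" for g
    by (auto simp: f' d_even_def zero_prod_def fun_eq_iff)
  moreover have "m = d_odd (\<alpha>, \<beta>, \<gamma>, 0) + (0, 0, f', 0)" by (simp flip: f' add: m0_def)
  ultimately show ?thesis using that by blast
qed

lemma d_even_exact:
  assumes "d_even m = 0"
  shows "\<exists>m'. d_odd m' = m"
proof -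
  obtain \<alpha> \<beta> \<gamma> f where m: "m = d_odd (\<alpha>, \<beta>, \<gamma>, 0) + (0, 0, f, 0)" and f: "\<And>g. f (g * gz) = f g"
    using d_even_kernel[OF assms] by blast
  obtain \<phi> where "\<And>g. f g = \<phi> g + \<phi> (g * gz)" using invariant_gz[of f] f by blast
  then have "d_odd (0, 0, 0, \<phi>) = (0, 0, f, 0)" by (simp add: d_odd_def fun_eq_iff)
  then have "d_odd ((\<alpha>, \<beta>, \<gamma>, 0) + (0, 0, 0, \<phi>)) = m"
    by (simp only: additive.add[OF d_odd_additive] m)
  then show ?thesis ..
qed

text \<open>Degree one has no \<open>\<phi>\<close> to produce \<open>f\<close>. Taking for
  \<open>\<beta>\<close> the increment along \<open>gb\<close> of a \<open>ga\<close>-invariant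
  \<open>y\<close>, the third component becomes the increment of \<open>y\<close> along
  \<open>gt\<close>, so \<open>edge_group_surjective\<close> applies.\<close>

lemma d_even_exact_2:
  assumes "d_even m = 0"
  shows "\<exists>\<alpha> \<beta> \<gamma>. d_odd (\<alpha>, \<beta>, \<gamma>, 0) = m"
proof -
  obtain \<alpha> \<beta> \<gamma> f where m: "m = d_odd (\<alpha>, \<beta>, \<gamma>, 0) + (0, 0, f, 0)" and f: "\<And>g. f (g * gz) = f g"
    using d_even_kernel[OF assms] by blast
  obtain y where y: "\<And>g. y (g * ga) = y g" "\<And>g. y (g * gt) - y g = f g"
    using edge_group_surjective[of f] f by blast
  have "y (g * gz) = y g" for g using y(1)[of "g * ga"] y(1)[of g] by (simp add: mult.assoc words)
  moreover have "y (g * (gb * ga)) = y (g * gb)" for g using y(1)[of "g * gb"] by (simp add: mult.assoc)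
  ultimately have "d_odd (0, \<lambda>g. y (g * gb) - y g, 0, 0) = (0, 0, f, 0)"
    using y(2) by (simp add: d_odd_def fun_eq_iff mult.assoc words gt_def)
  then have "d_odd ((\<alpha>, \<beta>, \<gamma>, 0) + (0, \<lambda>g. y (g * gb) - y g, 0, 0)) = m"
    by (simp only: additive.add[OF d_odd_additive] m)
  then show ?thesis by (simp add: plus_prod_def) blast
qed

text \<open>The trees of the two vertex groups correct \<open>x\<close> to potentials
  \<open>x + p\<close> for \<open>ga, gb\<close> and \<open>x + p'\<close> for
  \<open>ga, gc\<close>. The long relation makes \<open>p - p'\<close> invariant under the edge
  group, and the tree of \<open>G\<close> splits it, so that the two potentials become one.\<close>

lemma d_odd_exact_1:
  assumes m: "d_odd (\<alpha>, \<beta>, \<gamma>, 0) = 0"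
  shows "\<exists>u. d_even (0, 0, 0, u) = (\<alpha>, \<beta>, \<gamma>, 0)"
proof -
  obtain x y z where x: "\<And>g. \<alpha> g = x (g * ga) - x g" and y: "\<And>g. \<beta> g = y (g * gb) - y g"
    and z: "\<And>g. \<gamma> g = z (g * gc) - z g"
    and inv: "\<And>g. y (g * gz) - x (g * gz) = y g - x g" "\<And>g. z (g * gz) - x (g * gz) = z g - x g"
    using d_odd_kernel_cyclic[OF m] by blast
  obtain p q where p: "\<And>g. p (g * ga) = p g" and q: "\<And>g. q (g * gb) = q g" and pq: "\<And>g. y g - x g = p g - q g"
    using split_ga_gb[of "\<lambda>g. y g - x g"] inv(1) by blast
  obtain p' q' where p': "\<And>g. p' (g * ga) = p' g" and q': "\<And>g. q' (g * gc) = q' g" and pq': "\<And>g. z g - x g = p' g - q' g"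
    using split_ga_gc[of "\<lambda>g. z g - x g"] inv(2) by blast
  have \<beta>: "\<beta> g = x (g * gb) + p (g * gb) - (x g + p g)" for g
    using y[of g] pq[of g] pq[of "g * gb"] q[of g] by simp
  have \<gamma>: "\<gamma> g = x (g * gc) + p' (g * gc) - (x g + p' g)" for g
    using z[of g] pq'[of g] pq'[of "g * gc"] q'[of g] by simp
  have "p (g * gt) - p' (g * gt) = p g - p' g" for g
  proof -
    have "\<beta> g + \<alpha> (g * gb) + \<beta> (g * (gb * ga)) + \<gamma> (g * (gb * (ga * gb)))
       + \<alpha> (g * (gb * (ga * (gb * gc)))) + \<gamma> (g * (gb * (ga * (gb * (gc * ga))))) - \<alpha> g = 0"
      using m by (auto simp: d_odd_def zero_prod_def fun_eq_iff dest: spec[of _ g])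
    moreover have "p (g * (gb * ga)) = p (g * gb)" "p' (g * (gb * (ga * (gb * (gc * ga))))) = p' (g * (gb * (ga * (gb * gc))))"
      using p[of "g * gb"] p'[of "g * (gb * (ga * (gb * gc)))"] by (simp_all add: mult.assoc)
    ultimately show ?thesis
      using p'[of g] by (simp add: x \<beta> \<gamma> gt_def mult.assoc words)
  qed
  then obtain P Q where P: "\<And>g. P (g * ga) = P g" "\<And>g. P (g * gb) = P g"
    and Q: "\<And>g. Q (g * ga) = Q g" "\<And>g. Q (g * gc) = Q g" and PQ: "\<And>g. p g - p' g = P g - Q g"
    using split_SLZ[of "\<lambda>g. p g - p' g"] p p' by (auto simp: algebra_simps)
  define u where "u g = x g + p g - P g" for g
  have u': "u g = x g + p' g - Q g" for g using PQ[of g] by (simp add: u_def)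
  have "u (g * ga) - u g = \<alpha> g" "u (g * gb) - u g = \<beta> g" for g
    by (simp_all add: u_def p P x \<beta>)
  moreover have "u (g * gc) - u g = \<gamma> g" for g
    unfolding u' by (simp add: Q \<gamma>)
  ultimately have "d_even (0, 0, 0, u) = (\<alpha>, \<beta>, \<gamma>, 0)"
    by (simp add: d_even_def fun_eq_iff)
  then show ?thesis by blast
qed

section \<open>The complex as an acyclic resolution of the integers\<close>

definition quad_act :: "slh \<Rightarrow> quad \<Rightarrow> quad"
  where "quad_act h = (\<lambda>(\<alpha>, \<beta>, \<gamma>, \<phi>). (lshift h \<alpha>, lshift h \<beta>, lshift h \<gamma>, lshift h \<phi>))"

text \<open>Degree zero keeps only the slot of \<open>u\<close>, from which \<open>d_even\<close>
  takes increments along the generators; degree one keeps the three generators. Thus two formulas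
  serve all degrees.\<close>

definition quad_mod :: "nat \<Rightarrow> quad set"
  where "quad_mod q = {(\<alpha>, \<beta>, \<gamma>, \<phi>). (q = 0 \<longrightarrow> \<alpha> = 0 \<and> \<beta> = 0 \<and> \<gamma> = 0) \<and> (q = 1 \<longrightarrow> \<phi> = 0)}"

lemma quad_mod_iff: "m \<in> quad_mod q \<longleftrightarrow> (q = 0 \<longrightarrow> fst m = 0 \<and> fst (snd m) = 0 \<and> fst (snd (snd m)) = 0)
    \<and> (q = 1 \<longrightarrow> snd (snd (snd m)) = 0)"
  by (cases m) (simp add: quad_mod_def)

definition quad_d :: "nat \<Rightarrow> quad \<Rightarrow> quad"
  where "quad_d q = (if even q then d_even else d_odd)"

lemma cob_quad_act:
  "cob quad_act F = (\<lambda>l. (cob lshift (\<lambda>l. fst (F l)) l, cob lshift (\<lambda>l. fst (snd (F l))) l,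
    cob lshift (\<lambda>l. fst (snd (snd (F l)))) l, cob lshift (\<lambda>l. snd (snd (snd (F l)))) l))"
proof
  fix l :: "slh list"
  have a: "Modules.additive (\<lambda>m::quad. fst m)" "Modules.additive (\<lambda>m::quad. fst (snd m))"
    "Modules.additive (\<lambda>m::quad. fst (snd (snd m)))" "Modules.additive (\<lambda>m::quad. snd (snd (snd m)))"
    by (simp_all add: Modules.additive_def)
  show "cob quad_act F l = (cob lshift (\<lambda>l. fst (F l)) l, cob lshift (\<lambda>l. fst (snd (F l))) l,
    cob lshift (\<lambda>l. fst (snd (snd (F l)))) l, cob lshift (\<lambda>l. snd (snd (snd (F l)))) l)"
    by (cases l) (auto simp: quad_act_def prod_eq_iff split_beta merge_additive[OF a(1)] merge_additive[OF a(2)]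
        merge_additive[OF a(3)] merge_additive[OF a(4)] simp del: merge.simps)
qed

lemma quad_acyclic:
  assumes F: "F \<in> cochain (quad_mod q) (Suc p)" and c: "cob quad_act F = 0"
  shows "\<exists>E\<in>cochain (quad_mod q) p. cob quad_act E = F"
proof -
  have c': "cob lshift (\<lambda>l. fst (F l)) = 0" "cob lshift (\<lambda>l. fst (snd (F l))) = 0"
    "cob lshift (\<lambda>l. fst (snd (snd (F l)))) = 0" "cob lshift (\<lambda>l. snd (snd (snd (F l)))) = 0"
    using c unfolding cob_quad_act by (auto simp: fun_eq_iff zero_prod_def)
  have F': "(\<lambda>l. fst (F l)) \<in> cochain UNIV (Suc p)" "(\<lambda>l. fst (snd (F l))) \<in> cochain UNIV (Suc p)"
    "(\<lambda>l. fst (snd (snd (F l)))) \<in> cochain UNIV (Suc p)" "(\<lambda>l. snd (snd (snd (F l)))) \<in> cochain UNIV (Suc p)"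
    using F by (auto simp: cochain_def)
  obtain E1 where E1: "E1 \<in> cochain UNIV p" "cob lshift E1 = (\<lambda>l. fst (F l))" "(\<lambda>l. fst (F l)) = 0 \<longrightarrow> E1 = 0"
    using coinduced_acyclic[OF F'(1) c'(1)] by blast
  obtain E2 where E2: "E2 \<in> cochain UNIV p" "cob lshift E2 = (\<lambda>l. fst (snd (F l)))" "(\<lambda>l. fst (snd (F l))) = 0 \<longrightarrow> E2 = 0"
    using coinduced_acyclic[OF F'(2) c'(2)] by blast
  obtain E3 where E3: "E3 \<in> cochain UNIV p" "cob lshift E3 = (\<lambda>l. fst (snd (snd (F l))))" "(\<lambda>l. fst (snd (snd (F l)))) = 0 \<longrightarrow> E3 = 0"
    using coinduced_acyclic[OF F'(3) c'(3)] by blast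
  obtain E4 where E4: "E4 \<in> cochain UNIV p" "cob lshift E4 = (\<lambda>l. snd (snd (snd (F l))))" "(\<lambda>l. snd (snd (snd (F l)))) = 0 \<longrightarrow> E4 = 0"
    using coinduced_acyclic[OF F'(4) c'(4)] by blast
  have "F l \<in> quad_mod q" for l
    using F by (cases "length l = Suc p") (auto simp: cochain_def quad_mod_iff)
  then have "q = 0 \<Longrightarrow> (\<lambda>l. fst (F l)) = 0 \<and> (\<lambda>l. fst (snd (F l))) = 0 \<and> (\<lambda>l. fst (snd (snd (F l)))) = 0"
    "q = 1 \<Longrightarrow> (\<lambda>l. snd (snd (snd (F l)))) = 0"
    by (auto simp: quad_mod_iff)
  then have "(\<lambda>l. (E1 l, E2 l, E3 l, E4 l)) \<in> cochain (quad_mod q) p"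
    using E1 E2 E3 E4 by (auto simp: cochain_def quad_mod_def zero_prod_def)
  moreover have "cob quad_act (\<lambda>l. (E1 l, E2 l, E3 l, E4 l)) = F"
    unfolding cob_quad_act by (simp add: E1 E2 E3 E4)
  ultimately show ?thesis by blast
qed

interpretation res: acyclic_resolution quad_act quad_mod quad_d "\<lambda>k. (0, 0, 0, \<lambda>_. k)"
proof
  show "quad_act g (x + y) = quad_act g x + quad_act g y" for g x y
    by (auto simp: quad_act_def split_beta additive.add[OF additive_lshift] prod_eq_iff)
  show "quad_act g (quad_act h m) = quad_act (g * h) m" for g h m
    by (auto simp: quad_act_def split_beta lshift_lshift)
  show "quad_act g m \<in> quad_mod q" if "m \<in> quad_mod q" for m g q
    using that by (auto simp: quad_act_def quad_mod_def)
  show "additive_subgroup_set (quad_mod q)" for q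
    by (auto simp: additive_subgroup_set_def quad_mod_def zero_prod_def)
  show "quad_d q (x + y) = quad_d q x + quad_d q y" for q x y
    by (simp add: quad_d_def additive.add[OF d_even_additive] additive.add[OF d_odd_additive])
  show "quad_d q m \<in> quad_mod (Suc q)" if "m \<in> quad_mod q" for m q
    using that by (auto simp: quad_d_def quad_mod_def d_even_def zero_fun_def split_beta)
  show "quad_d q (quad_act g m) = quad_act g (quad_d q m)" for q g m
    by (auto simp: quad_d_def d_even_def d_odd_def quad_act_def lshift_def split_beta mult.assoc)
  show "quad_d (Suc q) (quad_d q m) = 0" if "m \<in> quad_mod q" for m q
    by (simp add: quad_d_def d_even_d_odd d_odd_d_even)
  show "\<exists>n\<in>quad_mod q. quad_d q n = m" if m: "m \<in> quad_mod (Suc q)" "quad_d (Suc q) m = 0" for m q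
  proof -
    consider "q = 0" | "q = 1" | "q > 1" "even q" | "q > 1" "odd q" by linarith
    then show ?thesis
    proof cases
      case 1
      then obtain \<alpha> \<beta> \<gamma> where "m = (\<alpha>, \<beta>, \<gamma>, 0)" using m(1) by (auto simp: quad_mod_def)
      then show ?thesis using d_odd_exact_1[of \<alpha> \<beta> \<gamma>] m(2) 1 by (auto simp: quad_d_def quad_mod_def)
    next
      case 2
      then show ?thesis using d_even_exact_2[of m] m(2) by (fastforce simp: quad_d_def quad_mod_def)
    next
      case 3
      then show ?thesis using d_odd_exact[of m] m(2) by (auto simp: quad_d_def quad_mod_def)
    next
      case 4
      then show ?thesis using d_even_exact[of m] m(2) by (auto simp: quad_d_def quad_mod_def)
    qed
  qed
  show "((0, 0, 0, \<lambda>_. k + l) :: quad) = (0, 0, 0, \<lambda>_. k) + (0, 0, 0, \<lambda>_. l)" for k l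
    by (simp add: fun_eq_iff)
  show "k = 0" if "((0, 0, 0, \<lambda>_. k) :: quad) = 0" for k
    using that by (simp add: zero_prod_def fun_eq_iff)
  show "(0, 0, 0, \<lambda>_. k) \<in> quad_mod 0" for k by (simp add: quad_mod_def)
  show "quad_d 0 (0, 0, 0, \<lambda>_. k) = 0" for k by (simp add: quad_d_def d_even_def zero_prod_def fun_eq_iff)
  show "quad_act g (0, 0, 0, \<lambda>_. k) = (0, 0, 0, \<lambda>_. k)" for g k
    by (simp add: quad_act_def) (simp add: lshift_def)
  show "\<exists>k. (0, 0, 0, \<lambda>_. k) = m" if m: "m \<in> quad_mod 0" "quad_d 0 m = 0" for m
  proof -
    obtain u where u: "m = (0, 0, 0, u)" using m(1) by (auto simp: quad_mod_def)
    then have inv: "u (g * ga) = u g" "u (g * gb) = u g" "u (g * gc) = u g" for g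
      using m(2) by (auto simp: quad_d_def d_even_def zero_prod_def fun_eq_iff)
    define k where "k = u 1"
    have "u g = k" for g unfolding k_def by (rule generators_invariant_const[of u g]) (rule inv)+
    then have "u = (\<lambda>_. k)" by (rule ext)
    then show ?thesis using u by blast
  qed
  show "\<exists>E\<in>cochain (quad_mod q) p. cob quad_act E = F"
    if "F \<in> cochain (quad_mod q) (Suc p)" "cob quad_act F = 0" for F q p
    by (rule quad_acyclic[OF that])
qed

section \<open>The cohomology groups\<close>

definition const4 :: "int \<Rightarrow> int \<Rightarrow> int \<Rightarrow> int \<Rightarrow> quad"
  where "const4 x y z w = ((\<lambda>_. x), (\<lambda>_. y), (\<lambda>_. z), (\<lambda>_. w))"

lemma const4_eq_iff [simp]: "const4 x y z w = const4 x' y' z' w' \<longleftrightarrow> x = x' \<and> y = y' \<and> z = z' \<and> w = w'"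
  by (simp add: const4_def fun_eq_iff)

lemma const4_0: "0 = const4 0 0 0 0"
  by (simp add: const4_def zero_prod_def zero_fun_def)

lemma const4_add: "const4 x y z w + const4 x' y' z' w' = const4 (x + x') (y + y') (z + z') (w + w')"
  by (simp add: const4_def fun_eq_iff)

text \<open>The coefficients are the exponent sums of the relations, \<open>1, 2, 2\<close> for
  \<open>babcac = a\<close>; the \<open>2 * w\<close> is the norm of \<open>gz\<close>.\<close>

lemma d_odd_const4:
  "d_odd (const4 x y z w) = const4 (2 * x - 3 * y) (2 * x - 3 * z) (x + 2 * y + 2 * z + 2 * w) (4 * x)"
  by (simp add: const4_def d_odd_def fun_eq_iff)

lemma d_even_const4: "d_even (const4 x y z w) = 0"
  by (simp add: const4_def d_even_def fun_eq_iff zero_prod_def)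

lemma Inv_iff: "m \<in> res.Inv q \<longleftrightarrow>
  (\<exists>x y z w. m = const4 x y z w \<and> (q = 0 \<longrightarrow> x = 0 \<and> y = 0 \<and> z = 0) \<and> (q = 1 \<longrightarrow> w = 0))"
proof -
  obtain \<alpha> \<beta> \<gamma> \<phi> where m: "m = (\<alpha>, \<beta>, \<gamma>, \<phi>)" by (cases m)
  have "(\<forall>g. quad_act g m = m) \<longleftrightarrow> (\<exists>x. \<alpha> = (\<lambda>_. x)) \<and> (\<exists>y. \<beta> = (\<lambda>_. y)) \<and> (\<exists>z. \<gamma> = (\<lambda>_. z)) \<and> (\<exists>w. \<phi> = (\<lambda>_. w))"
    unfolding lshift_invariant_iff[symmetric] by (auto simp: m quad_act_def)
  then show ?thesis
    by (auto simp: res.Inv_def m quad_mod_def const4_def zero_fun_def fun_eq_iff)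
qed

lemma cohomology_iso:
  "integral_cohomology SL2_Z_half (Suc n) \<cong>
    quot_group {m \<in> res.Inv (Suc n). quad_d (Suc n) m = 0} (quad_d n ` res.Inv n)"
  by (rule res.integral_cohomology_iso_invariants[OF bij_betw_Rep_slh Rep_slh_mult])

lemma cohomology_odd:
  assumes "odd i"
  shows "trivial_group (integral_cohomology SL2_Z_half i)"
proof -
  obtain n where n: "i = Suc n" "even n" using assms by (cases i) auto
  have Z: "{m \<in> res.Inv (Suc n). quad_d (Suc n) m = 0} = {0}"
    using n(2) by (auto simp: Inv_iff quad_d_def d_odd_const4 const4_0)
  have B: "quad_d n ` res.Inv n = {0}"
    using n(2) by (force simp: Inv_iff quad_d_def d_even_const4 const4_0 image_iff)
  have 0: "additive_subgroup_set {0 :: quad}" by (simp add: additive_subgroup_set_def)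
  have "quot_group {0 :: quad} {0} \<cong> singleton_group ()"
    by (rule quot_group_iso_hom[OF 0 singleton_group, where \<theta> = "\<lambda>_. ()"])
      (auto simp: singleton_group_def)
  then have iso: "integral_cohomology SL2_Z_half i \<cong> singleton_group ()"
    using iso_trans[OF cohomology_iso[of n, unfolded Z B]] n(1) by simp
  have grp: "group (integral_cohomology SL2_Z_half i)"
    unfolding n(1) by (rule res.group_integral_cohomology[OF bij_betw_Rep_slh Rep_slh_mult])
  have "trivial_group (singleton_group ())"
    unfolding trivial_group_def by (intro conjI singleton_group) (simp add: singleton_group_def)
  then show ?thesis
    by (simp only: isomorphic_group_triviality[OF iso grp singleton_group])
qed

lemma cocycles_even:
  assumes "odd n"
  shows "{m \<in> res.Inv (Suc n). quad_d (Suc n) m = 0} = {m. \<exists>x y z w. m = const4 x y z w}"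
  using assms by (auto simp: Inv_iff quad_d_def d_even_const4)

lemma const4_subgroup: "additive_subgroup_set {m. \<exists>x y z w. m = const4 x y z w}"
proof -
  have "const4 x y z w - const4 x' y' z' w' = const4 (x - x') (y - y') (z - z') (w - w')" for x y z w x' y' z' w'
    by (simp add: const4_def fun_eq_iff)
  then show ?thesis unfolding additive_subgroup_set_def using const4_0 by blast
qed

lemma cohomology_2: "integral_cohomology SL2_Z_half 2 \<cong> integer_group \<times>\<times> integer_mod_group 3"
proof -
  \<comment> \<open>The image is spanned by \<open>(2, 2, 1, 4)\<close>,
    \<open>(-3, 0, 2, 0)\<close> and \<open>(0, -3, 2, 0)\<close>. The form with coefficients
    \<open>8, 8, 12, -11\<close> spans its annihilator; the residue detects the torsion.\<close>
  define \<theta> :: "quad \<Rightarrow> int \<times> int" where "\<theta> = (\<lambda>(r, s, f, u).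
    (8 * r 1 + 8 * s 1 + 12 * f 1 - 11 * u 1, (r 1 - s 1) mod 3))"
  have \<theta>: "\<theta> (const4 x y z w) = (8 * x + 8 * y + 12 * z - 11 * w, (x - y) mod 3)" for x y z w
    by (simp add: \<theta>_def const4_def)
  have "quot_group {m. \<exists>x y z w. m = const4 x y z w} (quad_d 1 ` res.Inv 1) \<cong> integer_group \<times>\<times> integer_mod_group 3"
  proof (rule quot_group_iso_hom[OF const4_subgroup, where \<theta> = \<theta>])
    show "group (integer_group \<times>\<times> integer_mod_group 3)" by (simp add: DirProd_group)
    fix m assume m: "m \<in> {m. \<exists>x y z w. m = const4 x y z w}"
    then obtain x y z w where xyzw: "m = const4 x y z w" by blast
    show "\<theta> m \<in> carrier (integer_group \<times>\<times> integer_mod_group 3)"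
      by (simp add: xyzw \<theta> integer_group_def integer_mod_group_def)
    have B: "quad_d 1 ` res.Inv 1 = {m. \<exists>a b c. m = d_odd (const4 a b c 0)}"
    proof -
      have I: "m \<in> res.Inv 1 \<longleftrightarrow> (\<exists>x y z. m = const4 x y z 0)" for m unfolding Inv_iff by simp
      have D: "quad_d 1 = d_odd" by (simp add: quad_d_def)
      show ?thesis unfolding D image_def Bex_def I by blast
    qed
    have "m \<in> quad_d 1 ` res.Inv 1 \<longleftrightarrow>
        (\<exists>a b c. x = 2 * a - 3 * b \<and> y = 2 * a - 3 * c \<and> z = a + 2 * b + 2 * c \<and> w = 4 * a)"
      unfolding B by (simp add: xyzw d_odd_const4)
    also have "\<dots> \<longleftrightarrow> 8 * x + 8 * y + 12 * z - 11 * w = 0 \<and> (x - y) mod 3 = 0"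
    proof
      assume "\<exists>a b c. x = 2 * a - 3 * b \<and> y = 2 * a - 3 * c \<and> z = a + 2 * b + 2 * c \<and> w = 4 * a"
      then show "8 * x + 8 * y + 12 * z - 11 * w = 0 \<and> (x - y) mod 3 = 0" by auto
    next
      assume *: "8 * x + 8 * y + 12 * z - 11 * w = 0 \<and> (x - y) mod 3 = 0"
      then obtain k where k: "x - y = 3 * k" by (auto simp: mod_eq_0_iff_dvd elim!: dvdE)
      \<comment> \<open>\<open>4 * a = 12 * w - 11 * w = w\<close> by the linear equation;
        \<open>b\<close> comes from adding the equations for \<open>x\<close> and \<open>z\<close>
        with \<open>c = b + k\<close>.\<close>
      define a where "a = 3 * w - 2 * x - 2 * y - 3 * z"
      define b where "b = x + z - 3 * a - 2 * k"
      have a: "w = 4 * a" using * by (simp add: a_def)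
      then have "2 * x + 2 * y + 3 * z = 11 * a" using * by simp
      then have "x = 2 * a - 3 * b" "y = 2 * a - 3 * (b + k)" "z = a + 2 * b + 2 * (b + k)"
        using k by (simp_all add: b_def)
      then show "\<exists>a b c. x = 2 * a - 3 * b \<and> y = 2 * a - 3 * c \<and> z = a + 2 * b + 2 * c \<and> w = 4 * a"
        using a by blast
    qed
    finally show "\<theta> m = \<one>\<^bsub>integer_group \<times>\<times> integer_mod_group 3\<^esub> \<longleftrightarrow> m \<in> quad_d 1 ` res.Inv 1"
      by (simp add: xyzw \<theta> integer_group_def integer_mod_group_def)
  next
    fix m m' :: quad
    assume "m \<in> {m. \<exists>x y z w. m = const4 x y z w}" "m' \<in> {m. \<exists>x y z w. m = const4 x y z w}"
    then show "\<theta> (m + m') = \<theta> m \<otimes>\<^bsub>integer_group \<times>\<times> integer_mod_group 3\<^esub> \<theta> m'"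
      by (auto simp: const4_add \<theta> integer_group_def integer_mod_group_def mod_add_eq algebra_simps)
  next
    fix h assume "h \<in> carrier (integer_group \<times>\<times> integer_mod_group 3)"
    then obtain a b where "h = (a, b)" "0 \<le> b" "b < 3" by (auto simp: integer_mod_group_def)
    then have "\<theta> (const4 (2 * b) b (a - 2 * b) a) = h" by (simp add: \<theta>)
    then show "\<exists>m\<in>{m. \<exists>x y z w. m = const4 x y z w}. \<theta> m = h" by blast
  next
    show "quad_d 1 ` res.Inv 1 \<subseteq> {m. \<exists>x y z w. m = const4 x y z w}"
      by (auto simp: Inv_iff quad_d_def d_odd_const4)
  qed
  then show ?thesis
    using iso_trans[OF cohomology_iso[of 1]] cocycles_even[of 1] by (simp add: numeral_2_eq_2)
qed

lemma cohomology_even: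
  assumes "j > 1"
  shows "integral_cohomology SL2_Z_half (2 * j) \<cong> integer_mod_group 24 \<times>\<times> integer_mod_group 3"
proof -
  define n where "n = 2 * j - 1"
  have n: "2 * j = Suc n" "odd n" "n > 1" using assms by (auto simp: n_def)
  \<comment> \<open>Now \<open>\<phi>\<close> adds \<open>(0, 0, 2, 0)\<close> to the image, on
    which the integral form used in degree two takes the value 24. The simpler form here is a
    multiple of 24 on all four spanning vectors, and the determinant has absolute value 72.\<close>
  define \<theta> :: "quad \<Rightarrow> int \<times> int" where "\<theta> = (\<lambda>(r, s, f, u).
    ((u 1 - 8 * s 1 + 12 * f 1) mod 24, (r 1 - s 1) mod 3))"
  have \<theta>: "\<theta> (const4 x y z w) = ((w - 8 * y + 12 * z) mod 24, (x - y) mod 3)" for x y z w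
    by (simp add: \<theta>_def const4_def)
  have "quot_group {m. \<exists>x y z w. m = const4 x y z w} (quad_d n ` res.Inv n) \<cong> integer_mod_group 24 \<times>\<times> integer_mod_group 3"
  proof (rule quot_group_iso_hom[OF const4_subgroup, where \<theta> = \<theta>])
    show "group (integer_mod_group 24 \<times>\<times> integer_mod_group 3)" by (simp add: DirProd_group)
    fix m assume m: "m \<in> {m. \<exists>x y z w. m = const4 x y z w}"
    then obtain x y z w where xyzw: "m = const4 x y z w" by blast
    show "\<theta> m \<in> carrier (integer_mod_group 24 \<times>\<times> integer_mod_group 3)"
      by (simp add: xyzw \<theta> integer_mod_group_def)
    have B: "quad_d n ` res.Inv n = {m. \<exists>a b c e. m = d_odd (const4 a b c e)}"
    proof -
      have I: "m \<in> res.Inv n \<longleftrightarrow> (\<exists>x y z w. m = const4 x y z w)" for m unfolding Inv_iff using n by simp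
      have D: "quad_d n = d_odd" using n by (simp add: quad_d_def)
      show ?thesis unfolding D image_def Bex_def I by blast
    qed
    have "m \<in> quad_d n ` res.Inv n \<longleftrightarrow>
        (\<exists>a b c e. x = 2 * a - 3 * b \<and> y = 2 * a - 3 * c \<and> z = a + 2 * b + 2 * c + 2 * e \<and> w = 4 * a)"
      unfolding B by (simp add: xyzw d_odd_const4)
    also have "\<dots> \<longleftrightarrow> (w - 8 * y + 12 * z) mod 24 = 0 \<and> (x - y) mod 3 = 0"
    proof
      assume "\<exists>a b c e. x = 2 * a - 3 * b \<and> y = 2 * a - 3 * c \<and> z = a + 2 * b + 2 * c + 2 * e \<and> w = 4 * a"
      then obtain a b c e where "x = 2 * a - 3 * b" "y = 2 * a - 3 * c" "z = a + 2 * b + 2 * c + 2 * e" "w = 4 * a"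
        by blast
      then have "w - 8 * y + 12 * z = 24 * (b + 2 * c + e)" "x - y = 3 * (c - b)" by simp_all
      then show "(w - 8 * y + 12 * z) mod 24 = 0 \<and> (x - y) mod 3 = 0" by (metis mod_mult_self1_is_0)
    next
      assume *: "(w - 8 * y + 12 * z) mod 24 = 0 \<and> (x - y) mod 3 = 0"
      then obtain k l where k: "w - 8 * y + 12 * z = 24 * k" and l: "x - y = 3 * l"
        by (auto simp: mod_eq_0_iff_dvd elim!: dvdE)
      \<comment> \<open>Obtained by solving \<open>w = 4 * a\<close> and
        \<open>y = 2 * a - 3 * c\<close> with \<open>w\<close> eliminated through \<open>k\<close>;
        then \<open>b = c - l\<close>, and \<open>e\<close> takes up the rest of \<open>z\<close>,
        which is even since \<open>z - a\<close> is.\<close>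
      define a where "a = 6 * k + 2 * y - 3 * z"
      define c where "c = y - 2 * z + 4 * k"
      have "w = 4 * a" "y = 2 * a - 3 * c" "x = 2 * a - 3 * (c - l)"
        "z = a + 2 * (c - l) + 2 * c + 2 * (2 * z - y - 3 * k - (c - l) - c)"
        using k l by (simp_all add: a_def c_def)
      then show "\<exists>a b c e. x = 2 * a - 3 * b \<and> y = 2 * a - 3 * c \<and> z = a + 2 * b + 2 * c + 2 * e \<and> w = 4 * a"
        by blast
    qed
    finally show "\<theta> m = \<one>\<^bsub>integer_mod_group 24 \<times>\<times> integer_mod_group 3\<^esub> \<longleftrightarrow> m \<in> quad_d n ` res.Inv n"
      by (simp add: xyzw \<theta> integer_mod_group_def)
  next
    fix m m' :: quad
    assume "m \<in> {m. \<exists>x y z w. m = const4 x y z w}" "m' \<in> {m. \<exists>x y z w. m = const4 x y z w}"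
    then show "\<theta> (m + m') = \<theta> m \<otimes>\<^bsub>integer_mod_group 24 \<times>\<times> integer_mod_group 3\<^esub> \<theta> m'"
      by (auto simp: const4_add \<theta> integer_mod_group_def mod_add_eq algebra_simps)
  next
    fix h assume "h \<in> carrier (integer_mod_group 24 \<times>\<times> integer_mod_group 3)"
    then obtain a b where "h = (a, b)" "0 \<le> b" "b < 3" "0 \<le> a" "a < 24" by (auto simp: integer_mod_group_def)
    then have "\<theta> (const4 b 0 0 a) = h" by (simp add: \<theta>)
    then show "\<exists>m\<in>{m. \<exists>x y z w. m = const4 x y z w}. \<theta> m = h" by blast
  next
    show "quad_d n ` res.Inv n \<subseteq> {m. \<exists>x y z w. m = const4 x y z w}"
      using n by (auto simp: Inv_iff quad_d_def d_odd_const4)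
  qed
  then show ?thesis
    using iso_trans[OF cohomology_iso[of n]] cocycles_even[OF n(2)] n(1) by simp
qed

theorem mainTheorem3:
  fixes i :: nat
  shows "(odd i \<longrightarrow> trivial_group (integral_cohomology SL2_Z_half i))
    \<and> (i = 2 \<longrightarrow>
        integral_cohomology SL2_Z_half i \<cong> integer_group \<times>\<times> integer_mod_group 3)
    \<and> (\<forall>j. i = 2 * j \<and> j > 1 \<longrightarrow>
        integral_cohomology SL2_Z_half i \<cong> integer_mod_group 24 \<times>\<times> integer_mod_group 3)"
  by (auto intro: cohomology_odd cohomology_2 cohomology_even)

end
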